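(* Let $d\ge1$, $\gamma\in\mathbb{R}\setminus\{0\}$, and let $Z$ be the interacting branching diffusion in $\mathbb{R}^d$ with drift parameter $b$ and interaction parameter $\gamma$. Assume that $b>0$ and $b+\gamma>0$. Then, almost surely, as $n\to\infty$ through the integers, the measures $2^{-n}Z_n(\mathrm{d}y)$ converge weakly to the probability measure $$\left(\frac{\gamma+b}{\pi}\right)^{d/2}\exp\left(-(\gamma+b)|y|^2\right)\mathrm{d}y$$ on $\mathbb{R}^d$.
   Context: Model. Fix $d\ge1$, $b\in\mathbb{R}$ and $\gamma\neq 0$. The process $Z$ starts at time $0$ with one particle at the origin of $\mathbb{R}^d$. For each $m=0,1,2,\dots$, during the time interval $[m,m+1)$ there are exactly $2^m$ particles, with positions $Z_t^i$, $1\le i\le 2^m$; at each integer time $m\ge 1$ every particle is replaced by exactly two offspring, located at the parent's position (labels are arbitrary but independent of the spatial motion). On $[m,m+1)$ the positions satisfy $$\mathrm{d}Z_t^i = \mathrm{d}W_t^{i,m} - bZ_t^i\,\mathrm{d}t + \frac{1}{2^m}\sum_{j=1}^{2^m}\gamma\,(Z_t^j-Z_t^i)\,\mathrm{d}t,\qquad 1\le i\le 2^m,$$ where $\{W^{i,m}\}_{1\le i\le 2^m}$ are independent standard $d$-dimensional Brownian motions on $[m,m+1)$, also independent of the past up to time $m$. The associated discrete measure-valued process is $Z_t(\mathrm{d}y):=\sum_{i=1}^{2^{\lfloor t\rfloor}}\delta_{Z_t^i}(\mathrm{d}y)$. *)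

theory Defs
  imports "HOL-Probability.Probability"
begin

text \<open>
  The events generated by the random variables \<open>X t\<close>, \<open>t \<in> T\<close>, on the sample space of \<open>M\<close>.
\<close>

definition generated_events ::
    "'a measure \<Rightarrow> 's measure \<Rightarrow> ('t \<Rightarrow> 'a \<Rightarrow> 's) \<Rightarrow> 't set \<Rightarrow> 'a set set" where
  "generated_events M N X T =
     sigma_sets (space M) {X t -` A \<inter> space M | t A. t \<in> T \<and> A \<in> sets N}"

text \<open>
  The density below is that of the centred Gaussian vector with covariance \<open>(t - s) I\<close>;
  \<open>normal_density\<close> takes the standard deviation, not the variance.  Independence of increments
  is required along every finite increasing sequence \<open>\<tau> 0 \<le> \<dots> \<le> \<tau> n\<close> of times.
\<close>

definition standard_brownian_motion_on ::
    "'a measure \<Rightarrow> real \<Rightarrow> real \<Rightarrow> (real \<Rightarrow> 'a \<Rightarrow> real ^ 'd) \<Rightarrow> bool" where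
  "standard_brownian_motion_on M u v B \<longleftrightarrow>
     (\<forall>t\<in>{u..<v}. B t \<in> borel_measurable M) \<and>
     (AE \<omega> in M. B u \<omega> = 0) \<and>
     (AE \<omega> in M. continuous_on {u..<v} (\<lambda>t. B t \<omega>)) \<and>
     (\<forall>s\<in>{u..<v}. \<forall>t\<in>{u..<v}. s < t \<longrightarrow>
        distributed M lborel (\<lambda>\<omega>. B t \<omega> - B s \<omega>)
          (\<lambda>x. ennreal (\<Prod>k\<in>UNIV. normal_density 0 (sqrt (t - s)) (x $ k)))) \<and>
     (\<forall>(n::nat) \<tau>. (\<forall>k\<le>n. \<tau> k \<in> {u..<v}) \<and> (\<forall>k<n. \<tau> k \<le> \<tau> (Suc k)) \<longrightarrow>
        prob_space.indep_vars M (\<lambda>_. borel) (\<lambda>k \<omega>. B (\<tau> (Suc k)) \<omega> - B (\<tau> k) \<omega>) {..<n})"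

text \<open>
  Particles alive on \<open>[m, m+1)\<close> are labelled \<open>0, \<dots>, 2^m - 1\<close>.  The vector \<open>Z t i \<omega>\<close> is the
  position at time \<open>t\<close> of particle \<open>i\<close> (meaningful for \<open>i < 2 ^ nat \<lfloor>t\<rfloor>\<close> only), and \<open>W m i\<close>
  is its driving noise on \<open>[m, m+1)\<close>.  The labelling is a random genealogy: \<open>parent m i \<omega>\<close> is
  the label, among the \<open>2^m\<close> particles alive just before time \<open>m + 1\<close>, of the parent of the
  particle carrying label \<open>i < 2^(m+1)\<close> at time \<open>m + 1\<close>.
\<close>

definition motion_events ::
    "'a measure \<Rightarrow> (nat \<Rightarrow> nat \<Rightarrow> real \<Rightarrow> 'a \<Rightarrow> real ^ 'd) \<Rightarrow> nat \<Rightarrow> nat \<Rightarrow> 'a set set" where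
  "motion_events M W m i = generated_events M borel (W m i) {real m..<real (Suc m)}"

definition noise_events ::
    "'a measure \<Rightarrow> (nat \<Rightarrow> nat \<Rightarrow> real \<Rightarrow> 'a \<Rightarrow> real ^ 'd) \<Rightarrow> nat set \<Rightarrow> 'a set set" where
  "noise_events M W K = sigma_sets (space M) (\<Union>m\<in>K. \<Union>i<2^m. motion_events M W m i)"

definition genealogy_events ::
    "'a measure \<Rightarrow> (nat \<Rightarrow> nat \<Rightarrow> 'a \<Rightarrow> nat) \<Rightarrow> nat set \<Rightarrow> 'a set set" where
  "genealogy_events M parent K =
     generated_events M (count_space UNIV) (\<lambda>(m, i). parent m i)
       {(m, i). m \<in> K \<and> i < 2 ^ Suc m}"

text \<open>
  Everything observed up to and including time \<open>m\<close>, the branching at time \<open>m\<close> included.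
\<close>

definition past_events ::
    "'a measure \<Rightarrow> (nat \<Rightarrow> nat \<Rightarrow> real \<Rightarrow> 'a \<Rightarrow> real ^ 'd) \<Rightarrow> (nat \<Rightarrow> nat \<Rightarrow> 'a \<Rightarrow> nat) \<Rightarrow>
       (real \<Rightarrow> nat \<Rightarrow> 'a \<Rightarrow> real ^ 'd) \<Rightarrow> nat \<Rightarrow> 'a set set" where
  "past_events M W parent Z m =
     sigma_sets (space M)
       (generated_events M borel (\<lambda>(s, i). Z s i)
          {(s, i). 0 \<le> s \<and> s \<le> real m \<and> i < 2 ^ nat \<lfloor>s\<rfloor>}
        \<union> noise_events M W {..<m}
        \<union> genealogy_events M parent {..<m})"

text \<open>
  The noise is additive, so the stochastic differential equation is the pathwise integral
  equation \<open>sde\<close>.  By \<open>branching\<close>, offspring start from the left limit of the parent's path.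
\<close>

locale interacting_branching_diffusion = prob_space M
  for M :: "'a measure" +
  fixes b \<gamma> :: real
    and W :: "nat \<Rightarrow> nat \<Rightarrow> real \<Rightarrow> 'a \<Rightarrow> real ^ 'd"
    and parent :: "nat \<Rightarrow> nat \<Rightarrow> 'a \<Rightarrow> nat"
    and Z :: "real \<Rightarrow> nat \<Rightarrow> 'a \<Rightarrow> real ^ 'd"
  assumes brownian:
      "\<And>m i. i < 2 ^ m \<Longrightarrow>
         standard_brownian_motion_on M (real m) (real (Suc m)) (W m i)"
    and brownian_indep:
      "\<And>m. indep_sets (motion_events M W m) {..<2 ^ m}"
    and brownian_indep_past:
      "\<And>m. indep_set (noise_events M W {m}) (past_events M W parent Z m)"
    and parent_measurable:
      "\<And>m i. i < 2 ^ Suc m \<Longrightarrow> parent m i \<in> measurable M (count_space UNIV)"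
    and binary:
      "AE \<omega> in M. \<forall>m. (\<forall>i<2 ^ Suc m. parent m i \<omega> < 2 ^ m) \<and>
         (\<forall>j<2 ^ m. card {i. i < 2 ^ Suc m \<and> parent m i \<omega> = j} = 2)"
    and genealogy_indep:
      "indep_set (genealogy_events M parent UNIV) (noise_events M W UNIV)"
    and Z_measurable:
      "\<And>t i. 0 \<le> t \<Longrightarrow> i < 2 ^ nat \<lfloor>t\<rfloor> \<Longrightarrow> Z t i \<in> borel_measurable M"
    and Z_start:
      "AE \<omega> in M. Z 0 0 \<omega> = 0"
    and Z_continuous:
      "AE \<omega> in M. \<forall>m. \<forall>i<2 ^ m. continuous_on {real m..<real (Suc m)} (\<lambda>t. Z t i \<omega>)"
    and sde:
      "AE \<omega> in M. \<forall>m. \<forall>i<2 ^ m. \<forall>t\<in>{real m..<real (Suc m)}.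
         Z t i \<omega> = Z (real m) i \<omega> + (W m i t \<omega> - W m i (real m) \<omega>)
           + integral {real m..t} (\<lambda>s. - b *\<^sub>R Z s i \<omega>
               + (1 / 2 ^ m) *\<^sub>R (\<Sum>j<2 ^ m. \<gamma> *\<^sub>R (Z s j \<omega> - Z s i \<omega>)))"
    and branching:
      "AE \<omega> in M. \<forall>m. \<forall>i<2 ^ Suc m.
         ((\<lambda>t. Z t (parent m i \<omega>) \<omega>) \<longlongrightarrow> Z (real (Suc m)) i \<omega>) (at_left (real (Suc m)))"

text \<open>
  The image of counting measure on the labels is the sum of the Dirac masses at the particle
  positions, counted with multiplicity; see the lemma following the definition.
\<close>

definition particle_measure ::
    "(real \<Rightarrow> nat \<Rightarrow> 'a \<Rightarrow> real ^ 'd) \<Rightarrow> real \<Rightarrow> 'a \<Rightarrow> (real ^ 'd) measure" where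
  "particle_measure Z t \<omega> = distr (count_space {..<2 ^ nat \<lfloor>t\<rfloor>}) borel (\<lambda>i. Z t i \<omega>)"

lemma emeasure_particle_measure:
  assumes "A \<in> sets borel"
  shows "emeasure (particle_measure Z t \<omega>) A
           = (\<Sum>i<2 ^ nat \<lfloor>t\<rfloor>. emeasure (return borel (Z t i \<omega>)) A)"
proof -
  let ?I = "{..<2 ^ nat \<lfloor>t\<rfloor>} :: nat set"
  have "emeasure (particle_measure Z t \<omega>) A
      = emeasure (count_space ?I) ((\<lambda>i. Z t i \<omega>) -` A \<inter> ?I)"
    unfolding particle_measure_def using assms by (subst emeasure_distr) auto
  also have "\<dots> = of_nat (card {i \<in> ?I. Z t i \<omega> \<in> A})"
    by (subst emeasure_count_space_finite) (auto intro!: arg_cong[where f = card])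
  also have "\<dots> = (\<Sum>i\<in>?I. indicator A (Z t i \<omega>))"
    by (simp add: indicator_def sum.If_cases Int_def)
  finally show ?thesis
    using assms by simp
qed

definition weakly_converges ::
    "(nat \<Rightarrow> 's::topological_space measure) \<Rightarrow> 's measure \<Rightarrow> bool" where
  "weakly_converges \<mu> \<nu> \<longleftrightarrow>
     (\<forall>f :: 's \<Rightarrow> real. continuous_on UNIV f \<and> bounded (range f) \<longrightarrow>
        (\<lambda>n. integral\<^sup>L (\<mu> n) f) \<longlonglongrightarrow> integral\<^sup>L \<nu> f)"

definition limit_measure :: "real \<Rightarrow> real \<Rightarrow> (real ^ 'd) measure" where
  "limit_measure b \<gamma> = density lborel
     (\<lambda>y. ennreal (((\<gamma> + b) / pi) powr (real CARD('d) / 2) * exp (- (\<gamma> + b) * (norm y)\<^sup>2)))"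

end

theory Submission
  imports Defs "HOL-Real_Asymp.Real_Asymp"
begin

text \<open>
  Consider the barycentre of the particles and their deviations from it separately.  Averaging
  the equations cancels the interaction, so the barycentre relaxes to the origin at rate \<open>b\<close>;
  its noise is a mean of \<open>2 ^ m\<close> independent Brownian motions during generation \<open>m\<close>, hence
  the barycentre tends to \<open>0\<close> because \<open>b > 0\<close>.  The deviations satisfy linear equations with
  rate \<open>c = b + \<gamma>\<close>.  Branching replaces each particle by two at the same place and therefore
  leaves averages over the particles unchanged (\<open>generation_step\<close>).

  Fix a frequency \<open>\<xi>\<close> and a phase, and average \<open>cos (\<xi> \<bullet> y + \<theta>)\<close> over the deviations \<open>y\<close>.
  During one generation each deviation is multiplied by \<open>exp (- c)\<close> and receives Gaussian noise
  of variance \<open>(1 - exp (- 2 * c)) / (2 * c)\<close> in each coordinate.  So the average at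
  frequency \<open>\<xi>\<close> equals, up to a fluctuation of order \<open>norm \<xi> * 2 ^ (- m / 2)\<close> in mean square, a
  Gaussian factor \<open>q \<xi>\<close> times the previous average at the frequency \<open>exp (- c) *\<^sub>R \<xi>\<close>
  (\<open>centred_cosine_step\<close>).  The characteristic function
  \<open>g \<xi> = exp (- (norm \<xi>)\<^sup>2 / (4 * c))\<close> of the limit satisfies
  \<open>g \<xi> = q \<xi> * g (exp (- c) *\<^sub>R \<xi>)\<close>.  The error is thus transported to ever smaller frequencies,
  where it is quadratically small in mean square, while the fluctuations of later
  generations are small in their own right.  This gives a bound
  \<open>K * (norm \<xi>)\<^sup>2 * \<rho> ^ m\<close> with \<open>\<rho> < 1\<close> for the second moment of the error
  (\<open>contraction_recursion_second_moment\<close>, \<open>cosine_error_second_moment\<close>).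

  The bound is summable in \<open>m\<close>, so the averages converge almost surely at all rational
  frequencies.  Being quadratic in \<open>\<xi>\<close>, it is also summable over dyadic frequencies, and this
  makes the sequence of empirical measures almost surely tight
  (\<open>dyadic_cosine_error_bounded\<close>, \<open>dyadic_tail_bound\<close>).  Weak convergence follows by folding the
  space into a cube with triangle waves and approximating by polynomials in sines
  (\<open>weakly_converges_of_trig_averages\<close>).

  Stochastic integrals are avoided: the noises of the barycentre and of the deviations are limits of
  weighted sums of Brownian increments (\<open>linear_sde_stieltjes_limit\<close>), whose laws are explicit,
  and Fatou's lemma passes the second-moment bounds to the limit.
\<close>

section \<open>Weak convergence from averages of cosines\<close>

text \<open>
  This class is an algebra, so that polynomials in the sines of the coordinates belong to it.
  Its frequencies form a countable set: an almost sure statement about each of them holds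
  almost surely for all of them at once.
\<close>

inductive_set rational_trig_sums :: "((real ^ 'd) \<Rightarrow> real) set" where
  wave: "(\<And>k. \<xi> $ k \<in> \<rat>) \<Longrightarrow> (\<lambda>x. a * cos (\<xi> \<bullet> x + \<theta>)) \<in> rational_trig_sums"
| add: "f \<in> rational_trig_sums \<Longrightarrow> g \<in> rational_trig_sums \<Longrightarrow> (\<lambda>x. f x + g x) \<in> rational_trig_sums"

lemma rational_trig_sums_mult:
  assumes "f \<in> rational_trig_sums" "g \<in> rational_trig_sums"
  shows "(\<lambda>x. f x * g x) \<in> rational_trig_sums"
  using assms
proof (induction arbitrary: g)
  case (wave \<xi> a \<theta>)
  note \<xi> = wave(1)
  from wave(2) show ?case
  proof (induction)
    case (wave \<xi>' a' \<theta>')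
    have "(\<lambda>x. a * cos (\<xi> \<bullet> x + \<theta>) * (a' * cos (\<xi>' \<bullet> x + \<theta>')))
       = (\<lambda>x. a * a' / 2 * cos ((\<xi> - \<xi>') \<bullet> x + (\<theta> - \<theta>')) + a * a' / 2 * cos ((\<xi> + \<xi>') \<bullet> x + (\<theta> + \<theta>')))"
    proof
      fix x
      have "cos (\<xi> \<bullet> x + \<theta>) * cos (\<xi>' \<bullet> x + \<theta>')
         = (cos ((\<xi> - \<xi>') \<bullet> x + (\<theta> - \<theta>')) + cos ((\<xi> + \<xi>') \<bullet> x + (\<theta> + \<theta>'))) / 2"
        by (subst cos_times_cos) (simp add: inner_diff_left inner_add_left algebra_simps)
      then show "a * cos (\<xi> \<bullet> x + \<theta>) * (a' * cos (\<xi>' \<bullet> x + \<theta>')) =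
         a * a' / 2 * cos ((\<xi> - \<xi>') \<bullet> x + (\<theta> - \<theta>')) + a * a' / 2 * cos ((\<xi> + \<xi>') \<bullet> x + (\<theta> + \<theta>'))"
        by (simp add: field_simps)
    qed
    also have "\<dots> \<in> rational_trig_sums"
      by (intro rational_trig_sums.intros) (use wave \<xi> in auto)
    finally show ?case .
  next
    case (add f g)
    show ?case using rational_trig_sums.add[OF add.IH] by (simp add: distrib_left)
  qed
next
  case (add f h)
  show ?case using rational_trig_sums.add[OF add.IH(1,2)[OF add.prems]] by (simp add: distrib_right)
qed

lemma rational_trig_sums_const: "(\<lambda>x. a) \<in> rational_trig_sums"
  using rational_trig_sums.wave[of 0 a 0] by simp

lemma rational_trig_sums_sum:
  "(\<And>i. i \<in> I \<Longrightarrow> f i \<in> rational_trig_sums) \<Longrightarrow> (\<lambda>x. \<Sum>i\<in>I. f i x) \<in> rational_trig_sums"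
  by (induction I rule: infinite_finite_induct)
     (auto intro: rational_trig_sums.add rational_trig_sums_const)

lemma rational_trig_sums_sin:
  assumes "q \<in> \<rat>"
  shows "(\<lambda>x :: real ^ 'd. a * sin (q * x $ k)) \<in> rational_trig_sums"
proof -
  have "(\<lambda>x :: real ^ 'd. a * cos ((\<chi> i. if i = k then q else 0) \<bullet> x + (- (pi/2)))) \<in> rational_trig_sums"
    by (intro rational_trig_sums.wave) (use assms in auto)
  moreover have "(\<chi> i. if i = k then q else 0) \<bullet> x = q * x $ k" for x :: "real ^ 'd"
    by (simp add: inner_vec_def if_distrib[of "\<lambda>z. z * _"] cong: if_cong)
  moreover have "cos (y + (- (pi/2))) = sin y" for y :: real
    by (simp add: cos_diff)
  ultimately show ?thesis by simp
qed

lemma real_polynomial_of_sines_trig: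
  fixes p :: "real ^ 'd \<Rightarrow> real"
  assumes "real_polynomial_function p" and "q \<in> \<rat>"
  shows "(\<lambda>x. p (\<chi> k. sin (q * x $ k))) \<in> rational_trig_sums"
  using assms(1)
proof induction
  case (linear h)
  interpret h: bounded_linear h by fact
  have "h (\<chi> k. sin (q * x $ k)) = (\<Sum>k\<in>UNIV. h (axis k 1) * sin (q * x $ k))" for x :: "real ^ 'd"
  proof -
    have "h (\<chi> k. sin (q * x $ k)) = h (\<Sum>k\<in>UNIV. sin (q * x $ k) *\<^sub>R axis k 1)"
      by (subst basis_expansion[of "\<chi> k. sin (q * x $ k)", symmetric]) (simp add: scalar_mult_eq_scaleR)
    then show ?thesis by (simp add: h.sum h.scaleR mult.commute)
  qed
  then show ?case by (simp add: rational_trig_sums_sum rational_trig_sums_sin[OF assms(2)])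
next
  case (const c)
  show ?case by (rule rational_trig_sums_const)
qed (auto intro: rational_trig_sums.add rational_trig_sums_mult)

lemma rational_trig_sums_bounded_continuous:
  assumes "f \<in> rational_trig_sums"
  shows "continuous_on UNIV f" and "\<exists>C. \<forall>x. \<bar>f x\<bar> \<le> C"
  using assms
proof induction
  case (wave \<xi> a \<theta>)
  show "continuous_on UNIV (\<lambda>x. a * cos (\<xi> \<bullet> x + \<theta>))" by (intro continuous_intros)
  have "\<bar>a * cos (\<xi> \<bullet> x + \<theta>)\<bar> \<le> \<bar>a\<bar> * 1" for x
    unfolding abs_mult by (intro mult_left_mono) auto
  then show "\<exists>C. \<forall>x. \<bar>a * cos (\<xi> \<bullet> x + \<theta>)\<bar> \<le> C" by blast
next
  case (add f g)
  from add.IH(1,3) show "continuous_on UNIV (\<lambda>x. f x + g x)" by (intro continuous_intros)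
  from add.IH(2,4) obtain C D where "\<forall>x. \<bar>f x\<bar> \<le> C" "\<forall>x. \<bar>g x\<bar> \<le> D" by blast
  then have "\<forall>x. \<bar>f x + g x\<bar> \<le> C + D" using abs_triangle_ineq add_mono order_trans by blast
  then show "\<exists>C. \<forall>x. \<bar>f x + g x\<bar> \<le> C" by blast
qed

lemma integrable_bounded_continuous:
  fixes f :: "'b::topological_space \<Rightarrow> real"
  assumes "prob_space \<mu>" "sets \<mu> = sets borel" "continuous_on UNIV f" "\<And>x. \<bar>f x\<bar> \<le> C"
  shows "integrable \<mu> f"
proof -
  interpret prob_space \<mu> by fact
  have "f \<in> borel_measurable \<mu>"
    using borel_measurable_continuous_onI[OF assms(3)] measurable_cong_sets[OF assms(2) refl] by blast
  then show ?thesis by (rule integrable_const_bound[where B = C, rotated]) (use assms(4) in auto)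
qed

text \<open>
  The triangle wave \<open>t \<mapsto> N arcsin (sin (t / N))\<close> is the identity on \<open>[- N pi / 2, N pi / 2]\<close>.
  Applied to each coordinate it folds the space into a cube, and after folding \<open>f\<close> is a
  continuous function of the sines.  The Stone-Weierstrass theorem for the cube of the values of
  the sines therefore gives an approximation that is uniform on the whole space; a trigonometric
  approximation of \<open>f\<close> on a compact set alone would give no control outside that set.
\<close>

lemma trig_approximation_of_folding:
  fixes f :: "real ^ 'd \<Rightarrow> real"
  assumes f: "continuous_on UNIV f" and e: "e > 0" and N: "N > (0::nat)"
  obtains p where "p \<in> rational_trig_sums"
    "\<And>x. \<bar>p x - f (\<chi> k. real N * arcsin (sin (x $ k / real N)))\<bar> \<le> e"
proof -
  let ?g = "\<lambda>s :: real ^ 'd. f (\<chi> k. real N * arcsin (s $ k))"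
  let ?S = "cbox (\<chi> k. -1) (\<chi> k. 1) :: (real ^ 'd) set"
  have "continuous_on ?S ?g"
    by (intro continuous_on_compose2[OF f] continuous_intros continuous_on_vec_lambda ballI)
       (auto simp: mem_box_cart)
  then obtain P where P: "real_polynomial_function P" "\<And>s. s \<in> ?S \<Longrightarrow> \<bar>?g s - P s\<bar> < e"
    using Stone_Weierstrass_real_polynomial_function[of ?S ?g e] e by (metis compact_cbox)
  have "(\<lambda>x. P (\<chi> k. sin (1 / real N * x $ k))) \<in> rational_trig_sums"
    by (rule real_polynomial_of_sines_trig[OF P(1)]) auto
  moreover have "\<bar>P (\<chi> k. sin (1 / real N * x $ k)) - f (\<chi> k. real N * arcsin (sin (x $ k / real N)))\<bar> \<le> e" for x
    using P(2)[of "\<chi> k. sin (1 / real N * x $ k)"] by (auto simp: mem_box_cart abs_minus_commute)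
  ultimately show ?thesis by (rule that)
qed

text \<open>
  On a large cube \<open>f\<close> agrees with its folding, which is uniformly close to a trigonometric sum.
  Outside the cube the difference is at most twice the bound of \<open>f\<close>, and tightness makes the
  mass there small, uniformly in \<open>n\<close>.
\<close>

theorem weakly_converges_of_trig_averages:
  fixes \<mu> :: "nat \<Rightarrow> (real ^ 'd) measure"
  assumes p\<mu>: "\<And>n. prob_space (\<mu> n)" and s\<mu>: "\<And>n. sets (\<mu> n) = sets borel"
    and p\<nu>: "prob_space \<nu>" and s\<nu>: "sets \<nu> = sets borel"
    and trig: "\<And>\<xi> \<theta>. (\<And>k. \<xi> $ k \<in> \<rat>) \<Longrightarrow>
       (\<lambda>n. \<integral>x. cos (\<xi> \<bullet> x + \<theta>) \<partial>\<mu> n) \<longlonglongrightarrow> (\<integral>x. cos (\<xi> \<bullet> x + \<theta>) \<partial>\<nu>)"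
    and tight: "\<And>e. e > 0 \<Longrightarrow> \<exists>R. \<forall>n. measure (\<mu> n) {x. \<exists>k. R \<le> \<bar>x $ k\<bar>} \<le> e"
  shows "weakly_converges \<mu> \<nu>"
proof -
  have trig_sum: "(\<lambda>n. integral\<^sup>L (\<mu> n) p) \<longlonglongrightarrow> integral\<^sup>L \<nu> p" if "p \<in> rational_trig_sums" for p
    using that
  proof induction
    case (wave \<xi> a \<theta>)
    show ?case using tendsto_mult_left[OF trig[OF wave], of a] by simp
  next
    case (add f g)
    note int = integrable_bounded_continuous[OF _ _ rational_trig_sums_bounded_continuous(1)]
    from rational_trig_sums_bounded_continuous(2)[OF add(1)] rational_trig_sums_bounded_continuous(2)[OF add(2)]
    obtain C D where CD: "\<And>x. \<bar>f x\<bar> \<le> C" "\<And>x. \<bar>g x\<bar> \<le> D" by blast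
    have "integral\<^sup>L m (\<lambda>x. f x + g x) = integral\<^sup>L m f + integral\<^sup>L m g"
      if "prob_space m" "sets m = sets borel" for m
      using int[OF that add(1) CD(1)] int[OF that add(2) CD(2)] by simp
    then show ?case using tendsto_add[OF add.IH] by (simp add: p\<mu> s\<mu> p\<nu> s\<nu>)
  qed
  have tail_sets: "{x :: real ^ 'd. \<exists>k. R \<le> \<bar>x $ k\<bar>} \<in> sets borel" for R
    by measurable
  have tight_lim: "\<exists>R. measure \<nu> {x. \<exists>k. R \<le> \<bar>x $ k\<bar>} \<le> e" if "e > 0" for e
  proof -
    interpret prob_space \<nu> by fact
    let ?A = "\<lambda>n. {x :: real ^ 'd. \<exists>k. real n \<le> \<bar>x $ k\<bar>}"
    have "(\<lambda>n. measure \<nu> (?A n)) \<longlonglongrightarrow> measure \<nu> (\<Inter>n. ?A n)"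
      by (rule finite_Lim_measure_decseq) (auto simp: s\<nu> tail_sets decseq_def intro: order_trans[OF of_nat_mono])
    also have "(\<Inter>n. ?A n) = {}"
    proof -
      have "\<exists>n. x \<notin> ?A n" for x :: "real ^ 'd"
      proof -
        obtain n where n: "norm x < real n" using reals_Archimedean2 by blast
        have "\<bar>x $ k\<bar> < real n" for k using component_le_norm_cart n by (rule le_less_trans)
        then have "x \<notin> ?A n" by (simp add: not_le)
        then show ?thesis by (rule exI)
      qed
      then show ?thesis by blast
    qed
    finally have "eventually (\<lambda>n. measure \<nu> (?A n) < e) sequentially"
      using that by (intro order_tendstoD(2)[of _ 0]) auto
    then obtain n where "measure \<nu> (?A n) < e" using eventually_happens'[OF sequentially_bot] by blast
    then show ?thesis by (blast intro: less_imp_le)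
  qed
  show ?thesis unfolding weakly_converges_def
  proof (intro allI impI)
    fix f :: "real ^ 'd \<Rightarrow> real"
    assume "continuous_on UNIV f \<and> bounded (range f)"
    then have f: "continuous_on UNIV f" and bf: "bounded (range f)" by auto
    from bf obtain S0 where S0: "\<And>x. \<bar>f x\<bar> \<le> S0" unfolding bounded_real by blast
    define S where "S = max S0 1"
    have S: "\<bar>f x\<bar> \<le> S" for x using S0[of x] by (simp add: S_def)
    have S1: "S > 0" by (simp add: S_def)
    show "(\<lambda>n. integral\<^sup>L (\<mu> n) f) \<longlonglongrightarrow> integral\<^sup>L \<nu> f"
    proof (rule LIMSEQ_I)
      fix r :: real assume r: "r > 0"
      define e where "e = r / 5 / (2 * S + 1)"
      have e: "e > 0" using r S1 by (simp add: e_def)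
      have "e * (2 * S + 1) = r / 5" by (rule iffD1[OF nonzero_eq_divide_eq e_def]) (use S1 in simp)
      then have re: "2 * (2 * S * e + e) < r" using r by (simp add: algebra_simps)
      obtain R1 where R1: "\<And>n. measure (\<mu> n) {x. \<exists>k. R1 \<le> \<bar>x $ k\<bar>} \<le> e" using tight[OF e] by blast
      obtain R2 where R2: "measure \<nu> {x. \<exists>k. R2 \<le> \<bar>x $ k\<bar>} \<le> e" using tight_lim[OF e] by blast
      obtain N0 :: nat where N0: "max R1 R2 < real N0" using reals_Archimedean2 by blast
      define N where "N = Suc N0"
      have N: "N > 0" "R1 \<le> real N" "R2 \<le> real N" using N0 by (auto simp: N_def)
      obtain p where p: "p \<in> rational_trig_sums"
        and pf: "\<And>x. \<bar>p x - f (\<chi> k. real N * arcsin (sin (x $ k / real N)))\<bar> \<le> e"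
        using trig_approximation_of_folding[OF f e N(1)] by blast
      \<comment> \<open>The cube has half-width \<open>N\<close>, well inside the range \<open>N pi / 2\<close> where folding does nothing.\<close>
      have near: "\<bar>p x - f x\<bar> \<le> 2 * S * indicator {x. \<exists>k. real N \<le> \<bar>x $ k\<bar>} x + e" for x
      proof (cases "\<exists>k. real N \<le> \<bar>x $ k\<bar>")
        case True
        then show ?thesis
          using pf[of x] S[of x] S[of "\<chi> k. real N * arcsin (sin (x $ k / real N))"]
          by (simp add: indicator_def)
      next
        case False
        have "real N * arcsin (sin (x $ k / real N)) = x $ k" for k
        proof -
          have "\<bar>x $ k / real N\<bar> \<le> 1" using False N(1) by (simp add: not_le less_imp_le)
          moreover have "1 \<le> pi / 2" using pi_gt3 by simp
          ultimately have "- (pi/2) \<le> x $ k / real N" "x $ k / real N \<le> pi/2" by linarith+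
          then show ?thesis using N(1) by (simp add: arcsin_sin)
        qed
        then show ?thesis using pf[of x] False by (simp add: indicator_def)
      qed
      obtain C where C: "\<And>x. \<bar>p x\<bar> \<le> C" using rational_trig_sums_bounded_continuous(2)[OF p] by blast
      have close: "\<bar>integral\<^sup>L m p - integral\<^sup>L m f\<bar> \<le> 2 * S * e + e"
        if m: "prob_space m" "sets m = sets borel" and "R \<le> real N" "measure m {x. \<exists>k. R \<le> \<bar>x $ k\<bar>} \<le> e" for m R
      proof -
        interpret prob_space m by fact
        let ?A = "{x :: real ^ 'd. \<exists>k. real N \<le> \<bar>x $ k\<bar>}"
        have A: "?A \<in> sets m" using tail_sets m by simp
        have iA: "integrable m (indicat_real ?A)"
          by (rule integrable_real_indicator[OF A]) (simp add: less_top[symmetric])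
        have ip: "integrable m p" by (rule integrable_bounded_continuous[OF m rational_trig_sums_bounded_continuous(1)[OF p] C])
        have if': "integrable m f" by (rule integrable_bounded_continuous[OF m f S])
        have "measure m ?A \<le> measure m {x. \<exists>k. R \<le> \<bar>x $ k\<bar>}"
          by (rule finite_measure_mono) (use that tail_sets in \<open>auto intro: order_trans\<close>)
        then have mA: "measure m ?A \<le> e" using that by simp
        have "\<bar>integral\<^sup>L m p - integral\<^sup>L m f\<bar> = \<bar>\<integral>x. p x - f x \<partial>m\<bar>" using ip if' by simp
        also have "\<dots> \<le> (\<integral>x. \<bar>p x - f x\<bar> \<partial>m)" by (rule integral_abs_bound)
        also have "\<dots> \<le> (\<integral>x. 2 * S * indicator ?A x + e \<partial>m)"
          by (rule integral_mono) (use ip if' near iA in auto)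
        also have "\<dots> = 2 * S * measure m ?A + e"
          using A iA by (subst Bochner_Integration.integral_add) (auto simp: prob_space)
        also have "\<dots> \<le> 2 * S * e + e" using mA S1 by (intro add_right_mono mult_left_mono) auto
        finally show ?thesis .
      qed
      have "(\<lambda>n. \<bar>integral\<^sup>L (\<mu> n) p - integral\<^sup>L \<nu> p\<bar>) \<longlonglongrightarrow> 0"
        using trig_sum[OF p] by (simp add: LIM_zero tendsto_rabs_zero)
      then have "eventually (\<lambda>n. \<bar>integral\<^sup>L (\<mu> n) p - integral\<^sup>L \<nu> p\<bar> < r - 2 * (2 * S * e + e)) sequentially"
        using re by (intro order_tendstoD(2)[of _ 0]) auto
      then obtain no where "\<And>n. n \<ge> no \<Longrightarrow> \<bar>integral\<^sup>L (\<mu> n) p - integral\<^sup>L \<nu> p\<bar> < r - 2 * (2 * S * e + e)"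
        by (auto simp: eventually_sequentially)
      then have "\<bar>integral\<^sup>L (\<mu> n) f - integral\<^sup>L \<nu> f\<bar> < r" if "n \<ge> no" for n
      proof -
        from that have "\<bar>integral\<^sup>L (\<mu> n) p - integral\<^sup>L \<nu> p\<bar> < r - 2 * (2 * S * e + e)" by fact
        moreover have "\<bar>a - c\<bar> < r" if "\<bar>a' - a\<bar> \<le> T" "\<bar>c' - c\<bar> \<le> T" "\<bar>a' - c'\<bar> < r - 2 * T" for a a' c c' T :: real
          using that by linarith
        ultimately show ?thesis using close[OF p\<mu> s\<mu> N(2) R1, of n] close[OF p\<nu> s\<nu> N(3) R2] by blast
      qed
      then show "\<exists>no. \<forall>n\<ge>no. norm (integral\<^sup>L (\<mu> n) f - integral\<^sup>L \<nu> f) < r" by auto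
    qed
  qed
qed

text \<open>
  After \<open>J\<close> or more halvings \<open>\<bar>x\<bar>\<close> reaches \<open>[1, 2]\<close>, and there the cosine is at most
  \<open>cos 1\<close>.
\<close>

lemma dyadic_cosines_detect:
  fixes x :: real
  assumes "2 ^ J \<le> \<bar>x\<bar>"
  shows "\<exists>i. 1 - cos 1 \<le> 1 - cos (x / 2 ^ (J + i))"
proof -
  obtain n :: nat where "\<bar>x\<bar> < 2 ^ n"
    using real_arch_pow[of 2 "\<bar>x\<bar>"] by auto
  define P where "P n \<longleftrightarrow> \<bar>x\<bar> < 2 ^ (J + Suc n)" for n
  have "P n" unfolding P_def
    using \<open>\<bar>x\<bar> < 2 ^ n\<close> power_increasing[of n "J + Suc n" "2::real"] by simp
  define i where "i = (LEAST n. P n)"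
  have Pi: "P i" unfolding i_def using \<open>P n\<close> by (rule LeastI)
  have low: "2 ^ (J + i) \<le> \<bar>x\<bar>"
  proof (cases i)
    case 0 then show ?thesis using assms by simp
  next
    case (Suc i')
    then have "\<not> P i'" unfolding i_def using not_less_Least by (metis lessI)
    then show ?thesis by (simp add: P_def Suc)
  qed
  define y where "y = \<bar>x\<bar> / 2 ^ (J + i)"
  have y: "1 \<le> y" "y \<le> 2" using low Pi by (auto simp: y_def P_def field_simps)
  have "cos y \<le> cos 1" using y pi_gt3 by (intro cos_monotone_0_pi_le) auto
  moreover have "cos y = cos (x / 2 ^ (J + i))" by (cases "x \<ge> 0") (auto simp: y_def)
  ultimately show ?thesis by auto
qed

text \<open>
  A form of Levy's inequality between the tails of a measure and its characteristic function
  near the origin.  The usual average over an interval of frequencies is replaced by a sum over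
  dyadic frequencies, so that countably many values of the characteristic function suffice.
\<close>

lemma dyadic_tail_bound:
  fixes \<mu> :: "(real ^ 'd) measure"
  assumes \<mu>: "prob_space \<mu>" "sets \<mu> = sets borel" and B: "B \<ge> 0" and q: "0 \<le> q" "q < 1"
    and small: "\<And>i. 1 - (\<integral>x. cos (x $ k / 2 ^ i) \<partial>\<mu>) \<le> B * q ^ i"
  shows "measure \<mu> {x. 2 ^ J \<le> \<bar>x $ k\<bar>} \<le> B * q ^ J / ((1 - cos 1) * (1 - q))"
proof -
  interpret prob_space \<mu> by fact
  note [measurable_cong] = \<mu>(2)
  define \<delta> where "\<delta> = 1 - cos (1::real)"
  have \<delta>: "\<delta> > 0" using cos_monotone_0_pi[of 0 1] pi_gt3 by (simp add: \<delta>_def)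
  let ?A = "{x :: real ^ 'd. 2 ^ J \<le> \<bar>x $ k\<bar>}"
  let ?h = "\<lambda>i (x :: real ^ 'd). (1 - cos (x $ k / 2 ^ (J + i))) / \<delta>"
  have A: "?A \<in> sets \<mu>" unfolding \<mu>(2) by measurable
  have hc: "continuous_on UNIV (?h i)" for i by (intro continuous_intros) (use \<delta> in auto)
  have [measurable]: "?h i \<in> borel_measurable \<mu>" for i
    using borel_measurable_continuous_onI[OF hc] measurable_cong_sets[OF \<mu>(2) refl] by blast
  have h0: "0 \<le> ?h i x" for i x using \<delta> by simp
  have "emeasure \<mu> ?A = (\<integral>\<^sup>+x. indicator ?A x \<partial>\<mu>)" using A by simp
  also have "\<dots> \<le> (\<integral>\<^sup>+x. (\<Sum>i. ennreal (?h i x)) \<partial>\<mu>)"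
  proof (rule nn_integral_mono)
    fix x :: "real ^ 'd"
    show "indicator ?A x \<le> (\<Sum>i. ennreal (?h i x))"
    proof (cases "x \<in> ?A")
      case True
      then obtain i where "1 - cos 1 \<le> 1 - cos (x $ k / 2 ^ (J + i))" using dyadic_cosines_detect by blast
      then have "1 \<le> ?h i x" using \<delta> by (simp add: \<delta>_def)
      then have "indicator ?A x \<le> ennreal (?h i x)" using True by (simp add: ennreal_le_iff2 flip: ennreal_1)
      also have "\<dots> = (\<Sum>i\<in>{i}. ennreal (?h i x))" by simp
      also have "\<dots> \<le> (\<Sum>i. ennreal (?h i x))" by (rule sum_le_suminf) auto
      finally show ?thesis .
    qed simp
  qed
  also have "\<dots> = (\<Sum>i. \<integral>\<^sup>+x. ennreal (?h i x) \<partial>\<mu>)"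
    by (rule nn_integral_suminf) measurable
  also have "\<dots> \<le> (\<Sum>i. ennreal (B * q ^ J / \<delta> * q ^ i))"
  proof (rule suminf_le)
    fix i
    have c: "integrable \<mu> (\<lambda>x. cos (x $ k / 2 ^ (J + i)))"
      by (rule integrable_bounded_continuous[OF \<mu>, where C = 1]) (auto intro!: continuous_intros)
    then have "integrable \<mu> (?h i)" by simp
    then have "(\<integral>\<^sup>+x. ennreal (?h i x) \<partial>\<mu>) = ennreal (\<integral>x. ?h i x \<partial>\<mu>)"
      by (rule nn_integral_eq_integral) (use h0 in auto)
    also have "(\<integral>x. ?h i x \<partial>\<mu>) = (1 - (\<integral>x. cos (x $ k / 2 ^ (J + i)) \<partial>\<mu>)) / \<delta>"
      using c by (simp add: prob_space)
    also have "\<dots> \<le> (B * q ^ (J + i)) / \<delta>" using small \<delta> by (intro divide_right_mono) auto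
    also have "\<dots> = B * q ^ J / \<delta> * q ^ i" by (simp add: power_add)
    finally show "(\<integral>\<^sup>+x. ennreal (?h i x) \<partial>\<mu>) \<le> ennreal (B * q ^ J / \<delta> * q ^ i)"
      by (simp add: ennreal_leI)
  qed auto
  also have "\<dots> = ennreal (B * q ^ J / \<delta> * (1 / (1 - q)))"
  proof (rule suminf_ennreal_eq)
    show "(\<lambda>i. B * q ^ J / \<delta> * q ^ i) sums (B * q ^ J / \<delta> * (1 / (1 - q)))"
      by (intro sums_mult geometric_sums) (use q in auto)
  qed (use B q \<delta> in auto)
  finally have "ennreal (measure \<mu> ?A) \<le> ennreal (B * q ^ J / \<delta> * (1 / (1 - q)))"
    by (simp add: emeasure_eq_measure)
  then show ?thesis using B q \<delta> by (subst (asm) ennreal_le_iff) (auto simp: \<delta>_def)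
qed

section \<open>Averages of Gaussian noise\<close>

lemma nn_integral_lborel_vec_prod:
  fixes g :: "'d::finite \<Rightarrow> real \<Rightarrow> ennreal"
  assumes [measurable]: "\<And>k. g k \<in> borel_measurable borel"
  shows "(\<integral>\<^sup>+x. (\<Prod>k\<in>UNIV. g k (x $ k)) \<partial>(lborel :: (real ^ 'd) measure)) = (\<Prod>k\<in>UNIV. \<integral>\<^sup>+x. g k x \<partial>lborel)"
proof -
  have B: "(Basis :: (real ^ 'd) set) = range (\<lambda>k. axis k 1)" by (auto simp: Basis_vec_def)
  have inj: "inj (\<lambda>k :: 'd. axis k (1::real))" by (auto simp: inj_on_def axis_eq_axis)
  have re: "(\<Prod>b\<in>(Basis :: (real ^ 'd) set). f b) = (\<Prod>k\<in>UNIV. f (axis k 1))" for f :: "_ \<Rightarrow> ennreal"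
    unfolding B by (subst prod.reindex[OF inj]) simp
  have "(\<integral>\<^sup>+x. (\<Prod>b\<in>Basis. g (axis_index b) (x \<bullet> b)) \<partial>(lborel :: (real ^ 'd) measure))
      = (\<Prod>b\<in>(Basis :: (real ^ 'd) set). \<integral>\<^sup>+x. g (axis_index b) x \<partial>lborel)"
    by (rule nn_integral_lborel_prod) auto
  then show ?thesis by (simp add: re axis_index_axis inner_axis)
qed

lemma nn_integral_normal_density: "s > 0 \<Longrightarrow> (\<integral>\<^sup>+x. ennreal (normal_density m s x) \<partial>lborel) = 1"
  using prob_space.emeasure_space_1[OF prob_space_normal_density[of s m]]
  by (simp add: emeasure_density)

lemma abs_cos_diff_le: "\<bar>cos x - cos y\<bar> \<le> \<bar>x - y\<bar>" for x y :: real
proof -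
  have "\<bar>cos x - cos y\<bar> = 2 * \<bar>sin ((x + y) / 2)\<bar> * \<bar>sin ((y - x) / 2)\<bar>"
    by (simp add: cos_diff_cos abs_mult)
  also have "\<dots> \<le> 2 * 1 * \<bar>(y - x) / 2\<bar>"
    by (intro mult_mono abs_sin_x_le_abs_x) auto
  finally show ?thesis by simp
qed

context prob_space
begin

lemma indep_vars_imp_indep_var:
  fixes v :: "'i \<Rightarrow> 'a \<Rightarrow> real"
  assumes "indep_vars (\<lambda>_. borel) v I" "i \<in> I" "j \<in> I" "i \<noteq> j"
  shows "indep_var borel (v i) borel (v j)"
  using indep_vars_sum[of "{j}" i v] indep_vars_subset[OF assms(1), of "{i, j}"] assms(2-) by simp

text \<open>
  The probability of a box is an integral of a product of functions of single coordinates.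
  It factorises, which gives both the independence of the coordinates and their laws.
\<close>

lemma isotropic_normal_coordinates:
  fixes X :: "'a \<Rightarrow> real ^ 'd"
  assumes X: "distributed M lborel X (\<lambda>x. ennreal (\<Prod>k\<in>UNIV. normal_density 0 s (x $ k)))" and s: "s > 0"
  shows "indep_vars (\<lambda>_. borel) (\<lambda>k \<omega>. X \<omega> $ k) UNIV"
    and "distributed M lborel (\<lambda>\<omega>. X \<omega> $ k) (normal_density 0 s)"
proof -
  have Xm[measurable]: "X \<in> borel_measurable M" using distributed_measurable[OF X] by simp
  have Xk[measurable]: "(\<lambda>\<omega>. X \<omega> $ k) \<in> borel_measurable M" for k
    by (rule measurable_compose[OF Xm borel_measurable_continuous_onI]) (intro continuous_intros)
  let ?I = "\<lambda>A. \<integral>\<^sup>+x. ennreal (normal_density 0 s x) * indicator A x \<partial>lborel"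
  have box: "emeasure M {\<omega> \<in> space M. \<forall>k. X \<omega> $ k \<in> A k} = (\<Prod>k\<in>UNIV. ?I (A k))"
    if A: "\<And>k. A k \<in> sets borel" for A
  proof -
    let ?B = "{x :: real ^ 'd. \<forall>k. x $ k \<in> A k}"
    have B: "?B \<in> sets lborel" using A by measurable
    have "emeasure M {\<omega> \<in> space M. \<forall>k. X \<omega> $ k \<in> A k} = emeasure M (X -` ?B \<inter> space M)"
      by (rule arg_cong[where f = "emeasure M"]) auto
    also have "\<dots> = (\<integral>\<^sup>+x. ennreal (\<Prod>k\<in>UNIV. normal_density 0 s (x $ k)) * indicator ?B x \<partial>lborel)"
      by (rule distributed_emeasure[OF X B])
    also have "\<dots> = (\<integral>\<^sup>+x. (\<Prod>k\<in>UNIV. ennreal (normal_density 0 s (x $ k)) * indicator (A k) (x $ k)) \<partial>lborel)"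
    proof (rule nn_integral_cong)
      fix x :: "real ^ 'd"
      have "indicator ?B x = (\<Prod>k\<in>UNIV. indicator (A k) (x $ k) :: ennreal)"
      proof (cases "x \<in> ?B")
        case False
        then obtain k where "x $ k \<notin> A k" by auto
        then have "(\<Prod>k\<in>UNIV. indicator (A k) (x $ k) :: ennreal) = 0"
          by (intro prod_zero bexI[of _ k]) auto
        then show ?thesis using False by simp
      qed auto
      then show "ennreal (\<Prod>k\<in>UNIV. normal_density 0 s (x $ k)) * indicator ?B x
          = (\<Prod>k\<in>UNIV. ennreal (normal_density 0 s (x $ k)) * indicator (A k) (x $ k))"
        by (simp add: prod.distrib prod_ennreal)
    qed
    also have "\<dots> = (\<Prod>k\<in>UNIV. ?I (A k))"
      by (rule nn_integral_lborel_vec_prod) (use A in measurable)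
    finally show ?thesis .
  qed
  have I_UNIV: "?I UNIV = 1" using nn_integral_normal_density[OF s] by simp
  have marg: "emeasure M {\<omega> \<in> space M. X \<omega> $ k \<in> A} = ?I A" if "A \<in> sets borel" for k A
  proof -
    have "emeasure M {\<omega> \<in> space M. \<forall>j. X \<omega> $ j \<in> (if j = k then A else UNIV)}
        = (\<Prod>j\<in>UNIV. ?I (if j = k then A else UNIV))"
      by (rule box) (use that in auto)
    also have "\<dots> = (\<Prod>j\<in>UNIV. if j = k then ?I A else 1)"
      by (intro prod.cong refl) (use I_UNIV in \<open>simp del: indicator_UNIV split: if_splits\<close>)
    also have "\<dots> = ?I A" by simp
    finally show ?thesis by (simp add: if_distrib cong: if_cong) (metis (no_types, lifting))
  qed
  show "distributed M lborel (\<lambda>\<omega>. X \<omega> $ k) (normal_density 0 s)"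
    unfolding distributed_def
  proof (intro conjI)
    show "distr M lborel (\<lambda>\<omega>. X \<omega> $ k) = density lborel (\<lambda>x. ennreal (normal_density 0 s x))"
    proof (rule measure_eqI)
      fix A assume "A \<in> sets (distr M lborel (\<lambda>\<omega>. X \<omega> $ k))"
      then have A: "A \<in> sets borel" by simp
      have "emeasure (distr M lborel (\<lambda>\<omega>. X \<omega> $ k)) A = emeasure M ((\<lambda>\<omega>. X \<omega> $ k) -` A \<inter> space M)"
        by (rule emeasure_distr) (use A in auto)
      also have "(\<lambda>\<omega>. X \<omega> $ k) -` A \<inter> space M = {\<omega> \<in> space M. X \<omega> $ k \<in> A}" by auto
      finally show "emeasure (distr M lborel (\<lambda>\<omega>. X \<omega> $ k)) A
          = emeasure (density lborel (\<lambda>x. ennreal (normal_density 0 s x))) A"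
        using A by (simp add: marg emeasure_density)
    qed simp
  qed auto
  show "indep_vars (\<lambda>_. borel) (\<lambda>k \<omega>. X \<omega> $ k) UNIV"
  proof (subst indep_vars_finite[where E = "\<lambda>_. sets borel"])
    show "\<forall>A\<in>(\<Pi> i\<in>UNIV. sets borel). prob (\<Inter>j. (\<lambda>\<omega>. X \<omega> $ j) -` A j \<inter> space M) =
        (\<Prod>j\<in>UNIV. prob ((\<lambda>\<omega>. X \<omega> $ j) -` A j \<inter> space M))"
    proof
      fix A assume "A \<in> (UNIV :: 'd set) \<rightarrow> sets (borel :: real measure)"
      then have A: "A k \<in> sets borel" for k by auto
      have "(\<Inter>j. (\<lambda>\<omega>. X \<omega> $ j) -` A j \<inter> space M) = {\<omega> \<in> space M. \<forall>k. X \<omega> $ k \<in> A k}" by auto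
      moreover have "(\<lambda>\<omega>. X \<omega> $ j) -` A j \<inter> space M = {\<omega> \<in> space M. X \<omega> $ j \<in> A j}" for j by auto
      moreover have "ennreal (prob {\<omega> \<in> space M. \<forall>k. X \<omega> $ k \<in> A k})
          = ennreal (\<Prod>j\<in>UNIV. prob {\<omega> \<in> space M. X \<omega> $ j \<in> A j})"
        by (simp add: prod_ennreal[symmetric] emeasure_eq_measure[symmetric] box[OF A] marg[OF A])
      ultimately show "prob (\<Inter>j. (\<lambda>\<omega>. X \<omega> $ j) -` A j \<inter> space M) =
          (\<Prod>j\<in>UNIV. prob ((\<lambda>\<omega>. X \<omega> $ j) -` A j \<inter> space M))"
        by (simp add: prod_nonneg)
    qed
  qed (auto simp: Int_stable_def sets.sigma_sets_eq intro: sets.sets_into_space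
        simp: sets.sigma_sets_eq[of borel, simplified])
qed

lemma isotropic_normal_projection:
  fixes X :: "'a \<Rightarrow> real ^ 'd" and \<xi> :: "real ^ 'd"
  assumes X: "distributed M lborel X (\<lambda>x. ennreal (\<Prod>k\<in>UNIV. normal_density 0 s (x $ k)))"
    and s: "s > 0" and \<xi>: "\<xi> \<noteq> 0"
  shows "distributed M lborel (\<lambda>\<omega>. \<xi> \<bullet> X \<omega>) (normal_density 0 (s * norm \<xi>))"
proof -
  let ?I = "{k. \<xi> $ k \<noteq> 0}"
  note c = isotropic_normal_coordinates[OF X s]
  have "distributed M lborel (\<lambda>\<omega>. \<Sum>k\<in>?I. \<xi> $ k * X \<omega> $ k)
      (normal_density (\<Sum>k\<in>?I. 0) (sqrt (\<Sum>k\<in>?I. (\<bar>\<xi> $ k\<bar> * s)\<^sup>2)))"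
  proof (rule sum_indep_normal)
    show "?I \<noteq> {}" using \<xi> by (auto simp: vec_eq_iff)
    show "indep_vars (\<lambda>i. borel) (\<lambda>k \<omega>. \<xi> $ k * X \<omega> $ k) ?I"
      by (rule indep_vars_subset[OF indep_vars_compose2[OF c(1)]]) auto
    show "distributed M lborel (\<lambda>\<omega>. \<xi> $ k * X \<omega> $ k) (normal_density 0 (\<bar>\<xi> $ k\<bar> * s))" if "k \<in> ?I" for k
      using normal_density_affine[OF c(2)[of k] s, of "\<xi> $ k" 0] that by simp
  qed (use s in auto)
  moreover have "(\<Sum>k\<in>?I. \<xi> $ k * X \<omega> $ k) = \<xi> \<bullet> X \<omega>" for \<omega>
    unfolding inner_vec_def by (rule sum.mono_neutral_cong_left) auto
  moreover have "sqrt (\<Sum>k\<in>?I. (\<bar>\<xi> $ k\<bar> * s)\<^sup>2) = s * norm \<xi>"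
  proof -
    have "(\<Sum>k\<in>?I. (\<bar>\<xi> $ k\<bar> * s)\<^sup>2) = (\<Sum>k\<in>UNIV. (\<bar>\<xi> $ k\<bar> * s)\<^sup>2)"
      by (rule sum.mono_neutral_left) auto
    also have "\<dots> = (s * norm \<xi>)\<^sup>2"
      by (simp add: power_mult_distrib norm_vec_def L2_set_def sum_nonneg sum_distrib_left mult.commute)
    finally show ?thesis using s by simp
  qed
  ultimately show ?thesis by simp
qed

lemma normal_trig_moments:
  assumes Y: "distributed M lborel Y (normal_density 0 \<sigma>)" and \<sigma>: "\<sigma> > 0"
  shows "expectation (\<lambda>\<omega>. cos (Y \<omega>)) = exp (- \<sigma>\<^sup>2 / 2)"
    and "expectation (\<lambda>\<omega>. sin (Y \<omega>)) = 0"
    and "expectation (\<lambda>\<omega>. (Y \<omega>)\<^sup>2) = \<sigma>\<^sup>2"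
    and "integrable M (\<lambda>\<omega>. (Y \<omega>)\<^sup>2)"
proof -
  have Ym[measurable]: "Y \<in> borel_measurable M" using distributed_measurable[OF Y] by simp
  have std: "distributed M lborel (\<lambda>\<omega>. (Y \<omega> - 0) / \<sigma>) std_normal_density"
    using normal_standard_normal_convert[OF \<sigma>] Y by simp
  have "char std_normal_distribution \<sigma> = (CLINT x|std_normal_distribution. iexp (\<sigma> * x))"
    by (simp add: char_def)
  also have "\<dots> = (CLINT x|distr M lborel (\<lambda>\<omega>. (Y \<omega> - 0) / \<sigma>). iexp (\<sigma> * x))"
    using std by (simp add: distributed_def)
  also have "\<dots> = (CLINT \<omega>|M. iexp (\<sigma> * (Y \<omega> / \<sigma>)))"
    by (subst integral_distr) auto
  also have "\<dots> = (CLINT \<omega>|M. iexp (Y \<omega>))" using \<sigma> by simp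
  finally have E: "(CLINT \<omega>|M. iexp (Y \<omega>)) = complex_of_real (exp (- \<sigma>\<^sup>2 / 2))"
    by (simp add: char_std_normal_distribution)
  have int: "integrable M (\<lambda>\<omega>. iexp (Y \<omega>))"
    by (rule integrable_const_bound[where B = 1]) auto
  show "expectation (\<lambda>\<omega>. cos (Y \<omega>)) = exp (- \<sigma>\<^sup>2 / 2)"
    using integral_Re[OF int] E by (simp add: Re_exp)
  show "expectation (\<lambda>\<omega>. sin (Y \<omega>)) = 0"
    using integral_Im[OF int] E by (simp add: Im_exp)
  show "expectation (\<lambda>\<omega>. (Y \<omega>)\<^sup>2) = \<sigma>\<^sup>2"
    using normal_distributed_variance[OF \<sigma> Y] normal_distributed_expectation[OF \<sigma> Y] by simp
  then show "integrable M (\<lambda>\<omega>. (Y \<omega>)\<^sup>2)"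
    using \<sigma> not_integrable_integral_eq by force
qed

lemma indep_var_of_subalgebras:
  fixes U V :: "'a \<Rightarrow> real"
  assumes ind: "indep_set (sets F) (sets N)" and sub: "subalgebra M F" "subalgebra M N"
    and U: "U \<in> borel_measurable F" and V: "V \<in> borel_measurable N"
  shows "indep_var borel U borel V"
proof -
  have sp: "space F = space M" "space N = space M" using sub by (auto simp: subalgebra_def)
  have "sigma_sets (space M) {U -` A \<inter> space M |A. A \<in> sets borel} \<subseteq> sets F"
    unfolding sp(1)[symmetric] by (rule sets.sigma_sets_subset) (use U in auto)
  moreover have "sigma_sets (space M) {V -` A \<inter> space M |A. A \<in> sets borel} \<subseteq> sets N"
    unfolding sp(2)[symmetric] by (rule sets.sigma_sets_subset) (use V in auto)
  ultimately have "indep_set (sigma_sets (space M) {U -` A \<inter> space M |A. A \<in> sets borel})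
       (sigma_sets (space M) {V -` A \<inter> space M |A. A \<in> sets borel})"
    using ind unfolding indep_set_def by (elim indep_sets_mono_sets) (auto split: bool.split)
  then show ?thesis
    unfolding indep_var_eq using measurable_from_subalg[OF sub(1) U] measurable_from_subalg[OF sub(2) V] by blast
qed

text \<open>
  Orthogonality leaves only the \<open>n\<close> diagonal terms among the \<open>n\<^sup>2\<close> products.  This gain of a
  factor \<open>1 / n\<close> is the law of large numbers behind the whole argument.
\<close>

lemma second_moment_of_average:
  fixes d :: "nat \<Rightarrow> 'a \<Rightarrow> real"
  assumes n: "n > 0" and int: "\<And>i j. i < n \<Longrightarrow> j < n \<Longrightarrow> integrable M (\<lambda>\<omega>. d i \<omega> * d j \<omega>)"
    and orth: "\<And>i j. i < n \<Longrightarrow> j < n \<Longrightarrow> i \<noteq> j \<Longrightarrow> expectation (\<lambda>\<omega>. d i \<omega> * d j \<omega>) = 0"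
    and diag: "\<And>i. i < n \<Longrightarrow> expectation (\<lambda>\<omega>. d i \<omega> * d i \<omega>) \<le> C"
  shows "expectation (\<lambda>\<omega>. ((\<Sum>i<n. d i \<omega>) / real n)\<^sup>2) \<le> C / real n"
    and "integrable M (\<lambda>\<omega>. ((\<Sum>i<n. d i \<omega>) / real n)\<^sup>2)"
proof -
  have eq: "((\<Sum>i<n. d i \<omega>) / real n)\<^sup>2 = (\<Sum>i<n. \<Sum>j<n. d i \<omega> * d j \<omega>) / (real n)\<^sup>2" for \<omega>
    by (simp add: power2_eq_square sum_product)
  show "integrable M (\<lambda>\<omega>. ((\<Sum>i<n. d i \<omega>) / real n)\<^sup>2)"
    unfolding eq by (intro integrable_divide Bochner_Integration.integrable_sum int) auto
  have row: "integrable M (\<lambda>\<omega>. \<Sum>j<n. d i \<omega> * d j \<omega>)" if "i < n" for i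
    by (intro Bochner_Integration.integrable_sum int) (use that in auto)
  have "expectation (\<lambda>\<omega>. ((\<Sum>i<n. d i \<omega>) / real n)\<^sup>2)
      = expectation (\<lambda>\<omega>. \<Sum>i<n. \<Sum>j<n. d i \<omega> * d j \<omega>) / (real n)\<^sup>2"
    unfolding eq by simp
  also have "expectation (\<lambda>\<omega>. \<Sum>i<n. \<Sum>j<n. d i \<omega> * d j \<omega>)
      = (\<Sum>i<n. expectation (\<lambda>\<omega>. \<Sum>j<n. d i \<omega> * d j \<omega>))"
    by (rule Bochner_Integration.integral_sum) (simp add: row)
  also have "\<dots> = (\<Sum>i<n. \<Sum>j<n. expectation (\<lambda>\<omega>. d i \<omega> * d j \<omega>))"
    by (intro sum.cong refl Bochner_Integration.integral_sum) (auto intro: int)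
  also have "(\<Sum>i<n. \<Sum>j<n. expectation (\<lambda>\<omega>. d i \<omega> * d j \<omega>)) = (\<Sum>i<n. expectation (\<lambda>\<omega>. d i \<omega> * d i \<omega>))"
  proof (rule sum.cong[OF refl])
    fix i assume i: "i \<in> {..<n}"
    have "(\<Sum>j<n. expectation (\<lambda>\<omega>. d i \<omega> * d j \<omega>)) = (\<Sum>j\<in>{i}. expectation (\<lambda>\<omega>. d i \<omega> * d j \<omega>))"
      by (rule sum.mono_neutral_right) (use i orth in auto)
    then show "(\<Sum>j<n. expectation (\<lambda>\<omega>. d i \<omega> * d j \<omega>)) = expectation (\<lambda>\<omega>. d i \<omega> * d i \<omega>)" by simp
  qed
  also have "\<dots> / (real n)\<^sup>2 \<le> (\<Sum>i<n. C) / (real n)\<^sup>2"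
    by (intro divide_right_mono sum_mono diag) auto
  also have "\<dots> = C / real n" using n by (simp add: power2_eq_square)
  finally show "expectation (\<lambda>\<omega>. ((\<Sum>i<n. d i \<omega>) / real n)\<^sup>2) \<le> C / real n" .
qed

lemma normal_average_second_moment:
  assumes n: "n > 0" and ind: "indep_vars (\<lambda>_. borel) v {..<n}"
    and normal: "\<And>j. j < n \<Longrightarrow> distributed M lborel (v j) (normal_density 0 \<sigma>)" and \<sigma>: "\<sigma> > 0"
  shows "expectation (\<lambda>\<omega>. ((\<Sum>j<n. v j \<omega>) / real n)\<^sup>2) \<le> \<sigma>\<^sup>2 / real n"
    and "integrable M (\<lambda>\<omega>. ((\<Sum>j<n. v j \<omega>) / real n)\<^sup>2)"
proof -
  note mom = normal_trig_moments[OF normal \<sigma>]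
  have m[measurable]: "v j \<in> borel_measurable M" if "j < n" for j
    using distributed_measurable[OF normal[OF that]] by simp
  have i1: "integrable M (v j)" if "j < n" for j
    using square_integrable_imp_integrable[OF m mom(4)] that by auto
  have pair: "indep_var borel (v i) borel (v j)" if "i < n" "j < n" "i \<noteq> j" for i j
    by (rule indep_vars_imp_indep_var[OF ind]) (use that in auto)
  have int: "integrable M (\<lambda>\<omega>. v i \<omega> * v j \<omega>)" if "i < n" "j < n" for i j
  proof (cases "i = j")
    case True then show ?thesis using mom(4)[OF that(1)] by (simp add: power2_eq_square)
  next
    case False then show ?thesis using indep_var_integrable[OF pair i1 i1] that by auto
  qed
  have orth: "expectation (\<lambda>\<omega>. v i \<omega> * v j \<omega>) = 0" if "i < n" "j < n" "i \<noteq> j" for i j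
    using indep_var_lebesgue_integral[OF pair[OF that] i1 i1] normal_distributed_expectation[OF \<sigma> normal] that by auto
  have diag: "expectation (\<lambda>\<omega>. v i \<omega> * v i \<omega>) \<le> \<sigma>\<^sup>2" if "i < n" for i
    using mom(3)[OF that] by (simp add: power2_eq_square)
  show "expectation (\<lambda>\<omega>. ((\<Sum>j<n. v j \<omega>) / real n)\<^sup>2) \<le> \<sigma>\<^sup>2 / real n"
    by (rule second_moment_of_average(1)[OF n int orth diag])
  show "integrable M (\<lambda>\<omega>. ((\<Sum>j<n. v j \<omega>) / real n)\<^sup>2)"
    by (rule second_moment_of_average(2)[OF n int orth diag])
qed

text \<open>
  The phases \<open>a j\<close> belong to the past \<open>F\<close> and the \<open>v j\<close> to the independent field \<open>N\<close>.  Averaging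
  \<open>cos (a j + v j)\<close> over \<open>v j\<close> alone gives \<open>exp (- \<sigma>\<^sup>2 / 2) * cos (a j)\<close>, so the summands of \<open>D\<close> are
  centred given the past, and orthogonal because the \<open>v j\<close> are independent.  The bound is
  proportional to \<open>\<sigma>\<^sup>2\<close>, since the cosine is Lipschitz: the error is small not only when \<open>n\<close> is
  large but also when the frequency that enters \<open>\<sigma>\<close> is small.
\<close>

lemma cosine_average_second_moment:
  assumes n: "n > 0" and ind: "indep_vars (\<lambda>_. borel) v {..<n}"
    and normal: "\<And>j. j < n \<Longrightarrow> distributed M lborel (v j) (normal_density 0 \<sigma>)" and \<sigma>: "\<sigma> > 0"
    and FN: "indep_set (sets F) (sets N)" "subalgebra M F" "subalgebra M N"
    and a: "\<And>j. j < n \<Longrightarrow> a j \<in> borel_measurable F" and v: "\<And>j. j < n \<Longrightarrow> v j \<in> borel_measurable N"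
  defines "D \<equiv> \<lambda>\<omega>. (\<Sum>j<n. cos (a j \<omega> + v j \<omega>) - exp (- \<sigma>\<^sup>2 / 2) * cos (a j \<omega>)) / real n"
  shows "expectation (\<lambda>\<omega>. (D \<omega>)\<^sup>2) \<le> 3 * \<sigma>\<^sup>2 / real n" and "integrable M (\<lambda>\<omega>. (D \<omega>)\<^sup>2)"
proof -
  define q where "q = exp (- \<sigma>\<^sup>2 / 2)"
  have q: "0 \<le> q" "q \<le> 1" "1 - q \<le> \<sigma>\<^sup>2 / 2"
    using exp_ge_add_one_self[of "- \<sigma>\<^sup>2 / 2"] by (auto simp: q_def)
  define d where "d j \<omega> = cos (a j \<omega> + v j \<omega>) - q * cos (a j \<omega>)" for j \<omega>
  note mom = normal_trig_moments[OF normal \<sigma>, folded q_def]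
  have vm[measurable]: "v j \<in> borel_measurable M" if "j < n" for j
    using measurable_from_subalg[OF FN(3) v[OF that]] .
  have am[measurable]: "a j \<in> borel_measurable M" if "j < n" for j
    using measurable_from_subalg[OF FN(2) a[OF that]] .
  have dm[measurable]: "d j \<in> borel_measurable M" if "j < n" for j
    unfolding d_def using vm[OF that] am[OF that] by measurable
  have d2: "\<bar>d j \<omega>\<bar> \<le> 2" for j \<omega>
  proof -
    have "\<bar>q * cos (a j \<omega>)\<bar> \<le> 1 * 1" unfolding abs_mult using q by (intro mult_mono) auto
    then show ?thesis unfolding d_def using abs_cos_le_one[of "a j \<omega> + v j \<omega>"] by linarith
  qed
  have int: "integrable M (\<lambda>\<omega>. d i \<omega> * d j \<omega>)" if "i < n" "j < n" for i j
  proof (rule integrable_const_bound[where B = "2 * 2"])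
    show "AE \<omega> in M. norm (d i \<omega> * d j \<omega>) \<le> 2 * 2"
      unfolding real_norm_def abs_mult by (intro AE_I2 mult_mono d2) auto
  qed (use dm[OF that(1)] dm[OF that(2)] in measurable)
  have diag: "expectation (\<lambda>\<omega>. d j \<omega> * d j \<omega>) \<le> 3 * \<sigma>\<^sup>2" if "j < n" for j
  proof -
    have "d j \<omega> * d j \<omega> \<le> 2 * (v j \<omega>)\<^sup>2 + \<sigma>\<^sup>2" for \<omega>
    proof -
      have "\<bar>cos (a j \<omega> + v j \<omega>) - cos (a j \<omega>)\<bar> \<le> \<bar>v j \<omega>\<bar>"
        using abs_cos_diff_le[of "a j \<omega> + v j \<omega>" "a j \<omega>"] by simp
      moreover have "\<bar>(1 - q) * cos (a j \<omega>)\<bar> \<le> 1 - q"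
        unfolding abs_mult using q by (simp add: mult_left_le)
      ultimately have "\<bar>d j \<omega>\<bar> \<le> \<bar>v j \<omega>\<bar> + (1 - q)"
        unfolding d_def by (simp add: algebra_simps)
      then have "\<bar>d j \<omega>\<bar>\<^sup>2 \<le> (\<bar>v j \<omega>\<bar> + (1 - q))\<^sup>2" by (rule power_mono) simp
      also have "\<dots> \<le> 2 * (v j \<omega>)\<^sup>2 + 2 * (1 - q)\<^sup>2"
        using sum_squares_bound[of "\<bar>v j \<omega>\<bar>" "1 - q"] by (simp add: power2_sum)
      also have "(1 - q)\<^sup>2 \<le> (1 - q) * 1" unfolding power2_eq_square using q by (intro mult_left_mono) auto
      finally show ?thesis using q by (simp add: power2_eq_square)
    qed
    then have "expectation (\<lambda>\<omega>. d j \<omega> * d j \<omega>) \<le> expectation (\<lambda>\<omega>. 2 * (v j \<omega>)\<^sup>2 + \<sigma>\<^sup>2)"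
      by (intro integral_mono int that Bochner_Integration.integrable_add
          Bochner_Integration.integrable_mult_right mom(4)) auto
    also have "\<dots> = 2 * \<sigma>\<^sup>2 + \<sigma>\<^sup>2"
      using mom(3,4)[OF that] by (simp add: prob_space)
    finally show ?thesis by simp
  qed
  have orth: "expectation (\<lambda>\<omega>. d i \<omega> * d j \<omega>) = 0" if ij: "i < n" "j < n" "i \<noteq> j" for i j
  proof -
    have prod0: "expectation (\<lambda>\<omega>. (f1 (a i \<omega>) * f2 (a j \<omega>)) * (h1 (v i \<omega>) * h2 (v j \<omega>))) = 0
        \<and> integrable M (\<lambda>\<omega>. (f1 (a i \<omega>) * f2 (a j \<omega>)) * (h1 (v i \<omega>) * h2 (v j \<omega>)))"
      if f: "continuous_on UNIV f1" "continuous_on UNIV f2" "\<And>x. \<bar>f1 x\<bar> \<le> 1" "\<And>x. \<bar>f2 x\<bar> \<le> 1"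
        and h: "continuous_on UNIV h1" "continuous_on UNIV h2" "\<And>x. \<bar>h1 x\<bar> \<le> 2" "\<And>x. \<bar>h2 x\<bar> \<le> 2"
        and h0: "expectation (\<lambda>\<omega>. h1 (v i \<omega>)) = 0"
      for f1 f2 h1 h2 :: "real \<Rightarrow> real"
    proof -
      note [measurable] = borel_measurable_continuous_onI[OF f(1)] borel_measurable_continuous_onI[OF f(2)]
        borel_measurable_continuous_onI[OF h(1)] borel_measurable_continuous_onI[OF h(2)]
        vm[OF ij(1)] vm[OF ij(2)] am[OF ij(1)] am[OF ij(2)]
      note aF[measurable] = a[OF ij(1)] a[OF ij(2)]
      note vN[measurable] = v[OF ij(1)] v[OF ij(2)]
      have "indep_var borel (v i) borel (v j)"
        by (rule indep_vars_imp_indep_var[OF ind]) (use ij in auto)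
      from indep_var_compose[OF this, of h1 borel h2 borel]
      have iv: "indep_var borel (\<lambda>\<omega>. h1 (v i \<omega>)) borel (\<lambda>\<omega>. h2 (v j \<omega>))"
        by (simp add: comp_def)
      have ih: "integrable M (\<lambda>\<omega>. h1 (v i \<omega>))" "integrable M (\<lambda>\<omega>. h2 (v j \<omega>))"
        by (rule integrable_const_bound[where B = 2]; use h in simp)+
      note I2 = indep_var_integrable[OF iv ih] indep_var_lebesgue_integral[OF iv ih]
      have "\<bar>f1 x * f2 y\<bar> \<le> 1 * 1" for x y unfolding abs_mult by (intro mult_mono f) auto
      then have if': "integrable M (\<lambda>\<omega>. f1 (a i \<omega>) * f2 (a j \<omega>))"
        by (intro integrable_const_bound[where B = 1]) auto
      have iFN: "indep_var borel (\<lambda>\<omega>. f1 (a i \<omega>) * f2 (a j \<omega>)) borel (\<lambda>\<omega>. h1 (v i \<omega>) * h2 (v j \<omega>))"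
        by (rule indep_var_of_subalgebras[OF FN]) measurable
      show ?thesis
        using indep_var_integrable[OF iFN if' I2(1)] indep_var_lebesgue_integral[OF iFN if' I2(1)] I2(2) h0
        by simp
    qed
    have hc: "continuous_on UNIV (\<lambda>x. cos x - q)" "\<bar>cos x - q\<bar> \<le> 2" "expectation (\<lambda>\<omega>. cos (v i \<omega>) - q) = 0" for x
    proof -
      show "continuous_on UNIV (\<lambda>x. cos x - q)" by (intro continuous_intros)
      show "\<bar>cos x - q\<bar> \<le> 2" using abs_cos_le_one[of x] q by linarith
      have "integrable M (\<lambda>\<omega>. cos (v i \<omega>))"
        by (rule integrable_const_bound[where B = 1]) (use vm[OF ij(1)] in auto)
      then show "expectation (\<lambda>\<omega>. cos (v i \<omega>) - q) = 0" using mom(1)[OF ij(1)] by (simp add: prob_space)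
    qed
    have hs: "continuous_on UNIV (sin :: real \<Rightarrow> real)" "\<bar>sin x\<bar> \<le> 2" "expectation (\<lambda>\<omega>. sin (v i \<omega>)) = 0" for x :: real
    proof -
      show "continuous_on UNIV (sin :: real \<Rightarrow> real)" by (intro continuous_intros)
      show "\<bar>sin x\<bar> \<le> 2" using abs_sin_le_one[of x] by linarith
    qed (rule mom(2)[OF ij(1)])
    have c: "continuous_on UNIV (cos :: real \<Rightarrow> real)" by (intro continuous_intros)
    \<comment> \<open>By the addition formula, \<open>d i * d j\<close> splits into four products of a function of the phases
      and a function of the noise; in each of them the factor with \<open>v i\<close> is centred.\<close>
    note 1 = prod0[OF c c abs_cos_le_one abs_cos_le_one hc(1) hc(1) hc(2) hc(2) hc(3)]
    note 2 = prod0[OF c hs(1) abs_cos_le_one abs_sin_le_one hc(1) hs(1) hc(2) hs(2) hc(3)]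
    note 3 = prod0[OF hs(1) c abs_sin_le_one abs_cos_le_one hs(1) hc(1) hs(2) hc(2) hs(3)]
    note 4 = prod0[OF hs(1) hs(1) abs_sin_le_one abs_sin_le_one hs(1) hs(1) hs(2) hs(2) hs(3)]
    have "d i \<omega> * d j \<omega> = cos (a i \<omega>) * cos (a j \<omega>) * ((cos (v i \<omega>) - q) * (cos (v j \<omega>) - q))
        - cos (a i \<omega>) * sin (a j \<omega>) * ((cos (v i \<omega>) - q) * sin (v j \<omega>))
        - sin (a i \<omega>) * cos (a j \<omega>) * (sin (v i \<omega>) * (cos (v j \<omega>) - q))
        + sin (a i \<omega>) * sin (a j \<omega>) * (sin (v i \<omega>) * sin (v j \<omega>))" for \<omega>
      unfolding d_def cos_add by (simp add: algebra_simps)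
    then show ?thesis using 1 2 3 4 by simp
  qed
  have "D = (\<lambda>\<omega>. (\<Sum>j<n. d j \<omega>) / real n)" by (simp add: D_def d_def q_def)
  then show "expectation (\<lambda>\<omega>. (D \<omega>)\<^sup>2) \<le> 3 * \<sigma>\<^sup>2 / real n" "integrable M (\<lambda>\<omega>. (D \<omega>)\<^sup>2)"
    using second_moment_of_average[OF n int orth diag] by auto
qed

end

section \<open>Second-moment bounds\<close>

text \<open>
  The integral of a nonnegative function is used here because Fatou's lemma and the exchange with
  infinite sums then hold without integrability conditions.
\<close>

definition (in prob_space) second_moment_le :: "('a \<Rightarrow> real) \<Rightarrow> real \<Rightarrow> bool" where
  "second_moment_le X K \<longleftrightarrow> (\<integral>\<^sup>+\<omega>. ennreal ((X \<omega>)\<^sup>2) \<partial>M) \<le> ennreal K"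

context prob_space
begin

lemma second_moment_leI:
  assumes "integrable M (\<lambda>\<omega>. (X \<omega>)\<^sup>2)" "expectation (\<lambda>\<omega>. (X \<omega>)\<^sup>2) \<le> K"
  shows "second_moment_le X K"
  unfolding second_moment_le_def
  using nn_integral_eq_integral[OF assms(1)] assms(2) by (simp add: ennreal_leI)

lemma second_moment_le_mono: "second_moment_le X K \<Longrightarrow> K \<le> K' \<Longrightarrow> second_moment_le X K'"
  unfolding second_moment_le_def using ennreal_leI order_trans by blast

lemma second_moment_le_const: "(\<And>\<omega>. \<omega> \<in> space M \<Longrightarrow> (X \<omega>)\<^sup>2 \<le> K) \<Longrightarrow> second_moment_le X K"
proof -
  assume "\<And>\<omega>. \<omega> \<in> space M \<Longrightarrow> (X \<omega>)\<^sup>2 \<le> K"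
  then have "(\<integral>\<^sup>+\<omega>. ennreal ((X \<omega>)\<^sup>2) \<partial>M) \<le> (\<integral>\<^sup>+\<omega>. ennreal K \<partial>M)"
    by (intro nn_integral_mono ennreal_leI) auto
  then show ?thesis by (simp add: second_moment_le_def emeasure_space_1)
qed

text \<open>
  Young's inequality \<open>2 x y \<le> e x\<^sup>2 + y\<^sup>2 / e\<close>; the choice of \<open>e\<close> trades one
  factor against the other.
\<close>

lemma second_moment_le_triangle:
  assumes [measurable]: "X \<in> borel_measurable M" "Y \<in> borel_measurable M"
    and X: "second_moment_le X A" and Y: "second_moment_le Y B" and AB: "A \<ge> 0" "B \<ge> 0"
    and e: "e > 0" and V: "AE \<omega> in M. \<bar>V \<omega>\<bar> \<le> \<bar>X \<omega>\<bar> + \<bar>Y \<omega>\<bar>"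
  shows "second_moment_le V ((1 + e) * A + (1 + 1 / e) * B)"
proof -
  have sq: "v\<^sup>2 \<le> (1 + e) * x\<^sup>2 + (1 + 1 / e) * y\<^sup>2" if "\<bar>v\<bar> \<le> \<bar>x\<bar> + \<bar>y\<bar>" for v x y :: real
  proof -
    have "v\<^sup>2 \<le> (\<bar>x\<bar> + \<bar>y\<bar>)\<^sup>2" using power_mono[OF that, of 2] by simp
    moreover have "0 \<le> (e * \<bar>x\<bar> - \<bar>y\<bar>)\<^sup>2 / e" using e by simp
    then have "2 * \<bar>x\<bar> * \<bar>y\<bar> \<le> e * x\<^sup>2 + (1 / e) * y\<^sup>2"
      using e by (simp add: power2_diff power_mult_distrib field_simps power2_eq_square)
    ultimately show ?thesis by (simp add: power2_sum algebra_simps)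
  qed
  have "(\<integral>\<^sup>+\<omega>. ennreal ((V \<omega>)\<^sup>2) \<partial>M) \<le> (\<integral>\<^sup>+\<omega>. ennreal (1 + e) * ennreal ((X \<omega>)\<^sup>2) + ennreal (1 + 1 / e) * ennreal ((Y \<omega>)\<^sup>2) \<partial>M)"
  proof (rule nn_integral_mono_AE)
    show "AE \<omega> in M. ennreal ((V \<omega>)\<^sup>2) \<le> ennreal (1 + e) * ennreal ((X \<omega>)\<^sup>2) + ennreal (1 + 1 / e) * ennreal ((Y \<omega>)\<^sup>2)"
      using V
    proof eventually_elim
      case (elim \<omega>)
      have "ennreal ((V \<omega>)\<^sup>2) \<le> ennreal ((1 + e) * (X \<omega>)\<^sup>2 + (1 + 1 / e) * (Y \<omega>)\<^sup>2)"
        by (rule ennreal_leI[OF sq[OF elim]])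
      then show ?case using e by (simp add: ennreal_plus[symmetric] ennreal_mult[symmetric] del: ennreal_plus)
    qed
  qed
  also have "\<dots> = ennreal (1 + e) * (\<integral>\<^sup>+\<omega>. ennreal ((X \<omega>)\<^sup>2) \<partial>M) + ennreal (1 + 1 / e) * (\<integral>\<^sup>+\<omega>. ennreal ((Y \<omega>)\<^sup>2) \<partial>M)"
    by (simp add: nn_integral_add nn_integral_cmult)
  also have "\<dots> \<le> ennreal (1 + e) * ennreal A + ennreal (1 + 1 / e) * ennreal B"
    using X Y unfolding second_moment_le_def by (intro add_mono mult_left_mono) auto
  also have "\<dots> = ennreal ((1 + e) * A + (1 + 1 / e) * B)"
    using AB e by (simp add: ennreal_plus[symmetric] ennreal_mult[symmetric] del: ennreal_plus)
  finally show ?thesis unfolding second_moment_le_def .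
qed

text \<open>
  Fatou's lemma.  It carries bounds for finite sums of Gaussian increments over to their almost
  sure limits, whose laws are never identified.
\<close>

lemma second_moment_le_limit:
  assumes [measurable]: "\<And>k. X k \<in> borel_measurable M"
    and lim: "AE \<omega> in M. (\<lambda>k. X k \<omega>) \<longlonglongrightarrow> V \<omega>" and bd: "\<And>k. second_moment_le (X k) K"
  shows "second_moment_le V K"
proof -
  have "(\<integral>\<^sup>+\<omega>. ennreal ((V \<omega>)\<^sup>2) \<partial>M) = (\<integral>\<^sup>+\<omega>. liminf (\<lambda>k. ennreal ((X k \<omega>)\<^sup>2)) \<partial>M)"
  proof (rule nn_integral_cong_AE)
    show "AE \<omega> in M. ennreal ((V \<omega>)\<^sup>2) = liminf (\<lambda>k. ennreal ((X k \<omega>)\<^sup>2))"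
      using lim
    proof eventually_elim
      case (elim \<omega>)
      have "(\<lambda>k. ennreal ((X k \<omega>)\<^sup>2)) \<longlonglongrightarrow> ennreal ((V \<omega>)\<^sup>2)"
        by (intro tendsto_ennrealI tendsto_power elim)
      then show ?case using lim_imp_Liminf[OF sequentially_bot] by metis
    qed
  qed
  also have "\<dots> \<le> liminf (\<lambda>k. \<integral>\<^sup>+\<omega>. ennreal ((X k \<omega>)\<^sup>2) \<partial>M)"
    by (rule nn_integral_liminf) measurable
  also have "\<dots> \<le> liminf (\<lambda>k :: nat. ennreal K)"
    using bd unfolding second_moment_le_def by (intro Liminf_mono always_eventually) auto
  also have "\<dots> = ennreal K" by (simp add: Liminf_const)
  finally show ?thesis unfolding second_moment_le_def .
qed

text \<open>
  The error at frequency \<open>\<xi>\<close> is at most the previous error at the smaller frequency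
  \<open>exp (- c) *\<^sub>R \<xi>\<close> plus fresh noise.  A bound quadratic in the frequency gains a factor
  \<open>exp (- 2 * c)\<close> from the change of frequency, which contracts errors of early generations even
  though their noise was not small; the noise of late generations is small by itself.  Both
  effects are geometric, hence so is the decay.
\<close>

lemma contraction_recursion_second_moment:
  fixes E S :: "nat \<Rightarrow> real ^ 'd \<Rightarrow> 'a \<Rightarrow> real"
  assumes c: "c > 0" and K0: "K0 \<ge> 0" and H: "H \<ge> 0"
    and Em: "\<And>m \<xi>. E m \<xi> \<in> borel_measurable M" and Sm: "\<And>m \<xi>. S m \<xi> \<in> borel_measurable M"
    and E0: "\<And>\<xi>. second_moment_le (E 0 \<xi>) (K0 * (norm \<xi>)\<^sup>2)"
    and S: "\<And>m \<xi>. second_moment_le (S m \<xi>) (H * (norm \<xi>)\<^sup>2 / 2 ^ m)"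
    and step: "\<And>m \<xi>. AE \<omega> in M. \<bar>E (Suc m) \<xi> \<omega>\<bar> \<le> \<bar>E m (exp (- c) *\<^sub>R \<xi>) \<omega>\<bar> + \<bar>S m \<xi> \<omega>\<bar>"
  obtains K \<rho> where "K \<ge> 0" "0 < \<rho>" "\<rho> < 1"
    "\<And>m \<xi>. second_moment_le (E m \<xi>) (K * (norm \<xi>)\<^sup>2 * \<rho> ^ m)"
proof -
  \<comment> \<open>The factor \<open>1 + e = exp c\<close> in Young's inequality uses up half of the gain \<open>exp (- 2 * c)\<close>.\<close>
  define e where "e = exp c - 1"
  have e: "e > 0" "1 + e = exp c" using c by (auto simp: e_def)
  \<comment> \<open>The rate must dominate the remaining contraction \<open>exp (- c)\<close> strictly, to leave room for the
    noise, and also the rate \<open>1/2\<close> of the noise itself.\<close>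
  define \<rho> where "\<rho> = max (1/2) ((1 + exp (- c)) / 2)"
  have ec: "exp (- c) < 1" using c by simp
  have \<rho>': "\<rho> < 1" "1/2 \<le> \<rho>" "exp (- c) < \<rho>" using ec by (auto simp: \<rho>_def)
  have \<rho>: "0 < \<rho>" "\<rho> < 1" "1/2 \<le> \<rho>" "exp (- c) < \<rho>" using \<rho>' by linarith+
  define K where "K = K0 + (1 + 1 / e) * H / (\<rho> - exp (- c))"
  have K: "K \<ge> 0" "K0 \<le> K" "(1 + 1 / e) * H \<le> K * (\<rho> - exp (- c))"
  proof -
    define \<delta> x where "\<delta> = \<rho> - exp (- c)" and "x = (1 + 1 / e) * H"
    have p: "\<delta> > 0" "x \<ge> 0" using \<rho> e H by (auto simp: \<delta>_def x_def)
    have "K = K0 + x / \<delta>" by (simp add: K_def \<delta>_def x_def)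
    moreover have "(K0 + x / \<delta>) * \<delta> = K0 * \<delta> + x" using p by (simp add: distrib_right)
    moreover have "K0 * \<delta> \<ge> 0" "x / \<delta> \<ge> 0" using p K0 by auto
    ultimately show "K \<ge> 0" "K0 \<le> K" "(1 + 1 / e) * H \<le> K * (\<rho> - exp (- c))"
      using K0 unfolding \<delta>_def[symmetric] x_def[symmetric] by auto
  qed
  have "second_moment_le (E m \<xi>) (K * (norm \<xi>)\<^sup>2 * \<rho> ^ m)" for m \<xi>
  proof (induction m arbitrary: \<xi>)
    case 0
    show ?case by (rule second_moment_le_mono[OF E0]) (use K in \<open>auto intro: mult_right_mono\<close>)
  next
    case (Suc m)
    have "second_moment_le (E (Suc m) \<xi>) ((1 + e) * (K * (norm (exp (- c) *\<^sub>R \<xi>))\<^sup>2 * \<rho> ^ m) + (1 + 1 / e) * (H * (norm \<xi>)\<^sup>2 / 2 ^ m))"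
      by (rule second_moment_le_triangle[OF Em Sm Suc.IH S _ _ _ step]) (use K H e \<rho> in auto)
    then show ?case
    proof (rule second_moment_le_mono)
      have 1: "(1 + e) * (K * (norm (exp (- c) *\<^sub>R \<xi>))\<^sup>2 * \<rho> ^ m) = exp (- c) * (K * (norm \<xi>)\<^sup>2 * \<rho> ^ m)"
      proof -
        have "exp c * (exp (- c) * exp (- c)) = exp (- c)" by (simp add: exp_add[symmetric])
        then show ?thesis unfolding e(2) by (simp add: power_mult_distrib power2_eq_square algebra_simps)
      qed
      have "(1 / 2) ^ m \<le> \<rho> ^ m" using \<rho> by (intro power_mono) auto
      then have "(1 + 1 / e) * H * (norm \<xi>)\<^sup>2 * (1 / 2) ^ m \<le> K * (\<rho> - exp (- c)) * (norm \<xi>)\<^sup>2 * \<rho> ^ m"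
        by (intro mult_mono[OF mult_right_mono[OF K(3)]]) (use K \<rho> in auto)
      moreover have "(1 + 1 / e) * (H * (norm \<xi>)\<^sup>2 / 2 ^ m) = (1 + 1 / e) * H * (norm \<xi>)\<^sup>2 * (1 / 2) ^ m"
        by (simp only: power_one_over times_divide_eq_right mult_1_right mult.assoc)
      moreover have "x * (K * y * p) + K * (\<rho> - x) * y * p = K * y * (\<rho> * p)" for x y p
        by (simp add: algebra_simps)
      ultimately show "(1 + e) * (K * (norm (exp (- c) *\<^sub>R \<xi>))\<^sup>2 * \<rho> ^ m) + (1 + 1 / e) * (H * (norm \<xi>)\<^sup>2 / 2 ^ m)
          \<le> K * (norm \<xi>)\<^sup>2 * \<rho> ^ Suc m"
        unfolding 1 power_Suc by (metis add_left_mono)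
    qed
  qed
  then show ?thesis using that K(1) \<rho>(1,2) by blast
qed

text \<open>
  The sum over all \<open>n\<close> and \<open>i\<close> has finite expectation, hence is almost surely finite and bounds
  every term.
\<close>

lemma AE_bounded_double_series:
  fixes f :: "nat \<Rightarrow> nat \<Rightarrow> 'a \<Rightarrow> real"
  assumes [measurable]: "\<And>n i. f n i \<in> borel_measurable M"
    and K: "K \<ge> 0" and r: "0 \<le> r" "r < 1" "0 \<le> a" "a < 1"
    and bd: "\<And>n i. (\<integral>\<^sup>+\<omega>. ennreal (f n i \<omega>) \<partial>M) \<le> ennreal (K * r ^ n * a ^ i)"
  shows "AE \<omega> in M. \<exists>B. \<forall>n i. f n i \<omega> \<le> B"
proof -
  have "(\<integral>\<^sup>+\<omega>. (\<Sum>n. \<Sum>i. ennreal (f n i \<omega>)) \<partial>M) = (\<Sum>n. \<Sum>i. \<integral>\<^sup>+\<omega>. ennreal (f n i \<omega>) \<partial>M)"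
    by (simp add: nn_integral_suminf)
  also have "\<dots> \<le> (\<Sum>n. \<Sum>i. ennreal (K * r ^ n * a ^ i))"
    by (intro suminf_le bd) auto
  also have "\<dots> = (\<Sum>n. ennreal (K * r ^ n * (1 / (1 - a))))"
    by (intro suminf_cong suminf_ennreal_eq sums_mult geometric_sums) (use K r in auto)
  also have "\<dots> = ennreal (K * (1 / (1 - r)) * (1 / (1 - a)))"
    by (intro suminf_ennreal_eq sums_mult sums_mult2 geometric_sums) (use K r in auto)
  also have "\<dots> < \<infinity>" by simp
  finally have "AE \<omega> in M. (\<Sum>n. \<Sum>i. ennreal (f n i \<omega>)) \<noteq> \<infinity>"
    by (intro nn_integral_noteq_infinite) auto
  then show ?thesis
  proof eventually_elim
    case (elim \<omega>)
    define T where "T = (\<Sum>n. \<Sum>i. ennreal (f n i \<omega>))"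
    have "ennreal (f n i \<omega>) \<le> T" for n i
    proof -
      have "ennreal (f n i \<omega>) = (\<Sum>i\<in>{i}. ennreal (f n i \<omega>))" by simp
      also have "\<dots> \<le> (\<Sum>i. ennreal (f n i \<omega>))" by (rule sum_le_suminf) auto
      also have "\<dots> = (\<Sum>n\<in>{n}. \<Sum>i. ennreal (f n i \<omega>))" by simp
      also have "\<dots> \<le> T" unfolding T_def by (rule sum_le_suminf) auto
      finally show ?thesis .
    qed
    moreover have "T \<noteq> top" using elim by (simp add: T_def)
    then obtain B where "T = ennreal B" "B \<ge> 0" by (cases T) auto
    ultimately have "\<forall>n i. f n i \<omega> \<le> B" by (auto simp: ennreal_le_iff2)
    then show ?case by blast
  qed
qed

lemma AE_tendsto_zero_of_second_moments:
  assumes [measurable]: "\<And>n. X n \<in> borel_measurable M"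
    and K: "K \<ge> 0" and r: "0 \<le> r" "r < 1" and bd: "\<And>n. second_moment_le (X n) (K * r ^ n)"
  shows "AE \<omega> in M. (\<lambda>n. X n \<omega>) \<longlonglongrightarrow> 0"
proof -
  have "(\<integral>\<^sup>+\<omega>. (\<Sum>n. ennreal ((X n \<omega>)\<^sup>2)) \<partial>M) = (\<Sum>n. \<integral>\<^sup>+\<omega>. ennreal ((X n \<omega>)\<^sup>2) \<partial>M)"
    by (rule nn_integral_suminf) measurable
  also have "\<dots> \<le> (\<Sum>n. ennreal (K * r ^ n))"
    using bd unfolding second_moment_le_def by (intro suminf_le) auto
  also have "\<dots> = ennreal (K * (1 / (1 - r)))"
    by (intro suminf_ennreal_eq sums_mult geometric_sums) (use K r in auto)
  also have "\<dots> < \<infinity>" by simp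
  finally have "AE \<omega> in M. (\<Sum>n. ennreal ((X n \<omega>)\<^sup>2)) \<noteq> \<infinity>"
    by (intro nn_integral_noteq_infinite) auto
  then show ?thesis
  proof eventually_elim
    case (elim \<omega>)
    then have "summable (\<lambda>n. (X n \<omega>)\<^sup>2)" by (intro summable_suminf_not_top) auto
    then have "(\<lambda>n. (X n \<omega>)\<^sup>2) \<longlonglongrightarrow> 0" by (rule summable_LIMSEQ_zero)
    then have "(\<lambda>n. sqrt ((X n \<omega>)\<^sup>2)) \<longlonglongrightarrow> sqrt 0" by (rule tendsto_real_sqrt)
    then show ?case by (simp add: tendsto_rabs_zero_iff)
  qed
qed

end

section \<open>Linear equations with additive noise\<close>

text \<open>
  Formally \<open>d (exp (c s) y) = exp (c s) dw\<close>, and the sums are Riemann sums for the integral of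
  \<open>exp (- c (1 - s))\<close> against \<open>dw\<close>.  The path \<open>w\<close> need not have finite variation, but the equation
  expresses its increments by those of \<open>y\<close> and by an integral of \<open>y\<close>; what remains on each piece
  of length \<open>h\<close> is \<open>o(h)\<close> by the uniform continuity of \<open>y\<close>.  In this way the solution of the
  stochastic equation is reached through finite sums of Brownian increments, without a
  stochastic integral.
\<close>

lemma linear_sde_stieltjes_limit:
  fixes y w :: "real \<Rightarrow> real" and u c L :: real
  assumes cont: "continuous_on {u..<u+1} y"
    and lim: "(y \<longlongrightarrow> L) (at_left (u+1))"
    and eq: "\<And>t. t \<in> {u..<u+1} \<Longrightarrow> y t = y u + (w t - w u) - c * integral {u..t} y"
  shows "(\<lambda>k. \<Sum>l<k. exp (- c * (1 - real l / real (Suc k))) *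
             (w (u + real (Suc l) / real (Suc k)) - w (u + real l / real (Suc k))))
           \<longlonglongrightarrow> L - exp (- c) * y u"
proof -
  \<comment> \<open>Filling in the left limit at the right endpoint makes the path uniformly continuous.\<close>
  define z where "z t = (if t < u + 1 then y t else L)" for t
  have z_y: "z t = y t" if "t < u + 1" for t using that by (simp add: z_def)
  have zc: "continuous_on {u..u+1} z"
  proof (rule continuous_on_IccI)
    have "((\<lambda>t. y t) \<longlongrightarrow> y u) (at u within {u..<u+1})"
      using cont by (auto simp: continuous_on)
    moreover have "at u within {u..<u+1} = at_right u"
    proof -
      have "at u within {u..<u+1} = at u within {u..}"
        by (rule at_within_nhd[of _ "{..<u+1}"]) auto
      then show ?thesis by (simp add: at_within_Ici_at_right)
    qed
    ultimately have "(y \<longlongrightarrow> z u) (at_right u)" by (simp add: z_y)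
    moreover have "eventually (\<lambda>t. y t = z t) (at_right u)"
      by (rule eventually_at_rightI[of u "u+1"]) (auto simp: z_y)
    ultimately show "(z \<longlongrightarrow> z u) (at_right u)"
      by (rule Lim_transform_eventually)
  next
    have "eventually (\<lambda>t. y t = z t) (at_left (u+1))"
      by (rule eventually_at_leftI[of u "u+1"]) (auto simp: z_y)
    then show "(z \<longlongrightarrow> z (u+1)) (at_left (u+1))"
      using Lim_transform_eventually[OF lim] by (simp add: z_def)
  next
    fix t assume t: "u < t" "t < u + 1"
    have "continuous_on {u<..<u+1} y" by (rule continuous_on_subset[OF cont]) auto
    then have "y \<midarrow>t\<rightarrow> y t" using t by (simp add: continuous_on_eq_continuous_at isCont_def)
    moreover have "eventually (\<lambda>s. y s = z s) (at t)"
      using t eventually_at_topological z_y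
      by (metis (mono_tags, lifting) lessThan_iff open_lessThan)
    ultimately have "z \<midarrow>t\<rightarrow> y t" by (rule Lim_transform_eventually)
    then show "z \<midarrow>t\<rightarrow> z t" using t by (simp add: z_y)
  qed auto
  obtain B where B: "\<And>t. t \<in> {u..u+1} \<Longrightarrow> \<bar>z t\<bar> \<le> B" and B0: "B \<ge> 0"
  proof -
    have "bounded (z ` {u..u+1})"
      by (rule compact_imp_bounded[OF compact_continuous_image[OF zc]]) simp
    then obtain B where "\<forall>x\<in>z ` {u..u+1}. \<bar>x\<bar> \<le> B" by (auto simp: bounded_real)
    then show ?thesis using that[of "max B 0"] by (force simp: le_max_iff_disj)
  qed
  have uc: "uniformly_continuous_on {u..u+1} z"
    by (rule compact_uniformly_continuous[OF zc]) simp
  define s where "s k l = u + real l / real (Suc k)" for k l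
  define S where "S k = (\<Sum>l<k. exp (c * (s k l - u)) * (w (s k (Suc l)) - w (s k l)))" for k
  define \<eta> where "\<eta> k = \<bar>exp (c / real (Suc k)) - 1 - c / real (Suc k)\<bar> * real (Suc k)" for k
  \<comment> \<open>The discrepancy of \<open>d (exp (c s) y) = exp (c s) dw\<close> on the piece number \<open>l\<close>.\<close>
  define E where "E k l = exp (c * (s k (Suc l) - u)) * y (s k (Suc l)) - exp (c * (s k l - u)) * y (s k l)
      - exp (c * (s k l - u)) * (w (s k (Suc l)) - w (s k l))" for k l
  have "(\<lambda>k. (exp (c / real (Suc k)) - 1 - c / real (Suc k)) * real (Suc k)) \<longlonglongrightarrow> 0"
    by (cases c "0 :: real" rule: linorder_cases) real_asymp+
  then have "(\<lambda>k. \<bar>(exp (c / real (Suc k)) - 1 - c / real (Suc k)) * real (Suc k)\<bar>) \<longlonglongrightarrow> 0"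
    by (rule tendsto_rabs_zero)
  then have \<eta>: "\<eta> \<longlonglongrightarrow> 0" unfolding \<eta>_def by (simp add: abs_mult)
  have E_eq: "exp (c * (s k k - u)) * y (s k k) - y u - S k = (\<Sum>l<k. E k l)" for k
  proof -
    have "(\<Sum>l<k. exp (c * (s k (Suc l) - u)) * y (s k (Suc l)) - exp (c * (s k l - u)) * y (s k l))
       = exp (c * (s k k - u)) * y (s k k) - exp (c * (s k 0 - u)) * y (s k 0)"
      by (rule sum_lessThan_telescope)
    then show ?thesis unfolding E_def S_def sum_subtractf by (simp add: s_def)
  qed
  \<comment> \<open>Two sources of error: the exponential is not affine (\<open>\<eta>\<close>), and \<open>y\<close> oscillates (\<open>e\<close>).\<close>
  have E_bd: "\<bar>E k l\<bar> \<le> exp \<bar>c\<bar> * (\<eta> k * B + \<bar>c\<bar> * e) / real (Suc k)"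
    if l: "l < k" and osc: "\<And>x x'. x \<in> {u..u+1} \<Longrightarrow> x' \<in> {u..u+1} \<Longrightarrow> \<bar>x' - x\<bar> \<le> 1 / real (Suc k) \<Longrightarrow> \<bar>z x' - z x\<bar> \<le> e"
    for k l e
  proof -
    define h where "h = 1 / real (Suc k)"
    have h0: "h > 0" by (simp add: h_def)
    define a b where "a = s k l" and "b = s k (Suc l)"
    have ba: "b = a + h" by (simp add: a_def b_def s_def h_def add_divide_distrib)
    have au: "u \<le> a" by (simp add: a_def s_def)
    have bu: "b < u + 1" using l by (simp add: b_def s_def)
    have ycont: "continuous_on {u..b} y" by (rule continuous_on_subset[OF cont]) (use bu in auto)
    have yint: "y integrable_on {u..b}" by (rule integrable_continuous_real[OF ycont])
    have split: "integral {u..a} y + integral {a..b} y = integral {u..b} y"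
      by (rule Henstock_Kurzweil_Integration.integral_combine) (use au ba h0 yint in auto)
    have inc: "y b - y a = (w b - w a) - c * integral {a..b} y"
    proof -
      have "y b = y u + (w b - w u) - c * (integral {u..a} y + integral {a..b} y)"
        unfolding split by (rule eq) (use au bu ba h0 in auto)
      moreover have "y a = y u + (w a - w u) - c * integral {u..a} y"
        by (rule eq) (use au bu ba h0 in auto)
      ultimately show ?thesis by (simp add: distrib_left)
    qed
    have iab: "y integrable_on {a..b}"
      by (rule integrable_subinterval_real[OF yint]) (use au in auto)
    have const: "integral {a..b} (\<lambda>r. y b) = h * y b" using ba h0 by simp
    have d: "integral {a..b} (\<lambda>r. y b - y r) = h * y b - integral {a..b} y"
      using Henstock_Kurzweil_Integration.integral_diff[of "\<lambda>r. y b" "{a..b}" y] iab const by auto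
    have 1: "E k l = exp (c * (a - u)) * ((exp (c * h) - 1 - c * h) * y b + c * integral {a..b} (\<lambda>r. y b - y r))"
    proof -
      have "exp (c * (b - u)) = exp (c * (a - u)) * exp (c * h)"
        by (simp add: ba exp_add[symmetric] algebra_simps)
      moreover have "w b - w a = y b - y a + c * integral {a..b} y" using inc by simp
      ultimately show ?thesis unfolding E_def a_def[symmetric] b_def[symmetric] d
        by (simp only:) (simp add: algebra_simps)
    qed
    have 2: "\<bar>integral {a..b} (\<lambda>r. y b - y r)\<bar> \<le> e * (b - a)"
    proof -
      have "norm (integral {a..b} (\<lambda>r. y b - y r)) \<le> e * (b - a)"
      proof (rule integral_bound)
        show "a \<le> b" using ba h0 by simp
        show "continuous_on {a..b} (\<lambda>r. y b - y r)"
          by (intro continuous_intros continuous_on_subset[OF ycont]) (use au in auto)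
        fix r assume r: "r \<in> {a..b}"
        have "\<bar>z b - z r\<bar> \<le> e"
          by (rule osc) (use r au bu ba in \<open>auto simp: h_def\<close>)
        then show "norm (y b - y r) \<le> e" using r bu by (simp add: z_y)
      qed
      then show ?thesis by simp
    qed
    have 3: "\<bar>(exp (c * h) - 1 - c * h) * y b\<bar> \<le> \<eta> k * h * B"
    proof -
      have "\<bar>exp (c * h) - 1 - c * h\<bar> = \<eta> k * h" by (simp add: \<eta>_def h_def)
      moreover have "\<bar>y b\<bar> \<le> B" using B[of b] z_y[OF bu] au bu ba h0 by simp
      ultimately show ?thesis by (simp add: abs_mult mult_left_mono \<eta>_def h_def)
    qed
    have 4: "exp (c * (a - u)) \<le> exp \<bar>c\<bar>"
    proof -
      have "c * (a - u) \<le> \<bar>c\<bar> * 1"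
      proof -
        have "c * (a - u) \<le> \<bar>c\<bar> * (a - u)" using au by (intro mult_right_mono) auto
        also have "\<dots> \<le> \<bar>c\<bar> * 1" using bu ba h0 by (intro mult_left_mono) auto
        finally show ?thesis .
      qed
      then show ?thesis by simp
    qed
    have "\<bar>E k l\<bar> \<le> exp \<bar>c\<bar> * (\<eta> k * h * B + \<bar>c\<bar> * (e * h))"
    proof -
      have "\<bar>c * integral {a..b} (\<lambda>r. y b - y r)\<bar> \<le> \<bar>c\<bar> * (e * h)"
        using 2 ba by (simp add: abs_mult mult_left_mono)
      with 3 have "\<bar>(exp (c * h) - 1 - c * h) * y b + c * integral {a..b} (\<lambda>r. y b - y r)\<bar>
           \<le> \<eta> k * h * B + \<bar>c\<bar> * (e * h)" by linarith
      with 4 show ?thesis unfolding 1 abs_mult abs_exp_cancel by (intro mult_mono) auto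
    qed
    also have "\<dots> = exp \<bar>c\<bar> * (\<eta> k * B + \<bar>c\<bar> * e) / real (Suc k)"
      by (simp only: h_def times_divide_eq_right add_divide_distrib mult_1_right times_divide_eq_left distrib_left)
    finally show ?thesis .
  qed
  have "(\<lambda>k. \<Sum>l<k. E k l) \<longlonglongrightarrow> 0"
  proof (rule LIMSEQ_I)
    fix r :: real assume r: "r > 0"
    define e where "e = r / (2 * exp \<bar>c\<bar> * (\<bar>c\<bar> + 1))"
    have e0: "e > 0" using r by (simp add: e_def add_nonneg_pos)
    have ce: "exp \<bar>c\<bar> * (\<bar>c\<bar> * e) \<le> r / 2"
    proof -
      have "exp \<bar>c\<bar> * (\<bar>c\<bar> * e) = r / 2 * (\<bar>c\<bar> / (\<bar>c\<bar> + 1))" by (simp add: e_def)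
      also have "\<dots> \<le> r / 2 * 1" using r by (intro mult_left_mono) auto
      finally show ?thesis by simp
    qed
    obtain d where d0: "d > 0" and d: "\<And>x x'. x \<in> {u..u+1} \<Longrightarrow> x' \<in> {u..u+1} \<Longrightarrow> dist x' x < d \<Longrightarrow> dist (z x') (z x) < e"
      using uc e0 unfolding uniformly_continuous_on_def by blast
    have "(\<lambda>k. exp \<bar>c\<bar> * (\<eta> k * B)) \<longlonglongrightarrow> 0"
      by (auto intro!: tendsto_eq_intros \<eta>)
    then have "eventually (\<lambda>k. exp \<bar>c\<bar> * (\<eta> k * B) < r / 2) sequentially"
      using r by (intro order_tendstoD(2)[of _ 0]) auto
    moreover have "(\<lambda>k. 1 / real (Suc k)) \<longlonglongrightarrow> 0" by real_asymp
    then have "eventually (\<lambda>k. 1 / real (Suc k) < d) sequentially"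
      using d0 by (intro order_tendstoD(2)[of _ 0]) auto
    ultimately have "eventually (\<lambda>k. norm ((\<Sum>l<k. E k l) - 0) < r) sequentially"
    proof eventually_elim
      case (elim k)
      have "\<bar>\<Sum>l<k. E k l\<bar> \<le> (\<Sum>l<k. \<bar>E k l\<bar>)" by (rule sum_abs)
      also have "\<dots> \<le> (\<Sum>l<k. exp \<bar>c\<bar> * (\<eta> k * B + \<bar>c\<bar> * e) / real (Suc k))"
        by (intro sum_mono E_bd less_imp_le[OF d[unfolded dist_real_def]])
           (use elim in auto)
      also have "\<dots> = exp \<bar>c\<bar> * (\<eta> k * B + \<bar>c\<bar> * e) * (real k / real (Suc k))" by simp
      also have "\<dots> \<le> exp \<bar>c\<bar> * (\<eta> k * B + \<bar>c\<bar> * e) * 1"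
        by (intro mult_left_mono) (use B0 e0 in \<open>auto simp: \<eta>_def\<close>)
      also have "\<dots> < r" using elim ce by (simp add: algebra_simps)
      finally show ?case by simp
    qed
    then show "\<exists>no. \<forall>n\<ge>no. norm ((\<Sum>l<n. E n l) - 0) < r"
      by (simp add: eventually_sequentially)
  qed
  moreover have "(\<lambda>k. exp (c * (s k k - u)) * y (s k k)) \<longlonglongrightarrow> exp c * L"
  proof -
    have sl: "(\<lambda>k. s k k) \<longlonglongrightarrow> u + 1" unfolding s_def by real_asymp
    have "(\<lambda>k. z (s k k)) \<longlonglongrightarrow> z (u+1)"
      by (rule continuous_on_tendsto_compose[OF zc sl]) (auto simp: s_def)
    moreover have "z (s k k) = y (s k k)" for k by (rule z_y) (simp add: s_def)
    ultimately have "(\<lambda>k. y (s k k)) \<longlonglongrightarrow> L" by (simp add: z_def)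
    then show ?thesis
      using tendsto_mult[OF tendsto_exp[OF tendsto_mult_left[OF tendsto_diff[OF sl tendsto_const[of u]], of c]]]
      by simp
  qed
  ultimately have "(\<lambda>k. exp (c * (s k k - u)) * y (s k k) - y u - (\<Sum>l<k. E k l)) \<longlonglongrightarrow> exp c * L - y u - 0"
    by (intro tendsto_diff tendsto_const)
  then have "S \<longlonglongrightarrow> exp c * L - y u" by (simp add: E_eq[symmetric])
  then have "(\<lambda>k. exp (- c) * S k) \<longlonglongrightarrow> exp (- c) * (exp c * L - y u)"
    by (intro tendsto_intros)
  also have "exp (- c) * (exp c * L - y u) = L - exp (- c) * y u"
    by (simp add: right_diff_distrib mult.assoc[symmetric] exp_add[symmetric])
  also have "(\<lambda>k. exp (- c) * S k) = (\<lambda>k. \<Sum>l<k. exp (- c * (1 - real l / real (Suc k))) *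
             (w (u + real (Suc l) / real (Suc k)) - w (u + real l / real (Suc k))))"
    by (simp add: S_def s_def sum_distrib_left mult.assoc[symmetric] exp_add[symmetric] algebra_simps)
  finally show ?thesis .
qed

text \<open>
  The kernel \<open>exp (- c (1 - s))\<close> at the left end of the piece number \<open>l\<close>, when a unit interval
  is cut into \<open>k + 1\<close> equal pieces.
\<close>

definition exponential_weight :: "real \<Rightarrow> nat \<Rightarrow> nat \<Rightarrow> real" where
  "exponential_weight c k l = exp (- c * (1 - real l / real (Suc k)))"

text \<open>
  The last of the \<open>k + 1\<close> pieces is omitted, because the driving path lives on a half-open
  interval and has no value at the right endpoint.
\<close>

definition stieltjes_sum :: "real \<Rightarrow> nat \<Rightarrow> real \<Rightarrow> (real \<Rightarrow> real) \<Rightarrow> real" where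
  "stieltjes_sum c k u w = (\<Sum>l<k. exponential_weight c k l *
       (w (u + real (Suc l) / real (Suc k)) - w (u + real l / real (Suc k))))"

text \<open>
  The variance of \<open>stieltjes_sum\<close> for a real Brownian path, and a Riemann sum for the integral
  of \<open>exp (- 2 c (1 - s))\<close> over the unit interval.
\<close>

definition stieltjes_variance :: "real \<Rightarrow> nat \<Rightarrow> real" where
  "stieltjes_variance c k = (\<Sum>l<k. (exponential_weight c k l)\<^sup>2 / real (Suc k))"

lemma stieltjes_variance_pos: "k > 0 \<Longrightarrow> stieltjes_variance c k > 0"
  unfolding stieltjes_variance_def exponential_weight_def by (intro sum_pos) auto

lemma stieltjes_variance_le_1:
  assumes "c > 0"
  shows "stieltjes_variance c k \<le> 1"
proof -
  have "stieltjes_variance c k \<le> (\<Sum>l<k. 1 / real (Suc k))"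
    unfolding stieltjes_variance_def
  proof (intro sum_mono divide_right_mono)
    fix l assume "l \<in> {..<k}"
    then have "exponential_weight c k l \<le> 1"
      using assms unfolding exponential_weight_def by (simp add: mult_nonneg_nonneg)
    then show "(exponential_weight c k l)\<^sup>2 \<le> 1"
      by (intro power_le_one) (auto simp: exponential_weight_def)
  qed auto
  also have "\<dots> \<le> 1" by simp
  finally show ?thesis .
qed

lemma stieltjes_variance_limit:
  assumes c: "c > 0"
  shows "stieltjes_variance c \<longlonglongrightarrow> (1 - exp (- 2 * c)) / (2 * c)"
proof -
  \<comment> \<open>A finite geometric series.\<close>
  have eq: "stieltjes_variance c k = exp (- 2 * c) * ((exp (2 * c * (real k / real (Suc k))) - 1)
       / ((exp (2 * c / real (Suc k)) - 1) * real (Suc k)))" for k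
  proof -
    have ne: "exp (2 * c / real (Suc k)) \<noteq> 1" using c by simp
    have "(exponential_weight c k l)\<^sup>2 = exp (- 2 * c) * exp (2 * c / real (Suc k)) ^ l" for l
      unfolding exponential_weight_def
      by (simp add: exp_of_nat_mult[symmetric] exp_add[symmetric] power2_eq_square algebra_simps)
    then have "stieltjes_variance c k = exp (- 2 * c) * (\<Sum>l<k. exp (2 * c / real (Suc k)) ^ l) / real (Suc k)"
      unfolding stieltjes_variance_def by (simp add: sum_distrib_left sum_divide_distrib)
    also have "(\<Sum>l<k. exp (2 * c / real (Suc k)) ^ l) = (exp (2 * c / real (Suc k)) ^ k - 1) / (exp (2 * c / real (Suc k)) - 1)"
      by (rule geometric_sum[OF ne])
    also have "exp (2 * c / real (Suc k)) ^ k = exp (2 * c * (real k / real (Suc k)))"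
      by (simp add: exp_of_nat_mult[symmetric] algebra_simps)
    finally show ?thesis by simp
  qed
  have "(\<lambda>k. (exp (2 * c / real (Suc k)) - 1) * real (Suc k)) \<longlonglongrightarrow> 2 * c"
    using c by real_asymp
  moreover have "(\<lambda>k. exp (2 * c * (real k / real (Suc k))) - 1) \<longlonglongrightarrow> exp (2 * c * 1) - 1"
  proof -
    have "(\<lambda>k. real k / real (Suc k)) \<longlonglongrightarrow> 1" by real_asymp
    then show ?thesis by (intro tendsto_intros)
  qed
  ultimately have "(\<lambda>k. exp (- 2 * c) * ((exp (2 * c * (real k / real (Suc k))) - 1)
       / ((exp (2 * c / real (Suc k)) - 1) * real (Suc k)))) \<longlonglongrightarrow> exp (- 2 * c) * ((exp (2 * c * 1) - 1) / (2 * c))"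
    using c by (intro tendsto_mult_left tendsto_divide) auto
  also have "exp (- 2 * c) * ((exp (2 * c * 1) - 1) / (2 * c)) = (1 - exp (- 2 * c)) / (2 * c)"
    by (simp add: right_diff_distrib exp_add[symmetric])
  finally show ?thesis using eq by presburger
qed

text \<open>
  Summation over the particles cancels the interaction, so the mean relaxes at rate \<open>b\<close>.
  Subtraction of the mean turns the attraction to it into a linear drift, so the deviations relax
  at rate \<open>b + \<gamma>\<close>.  Both are linear equations with additive noise.
\<close>

lemma mean_field_stieltjes_limits:
  fixes x w :: "nat \<Rightarrow> real \<Rightarrow> real"
  assumes n: "n > 0"
    and cont: "\<And>j. j < n \<Longrightarrow> continuous_on {u..<u+1} (x j)"
    and lim: "\<And>j. j < n \<Longrightarrow> (x j \<longlongrightarrow> L j) (at_left (u+1))"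
    and eq: "\<And>j t. j < n \<Longrightarrow> t \<in> {u..<u+1} \<Longrightarrow> x j t = x j u + (w j t - w j u)
        + integral {u..t} (\<lambda>s. - b * x j s + \<gamma> * ((\<Sum>i<n. x i s) / real n - x j s))"
  shows "(\<lambda>k. stieltjes_sum b k u (\<lambda>t. (\<Sum>j<n. w j t) / real n))
           \<longlonglongrightarrow> (\<Sum>j<n. L j) / real n - exp (- b) * ((\<Sum>j<n. x j u) / real n)" (is ?mean)
    and "j < n \<Longrightarrow> (\<lambda>k. stieltjes_sum (b + \<gamma>) k u (\<lambda>t. w j t - (\<Sum>i<n. w i t) / real n))
           \<longlonglongrightarrow> (L j - (\<Sum>i<n. L i) / real n) - exp (- (b + \<gamma>)) * (x j u - (\<Sum>i<n. x i u) / real n)"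
proof -
  have meanc: "continuous_on {u..<u+1} (\<lambda>t. (\<Sum>i<n. x i t) / real n)"
    by (intro continuous_intros cont) (use n in auto)
  have sub: "continuous_on {u..t} f" if "continuous_on {u..<u+1} f" "t < u + 1" for f :: "real \<Rightarrow> real" and t
    by (rule continuous_on_subset[OF that(1)]) (use that in auto)
  define f where "f j s = - b * x j s + \<gamma> * ((\<Sum>i<n. x i s) / real n - x j s)" for j s
  have fi: "f j integrable_on {u..t}" if "j < n" "t < u + 1" for j t
    unfolding f_def
    by (intro integrable_continuous_real continuous_intros sub[OF cont] sub[OF meanc] that)
  have xi: "x j integrable_on {u..t}" if "j < n" "t < u + 1" for j t
    by (intro integrable_continuous_real sub[OF cont] that)
  have mi: "(\<lambda>s. (\<Sum>i<n. x i s) / real n) integrable_on {u..t}" if "t < u + 1" for t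
    by (intro integrable_continuous_real sub[OF meanc] that)
  have f_mean: "(\<Sum>j<n. f j s) / real n = - b * ((\<Sum>i<n. x i s) / real n)" for s
  proof -
    have "(\<Sum>j<n. f j s) = - b * (\<Sum>j<n. x j s) + \<gamma> * (real n * ((\<Sum>i<n. x i s) / real n) - (\<Sum>j<n. x j s))"
      unfolding f_def sum.distrib sum_distrib_left[symmetric] sum_subtractf by simp
    then show ?thesis using n by simp
  qed
  have mean_int: "(\<Sum>j<n. integral {u..t} (f j)) / real n = - b * integral {u..t} (\<lambda>s. (\<Sum>i<n. x i s) / real n)"
    if t: "t < u + 1" for t
  proof -
    have "(\<Sum>j<n. integral {u..t} (f j)) / real n = integral {u..t} (\<lambda>s. \<Sum>j<n. f j s) / real n"
      by (subst Henstock_Kurzweil_Integration.integral_sum) (use fi t in auto)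
    also have "\<dots> = integral {u..t} (\<lambda>s. (\<Sum>j<n. f j s) / real n)" by simp
    also have "\<dots> = - b * integral {u..t} (\<lambda>s. (\<Sum>i<n. x i s) / real n)"
      unfolding f_mean by simp
    finally show ?thesis .
  qed
  have mean_eq: "(\<Sum>j<n. x j t) / real n = (\<Sum>j<n. x j u) / real n
      + ((\<Sum>j<n. w j t) / real n - (\<Sum>j<n. w j u) / real n)
      - b * integral {u..t} (\<lambda>s. (\<Sum>i<n. x i s) / real n)" if t: "t \<in> {u..<u+1}" for t
  proof -
    have "(\<Sum>j<n. x j t) = (\<Sum>j<n. x j u + (w j t - w j u) + integral {u..t} (f j))"
      unfolding f_def by (rule sum.cong[OF refl], rule eq) (use t in auto)
    then have "(\<Sum>j<n. x j t) / real n = (\<Sum>j<n. x j u) / real n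
      + ((\<Sum>j<n. w j t) / real n - (\<Sum>j<n. w j u) / real n) + (\<Sum>j<n. integral {u..t} (f j)) / real n"
      by (simp add: sum.distrib sum_subtractf add_divide_distrib diff_divide_distrib)
    then show ?thesis using mean_int t by simp
  qed
  have mean_lim: "((\<lambda>t. (\<Sum>j<n. x j t) / real n) \<longlongrightarrow> (\<Sum>j<n. L j) / real n) (at_left (u+1))"
    by (intro tendsto_intros lim) (use n in auto)
  show ?mean
    unfolding stieltjes_sum_def exponential_weight_def
    by (rule linear_sde_stieltjes_limit[OF meanc mean_lim mean_eq])
  assume j: "j < n"
  show "(\<lambda>k. stieltjes_sum (b + \<gamma>) k u (\<lambda>t. w j t - (\<Sum>i<n. w i t) / real n))
           \<longlonglongrightarrow> (L j - (\<Sum>i<n. L i) / real n) - exp (- (b + \<gamma>)) * (x j u - (\<Sum>i<n. x i u) / real n)"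
    unfolding stieltjes_sum_def exponential_weight_def
  proof (rule linear_sde_stieltjes_limit)
    show "continuous_on {u..<u+1} (\<lambda>t. x j t - (\<Sum>i<n. x i t) / real n)"
      by (intro continuous_on_diff cont meanc j)
    show "((\<lambda>t. x j t - (\<Sum>i<n. x i t) / real n) \<longlongrightarrow> L j - (\<Sum>i<n. L i) / real n) (at_left (u+1))"
      by (intro tendsto_diff lim mean_lim j)
    fix t assume t: "t \<in> {u..<u+1}"
    let ?m = "\<lambda>s. (\<Sum>i<n. x i s) / real n"
    have "integral {u..t} (f j) = integral {u..t} (\<lambda>s. - b * ?m s + - (b + \<gamma>) * (x j s - ?m s))"
    proof (rule integral_cong)
      have "- b * p + \<gamma> * (q - p) = - b * q + - (b + \<gamma>) * (p - q)" for p q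
        by (simp add: algebra_simps)
      then show "f j s = - b * ?m s + - (b + \<gamma>) * (x j s - ?m s)" for s
        unfolding f_def .
    qed
    also have "\<dots> = - b * integral {u..t} ?m - (b + \<gamma>) * integral {u..t} (\<lambda>s. x j s - ?m s)"
    proof -
      have d: "(\<lambda>s. x j s - ?m s) integrable_on {u..t}"
        by (intro Henstock_Kurzweil_Integration.integrable_diff xi mi) (use j t in auto)
      have m: "?m integrable_on {u..t}" using mi t by simp
      have "integral {u..t} (\<lambda>s. - b * ?m s + - (b + \<gamma>) * (x j s - ?m s))
         = integral {u..t} (\<lambda>s. - b * ?m s) + integral {u..t} (\<lambda>s. - (b + \<gamma>) * (x j s - ?m s))"
        by (rule Henstock_Kurzweil_Integration.integral_add) (intro integrable_on_mult_right d m)+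
      then show ?thesis by (simp, simp add: left_diff_distrib distrib_right)
    qed
    finally have "integral {u..t} (f j) = - b * integral {u..t} ?m - (b + \<gamma>) * integral {u..t} (\<lambda>s. x j s - ?m s)" .
    moreover have "x j t = x j u + (w j t - w j u) + integral {u..t} (f j)"
      unfolding f_def by (rule eq[OF j t])
    ultimately show "x j t - ?m t = x j u - ?m u + (w j t - (\<Sum>i<n. w i t) / real n - (w j u - (\<Sum>i<n. w i u) / real n))
        - (b + \<gamma>) * integral {u..t} (\<lambda>s. x j s - ?m s)"
      using mean_eq[OF t] by linarith
  qed
qed

lemma (in prob_space) brownian_stieltjes_sum_normal:
  fixes B :: "real \<Rightarrow> 'a \<Rightarrow> real ^ 'd"
  assumes B: "standard_brownian_motion_on M u (u + 1) B" and \<xi>: "\<xi> \<noteq> 0" and k: "k > 0"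
  shows "distributed M lborel (\<lambda>\<omega>. stieltjes_sum c k u (\<lambda>t. \<xi> \<bullet> B t \<omega>))
           (normal_density 0 (norm \<xi> * sqrt (stieltjes_variance c k)))"
proof -
  define s where "s l = u + real l / real (Suc k)" for l
  define \<alpha> where "\<alpha> l = exponential_weight c k l" for l
  have \<alpha>: "\<alpha> l > 0" for l by (simp add: \<alpha>_def exponential_weight_def)
  have s_in: "s l \<in> {u..<u+1}" if "l \<le> k" for l using that by (auto simp: s_def)
  have ds: "s (Suc l) - s l = 1 / real (Suc k)" for l by (simp add: s_def add_divide_distrib)
  have "indep_vars (\<lambda>_. borel) (\<lambda>l \<omega>. B (s (Suc l)) \<omega> - B (s l) \<omega>) {..<k}"
  proof -
    have "(\<forall>l\<le>k. s l \<in> {u..<u+1}) \<and> (\<forall>l<k. s l \<le> s (Suc l))"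
      using s_in by (auto simp: s_def divide_right_mono)
    then show ?thesis using B unfolding standard_brownian_motion_on_def by blast
  qed
  then have ind: "indep_vars (\<lambda>_. borel) (\<lambda>l \<omega>. \<alpha> l * (\<xi> \<bullet> (B (s (Suc l)) \<omega> - B (s l) \<omega>))) {..<k}"
    by (rule indep_vars_compose2) measurable
  have inc: "distributed M lborel (\<lambda>\<omega>. \<alpha> l * (\<xi> \<bullet> (B (s (Suc l)) \<omega> - B (s l) \<omega>)))
      (normal_density 0 (\<alpha> l * (sqrt (1 / real (Suc k)) * norm \<xi>)))" if l: "l < k" for l
  proof -
    have "s l < s (Suc l)" using ds[of l] by (metis diff_gt_0_iff_gt of_nat_0_less_iff zero_less_Suc zero_less_divide_1_iff)
    then have "distributed M lborel (\<lambda>\<omega>. B (s (Suc l)) \<omega> - B (s l) \<omega>)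
          (\<lambda>x. ennreal (\<Prod>k\<in>UNIV. normal_density 0 (sqrt (s (Suc l) - s l)) (x $ k)))"
      using B s_in[of l] s_in[of "Suc l"] l unfolding standard_brownian_motion_on_def by auto
    then have "distributed M lborel (\<lambda>\<omega>. \<xi> \<bullet> (B (s (Suc l)) \<omega> - B (s l) \<omega>))
          (normal_density 0 (sqrt (1 / real (Suc k)) * norm \<xi>))"
      unfolding ds by (rule isotropic_normal_projection) (use \<xi> in auto)
    from normal_density_affine[OF this, of "\<alpha> l" 0] show ?thesis using \<xi> \<alpha>[of l] by simp
  qed
  have "distributed M lborel (\<lambda>\<omega>. \<Sum>l<k. \<alpha> l * (\<xi> \<bullet> (B (s (Suc l)) \<omega> - B (s l) \<omega>)))
     (normal_density (\<Sum>l<k. 0) (sqrt (\<Sum>l<k. (\<alpha> l * (sqrt (1 / real (Suc k)) * norm \<xi>))\<^sup>2)))"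
    by (rule sum_indep_normal[OF _ _ ind _ inc]) (use k \<alpha> \<xi> in auto)
  moreover have "sqrt (\<Sum>l<k. (\<alpha> l * (sqrt (1 / real (Suc k)) * norm \<xi>))\<^sup>2) = norm \<xi> * sqrt (stieltjes_variance c k)"
  proof -
    have "(\<Sum>l<k. (\<alpha> l * (sqrt (1 / real (Suc k)) * norm \<xi>))\<^sup>2) = (norm \<xi>)\<^sup>2 * stieltjes_variance c k"
      unfolding stieltjes_variance_def sum_distrib_left \<alpha>_def[symmetric]
      by (intro sum.cong refl) (simp add: power_mult_distrib power_divide)
    then show ?thesis by (simp add: real_sqrt_mult)
  qed
  ultimately show ?thesis
    by (simp add: stieltjes_sum_def \<alpha>_def s_def inner_diff_right)
qed

section \<open>One generation of the particle system\<close>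

definition label_mean :: "nat \<Rightarrow> (nat \<Rightarrow> real) \<Rightarrow> real" where
  "label_mean m f = (\<Sum>j<2 ^ m. f j) / real (2 ^ m)"

lemma label_mean_0: "label_mean 0 f = f 0"
  by (simp add: label_mean_def)

lemma label_mean_cong: "(\<And>j. j < 2 ^ m \<Longrightarrow> f j = g j) \<Longrightarrow> label_mean m f = label_mean m g"
  unfolding label_mean_def by (auto intro!: sum.cong arg_cong[where f = "\<lambda>s. s / _"])

lemma label_mean_diff: "label_mean m f - label_mean m g = label_mean m (\<lambda>j. f j - g j)"
  by (simp add: label_mean_def sum_subtractf diff_divide_distrib)

lemma label_mean_add: "label_mean m f + label_mean m g = label_mean m (\<lambda>j. f j + g j)"
  by (simp add: label_mean_def sum.distrib add_divide_distrib)

lemma label_mean_mult: "a * label_mean m f = label_mean m (\<lambda>j. a * f j)"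
  by (simp add: label_mean_def sum_distrib_left)

lemma label_mean_const: "label_mean m (\<lambda>_. a) = a"
  by (simp add: label_mean_def)

lemma label_mean_mono: "(\<And>j. j < 2 ^ m \<Longrightarrow> f j \<le> g j) \<Longrightarrow> label_mean m f \<le> label_mean m g"
  unfolding label_mean_def by (intro divide_right_mono sum_mono) auto

lemma abs_label_mean_le: "(\<And>j. j < 2 ^ m \<Longrightarrow> \<bar>f j\<bar> \<le> a) \<Longrightarrow> \<bar>label_mean m f\<bar> \<le> a"
  using label_mean_mono[of m f "\<lambda>_. a"] label_mean_mono[of m "\<lambda>_. - a" f]
  by (simp add: label_mean_const abs_le_iff) (metis minus_le_iff)

lemma label_mean_tendsto:
  "(\<And>j. j < 2 ^ m \<Longrightarrow> (\<lambda>k. f k j) \<longlonglongrightarrow> g j) \<Longrightarrow> (\<lambda>k. label_mean m (f k)) \<longlonglongrightarrow> label_mean m g"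
  unfolding label_mean_def by (intro tendsto_intros) auto

lemma borel_measurable_label_mean:
  "(\<And>j. j < 2 ^ m \<Longrightarrow> f j \<in> borel_measurable N) \<Longrightarrow> (\<lambda>\<omega>. label_mean m (\<lambda>j. f j \<omega>)) \<in> borel_measurable N"
  unfolding label_mean_def by (intro borel_measurable_divide borel_measurable_sum) auto

lemma stieltjes_sum_label_mean:
  "stieltjes_sum c k u (\<lambda>t. label_mean m (\<lambda>j. w j t)) = label_mean m (\<lambda>j. stieltjes_sum c k u (w j))"
proof -
  have "stieltjes_sum c k u (\<lambda>t. label_mean m (\<lambda>j. w j t))
     = (\<Sum>l<k. \<Sum>j<2^m. exponential_weight c k l * (w j (u + real (Suc l) / real (Suc k)) - w j (u + real l / real (Suc k))) / real (2^m))"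
    unfolding stieltjes_sum_def label_mean_diff
    by (simp add: label_mean_def sum_distrib_left sum_divide_distrib)
  also have "\<dots> = (\<Sum>j<2^m. \<Sum>l<k. exponential_weight c k l * (w j (u + real (Suc l) / real (Suc k)) - w j (u + real l / real (Suc k))) / real (2^m))"
    by (rule sum.swap)
  finally show ?thesis by (simp add: label_mean_def stieltjes_sum_def sum_divide_distrib)
qed

lemma stieltjes_sum_diff:
  "stieltjes_sum c k u (\<lambda>t. w t - w' t) = stieltjes_sum c k u w - stieltjes_sum c k u w'"
  by (simp add: stieltjes_sum_def sum_subtractf[symmetric] algebra_simps)

lemma (in prob_space) sets_sigma_of_sigma_sets:
  assumes "A = sigma_sets (space M) X" "A \<subseteq> events"
  shows "sets (sigma (space M) A) = A"
proof -
  have "A \<subseteq> Pow (space M)" using assms(2) sets.space_closed by blast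
  moreover have "X \<subseteq> A" using assms(1) by auto
  ultimately show ?thesis using assms(1) sigma_sets_sigma_sets_eq[of X "space M"] by (simp add: sets_measure_of)
qed

context interacting_branching_diffusion
begin

definition barycentre :: "nat \<Rightarrow> real ^ 'd \<Rightarrow> 'a \<Rightarrow> real" where
  "barycentre m \<xi> \<omega> = label_mean m (\<lambda>j. \<xi> \<bullet> Z (real m) j \<omega>)"

text \<open>
  Positions are taken relative to the barycentre, because the deviations from it satisfy a closed
  linear equation.
\<close>

definition centred_cosine :: "real \<Rightarrow> nat \<Rightarrow> real ^ 'd \<Rightarrow> 'a \<Rightarrow> real" where
  "centred_cosine \<theta> m \<xi> \<omega> = label_mean m (\<lambda>j. cos (\<xi> \<bullet> Z (real m) j \<omega> - barycentre m \<xi> \<omega> + \<theta>))"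

definition noise :: "real \<Rightarrow> nat \<Rightarrow> real ^ 'd \<Rightarrow> nat \<Rightarrow> nat \<Rightarrow> 'a \<Rightarrow> real" where
  "noise c m \<xi> k j \<omega> = stieltjes_sum c k (real m) (\<lambda>t. \<xi> \<bullet> W m j t \<omega>)"

text \<open>
  Here \<open>L j\<close> is the left limit of the path \<open>j\<close> at the end of its generation.  Exactly two of the
  new particles start there, so an average over the new generation is an average over the \<open>L j\<close>,
  whatever the random labelling of the offspring.  The two limits give the motion within
  the generation: relaxation of the barycentre at rate \<open>b\<close>, of the deviations at rate \<open>b + \<gamma>\<close>.
\<close>

lemma generation_step:
  "AE \<omega> in M. \<forall>m. \<exists>L. (\<forall>F :: real ^ 'd \<Rightarrow> real.
        label_mean (Suc m) (\<lambda>i. F (Z (real (Suc m)) i \<omega>)) = label_mean m (\<lambda>j. F (L j))) \<and>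
      (\<forall>\<xi>. (\<lambda>k. label_mean m (\<lambda>j. noise b m \<xi> k j \<omega>)) \<longlonglongrightarrow>
        label_mean m (\<lambda>j. \<xi> \<bullet> L j) - exp (- b) * barycentre m \<xi> \<omega>) \<and>
      (\<forall>\<xi>. \<forall>j<2 ^ m. (\<lambda>k. noise (b + \<gamma>) m \<xi> k j \<omega> - label_mean m (\<lambda>i. noise (b + \<gamma>) m \<xi> k i \<omega>)) \<longlonglongrightarrow>
        (\<xi> \<bullet> L j - label_mean m (\<lambda>i. \<xi> \<bullet> L i)) - exp (- (b + \<gamma>)) * (\<xi> \<bullet> Z (real m) j \<omega> - barycentre m \<xi> \<omega>))"
  using binary Z_continuous sde branching
proof eventually_elim
  case (elim \<omega>)
  show ?case
  proof
    fix m
    define N where "N = (2::nat) ^ m"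
    have N: "N > 0" by (simp add: N_def)
    have par: "parent m i \<omega> < N" if "i < 2 ^ Suc m" for i using elim(1) that by (auto simp: N_def)
    have two: "card {i. i < 2 ^ Suc m \<and> parent m i \<omega> = j} = 2" if "j < N" for j using elim(1) that by (auto simp: N_def)
    have "\<exists>i. i < 2 ^ Suc m \<and> parent m i \<omega> = j" if "j < N" for j
    proof -
      have "{i. i < 2 ^ Suc m \<and> parent m i \<omega> = j} \<noteq> {}" using two[OF that] by (metis card.empty zero_neq_numeral)
      then show ?thesis by blast
    qed
    then obtain child where child: "\<And>j. j < N \<Longrightarrow> child j < 2 ^ Suc m \<and> parent m (child j) \<omega> = j" by metis
    define L where "L j = Z (real (Suc m)) (child j) \<omega>" for j
    have lim: "((\<lambda>t. Z t j \<omega>) \<longlongrightarrow> L j) (at_left (real m + 1))" if "j < N" for j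
      using elim(4)[rule_format, of "child j" m] child[OF that] by (simp add: L_def add.commute)
    have Z_L: "Z (real (Suc m)) i \<omega> = L (parent m i \<omega>)" if "i < 2 ^ Suc m" for i
    proof (rule tendsto_unique)
      show "((\<lambda>t. Z t (parent m i \<omega>) \<omega>) \<longlongrightarrow> Z (real (Suc m)) i \<omega>) (at_left (real m + 1))"
        using elim(4)[rule_format, OF that] by (simp add: add.commute)
      show "((\<lambda>t. Z t (parent m i \<omega>) \<omega>) \<longlongrightarrow> L (parent m i \<omega>)) (at_left (real m + 1))"
        by (rule lim[OF par[OF that]])
    qed (rule trivial_limit_at_left_real)
    have mean_F: "label_mean (Suc m) (\<lambda>i. F (Z (real (Suc m)) i \<omega>)) = label_mean m (\<lambda>j. F (L j))" for F :: "real ^ 'd \<Rightarrow> real"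
    proof -
      have "(\<Sum>i<2 ^ Suc m. F (Z (real (Suc m)) i \<omega>)) = (\<Sum>i<2 ^ Suc m. F (L (parent m i \<omega>)))"
        by (rule sum.cong) (use Z_L in auto)
      also have "\<dots> = (\<Sum>j<N. \<Sum>i\<in>{i \<in> {..<2 ^ Suc m}. parent m i \<omega> = j}. F (L (parent m i \<omega>)))"
        by (rule sum.group[symmetric]) (use par in auto)
      also have "\<dots> = (\<Sum>j<N. 2 * F (L j))"
      proof (rule sum.cong[OF refl])
        fix j assume "j \<in> {..<N}"
        then have "card {i \<in> {..<2 ^ Suc m}. parent m i \<omega> = j} = 2" using two[of j] by simp
        then show "(\<Sum>i\<in>{i \<in> {..<2 ^ Suc m}. parent m i \<omega> = j}. F (L (parent m i \<omega>))) = 2 * F (L j)" by simp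
      qed
      finally show ?thesis by (simp add: label_mean_def N_def sum_distrib_left[symmetric])
    qed
    have lim_noise: "(\<lambda>k. label_mean m (\<lambda>j. noise b m \<xi> k j \<omega>)) \<longlonglongrightarrow>
          label_mean m (\<lambda>j. \<xi> \<bullet> L j) - exp (- b) * barycentre m \<xi> \<omega>"
        "j < 2 ^ m \<Longrightarrow> (\<lambda>k. noise (b + \<gamma>) m \<xi> k j \<omega> - label_mean m (\<lambda>i. noise (b + \<gamma>) m \<xi> k i \<omega>)) \<longlonglongrightarrow>
          (\<xi> \<bullet> L j - label_mean m (\<lambda>i. \<xi> \<bullet> L i)) - exp (- (b + \<gamma>)) * (\<xi> \<bullet> Z (real m) j \<omega> - barycentre m \<xi> \<omega>)"
      for \<xi> j
    proof -
      define x where "x j t = \<xi> \<bullet> Z t j \<omega>" for j t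
      define w where "w j t = \<xi> \<bullet> W m j t \<omega>" for j t
      have Zc: "continuous_on {real m..<real m + 1} (\<lambda>t. Z t j \<omega>)" if "j < N" for j
        using elim(2)[rule_format, of j m] that by (simp add: N_def add.commute)
      have cont: "continuous_on {real m..<real m + 1} (x j)" if "j < N" for j
        unfolding x_def by (intro continuous_intros Zc that)
      have xlim: "(x j \<longlongrightarrow> \<xi> \<bullet> L j) (at_left (real m + 1))" if "j < N" for j
        unfolding x_def by (intro tendsto_intros lim that)
      have eq: "x j t = x j (real m) + (w j t - w j (real m))
          + integral {real m..t} (\<lambda>s. - b * x j s + \<gamma> * ((\<Sum>i<N. x i s) / real N - x j s))"
        if j: "j < N" and t: "t \<in> {real m..<real m + 1}" for j t
      proof -
        let ?f = "\<lambda>s. - b *\<^sub>R Z s j \<omega> + (1 / 2 ^ m) *\<^sub>R (\<Sum>i<2 ^ m. \<gamma> *\<^sub>R (Z s i \<omega> - Z s j \<omega>))"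
        have "continuous_on {real m..t} ?f"
          by (intro continuous_intros continuous_on_subset[OF Zc]) (use t j in \<open>auto simp: N_def\<close>)
        then have "?f integrable_on {real m..t}" by (rule integrable_continuous_real)
        then have "integral {real m..t} ((\<lambda>z. \<xi> \<bullet> z) \<circ> ?f) = \<xi> \<bullet> integral {real m..t} ?f"
          by (rule integral_linear[OF _ bounded_linear_inner_right])
        moreover have "(\<lambda>z. \<xi> \<bullet> z) \<circ> ?f = (\<lambda>s. - b * x j s + \<gamma> * ((\<Sum>i<N. x i s) / real N - x j s))"
        proof
          fix s
          have "(\<Sum>i<2 ^ m. \<gamma> * (x i s - x j s)) = \<gamma> * ((\<Sum>i<N. x i s) - real N * x j s)"
            by (simp add: sum_distrib_left[symmetric] sum_subtractf N_def)
          moreover have "(1 / 2 ^ m) * (\<gamma> * ((\<Sum>i<N. x i s) - real N * x j s)) = \<gamma> * ((\<Sum>i<N. x i s) / real N - x j s)"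
            by (simp add: N_def field_simps)
          ultimately show "((\<lambda>z. \<xi> \<bullet> z) \<circ> ?f) s = - b * x j s + \<gamma> * ((\<Sum>i<N. x i s) / real N - x j s)"
            by (simp add: inner_add_right inner_sum_right inner_diff_right x_def)
        qed
        moreover have "Z t j \<omega> = Z (real m) j \<omega> + (W m j t \<omega> - W m j (real m) \<omega>) + integral {real m..t} ?f"
          using elim(3)[rule_format, of j m t] j t by (auto simp: N_def)
        then have "x j t = x j (real m) + (w j t - w j (real m)) + \<xi> \<bullet> integral {real m..t} ?f"
          by (simp add: x_def w_def inner_add_right inner_diff_right)
        ultimately show ?thesis by simp
      qed
      note lims = mean_field_stieltjes_limits[OF N cont xlim eq]
      have "(\<lambda>k. stieltjes_sum b k (real m) (\<lambda>t. label_mean m (\<lambda>j. w j t))) \<longlonglongrightarrow>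
          label_mean m (\<lambda>j. \<xi> \<bullet> L j) - exp (- b) * barycentre m \<xi> \<omega>"
        using lims(1) by (simp add: label_mean_def barycentre_def N_def x_def)
      then show "(\<lambda>k. label_mean m (\<lambda>j. noise b m \<xi> k j \<omega>)) \<longlonglongrightarrow>
          label_mean m (\<lambda>j. \<xi> \<bullet> L j) - exp (- b) * barycentre m \<xi> \<omega>"
        unfolding stieltjes_sum_label_mean by (simp add: noise_def w_def)
      assume "j < 2 ^ m"
      then have "(\<lambda>k. stieltjes_sum (b + \<gamma>) k (real m) (\<lambda>t. w j t - label_mean m (\<lambda>i. w i t))) \<longlonglongrightarrow>
          (\<xi> \<bullet> L j - label_mean m (\<lambda>i. \<xi> \<bullet> L i)) - exp (- (b + \<gamma>)) * (\<xi> \<bullet> Z (real m) j \<omega> - barycentre m \<xi> \<omega>)"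
        using lims(2)[of j] by (simp add: label_mean_def barycentre_def N_def x_def)
      then show "(\<lambda>k. noise (b + \<gamma>) m \<xi> k j \<omega> - label_mean m (\<lambda>i. noise (b + \<gamma>) m \<xi> k i \<omega>)) \<longlonglongrightarrow>
          (\<xi> \<bullet> L j - label_mean m (\<lambda>i. \<xi> \<bullet> L i)) - exp (- (b + \<gamma>)) * (\<xi> \<bullet> Z (real m) j \<omega> - barycentre m \<xi> \<omega>)"
        unfolding stieltjes_sum_diff stieltjes_sum_label_mean by (simp add: noise_def w_def)
    qed
    show "\<exists>L. (\<forall>F :: real ^ 'd \<Rightarrow> real.
        label_mean (Suc m) (\<lambda>i. F (Z (real (Suc m)) i \<omega>)) = label_mean m (\<lambda>j. F (L j))) \<and>
      (\<forall>\<xi>. (\<lambda>k. label_mean m (\<lambda>j. noise b m \<xi> k j \<omega>)) \<longlonglongrightarrow>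
        label_mean m (\<lambda>j. \<xi> \<bullet> L j) - exp (- b) * barycentre m \<xi> \<omega>) \<and>
      (\<forall>\<xi>. \<forall>j<2 ^ m. (\<lambda>k. noise (b + \<gamma>) m \<xi> k j \<omega> - label_mean m (\<lambda>i. noise (b + \<gamma>) m \<xi> k i \<omega>)) \<longlonglongrightarrow>
        (\<xi> \<bullet> L j - label_mean m (\<lambda>i. \<xi> \<bullet> L i)) - exp (- (b + \<gamma>)) * (\<xi> \<bullet> Z (real m) j \<omega> - barycentre m \<xi> \<omega>))"
      using mean_F lim_noise by blast
  qed
qed

definition past :: "nat \<Rightarrow> 'a measure" where
  "past m = sigma (space M) (past_events M W parent Z m)"

definition noise_field :: "nat \<Rightarrow> 'a measure" where
  "noise_field m = sigma (space M) (noise_events M W {m})"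

lemma
  shows sets_past: "sets (past m) = past_events M W parent Z m"
    and sets_noise_field: "sets (noise_field m) = noise_events M W {m}"
    and subalgebra_past: "subalgebra M (past m)"
    and subalgebra_noise_field: "subalgebra M (noise_field m)"
    and indep_past_noise_field: "indep_set (sets (past m)) (sets (noise_field m))"
proof -
  have sub: "past_events M W parent Z m \<subseteq> events" "noise_events M W {m} \<subseteq> events"
    using brownian_indep_past[of m] unfolding indep_set_def indep_sets_def by (auto split: bool.splits)
  show 1: "sets (past m) = past_events M W parent Z m"
    unfolding past_def by (rule sets_sigma_of_sigma_sets[OF past_events_def sub(1)])
  show 2: "sets (noise_field m) = noise_events M W {m}"
    unfolding noise_field_def by (rule sets_sigma_of_sigma_sets[OF noise_events_def sub(2)])
  show "subalgebra M (past m)" "subalgebra M (noise_field m)"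
    unfolding subalgebra_def using sub 1 2 by (auto simp: past_def noise_field_def space_measure_of_conv)
  show "indep_set (sets (past m)) (sets (noise_field m))"
    unfolding 1 2 indep_sets2_eq using brownian_indep_past[of m]
    unfolding indep_sets2_eq by (metis Int_commute mult.commute)
qed

lemma position_measurable_past:
  assumes "j < 2 ^ m"
  shows "Z (real m) j \<in> borel_measurable (past m)"
proof (rule measurableI)
  fix A :: "(real ^ 'd) set" assume A: "A \<in> sets borel"
  have "Z (real m) j -` A \<inter> space M \<in> generated_events M borel (\<lambda>(s, i). Z s i)
          {(s, i). 0 \<le> s \<and> s \<le> real m \<and> i < 2 ^ nat \<lfloor>s\<rfloor>}"
    unfolding generated_events_def
  proof (rule sigma_sets.Basic)
    show "Z (real m) j -` A \<inter> space M \<in> {(case t of (s, i) \<Rightarrow> Z s i) -` A \<inter> space M |t A.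
         t \<in> {(s, i). 0 \<le> s \<and> s \<le> real m \<and> i < 2 ^ nat \<lfloor>s\<rfloor>} \<and> A \<in> sets borel}"
      using A assms by (intro CollectI exI[of _ "(real m, j)"] exI[of _ A]) auto
  qed
  then have "Z (real m) j -` A \<inter> space M \<in> past_events M W parent Z m"
    unfolding past_events_def by (intro sigma_sets.Basic) auto
  then show "Z (real m) j -` A \<inter> space (past m) \<in> sets (past m)"
    unfolding sets_past by (simp add: past_def space_measure_of_conv)
qed auto

lemma path_measurable:
  assumes "t \<in> {real m..<real (Suc m)}" and sp: "space N = space M"
    and N: "motion_events M W m j \<subseteq> sets N"
  shows "W m j t \<in> borel_measurable N"
proof (rule measurableI)
  fix A :: "(real ^ 'd) set" assume "A \<in> sets borel"
  then have "W m j t -` A \<inter> space M \<in> motion_events M W m j"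
    unfolding motion_events_def generated_events_def using assms(1) by (intro sigma_sets.Basic) blast
  then show "W m j t -` A \<inter> space N \<in> sets N" using N sp by auto
qed auto

lemma noise_measurable:
  assumes "space N = space M" "motion_events M W m j \<subseteq> sets N"
  shows "noise c m \<xi> k j \<in> borel_measurable N"
proof -
  have "W m j (real m + real l / real (Suc k)) \<in> borel_measurable N" if "l \<le> k" for l
    by (rule path_measurable[OF _ assms]) (use that in \<open>auto simp: field_simps\<close>)
  then show ?thesis
    unfolding noise_def[abs_def] stieltjes_sum_def
    by (intro borel_measurable_sum borel_measurable_times borel_measurable_diff borel_measurable_inner borel_measurable_const)
      (auto simp del: of_nat_Suc)
qed

lemma noise_measurable_field: "j < 2 ^ m \<Longrightarrow> noise c m \<xi> k j \<in> borel_measurable (noise_field m)"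
proof (rule noise_measurable)
  assume "j < 2 ^ m"
  then show "motion_events M W m j \<subseteq> sets (noise_field m)"
    unfolding sets_noise_field noise_events_def by (auto intro!: sigma_sets.Basic)
qed (simp add: noise_field_def space_measure_of_conv)

lemma noise_measurable_M: "j < 2 ^ m \<Longrightarrow> noise c m \<xi> k j \<in> borel_measurable M"
  using measurable_from_subalg[OF subalgebra_noise_field noise_measurable_field] .

lemma indep_vars_noise: "indep_vars (\<lambda>_. borel) (noise c m \<xi> k) {..<2 ^ m}"
  unfolding indep_vars_def
proof (intro conjI ballI)
  fix j :: nat assume "j \<in> {..<2 ^ m}"
  then show "noise c m \<xi> k j \<in> borel_measurable M" by (simp add: noise_measurable_M)
next
  show "indep_sets (\<lambda>j. sigma_sets (space M) {noise c m \<xi> k j -` A \<inter> space M |A. A \<in> sets borel}) {..<2 ^ m}"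
  proof (rule indep_sets_mono_sets[OF brownian_indep[of m]])
    fix j :: nat assume j: "j \<in> {..<2 ^ m}"
    have ev: "motion_events M W m j \<subseteq> events"
      using brownian_indep[of m] j unfolding indep_sets_def by auto
    let ?N = "sigma (space M) (motion_events M W m j)"
    have sN: "sets ?N = motion_events M W m j"
      by (rule sets_sigma_of_sigma_sets[OF _ ev]) (simp add: motion_events_def generated_events_def)
    have sp: "space ?N = space M" by (simp add: space_measure_of_conv)
    have m: "noise c m \<xi> k j \<in> borel_measurable ?N"
      by (rule noise_measurable[OF sp]) (simp add: sN)
    have "sigma_sets (space ?N) {noise c m \<xi> k j -` A \<inter> space ?N |A. A \<in> sets borel} \<subseteq> sets ?N"
      by (rule sets.sigma_sets_subset) (use m in \<open>auto intro: measurable_sets\<close>)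
    then show "sigma_sets (space M) {noise c m \<xi> k j -` A \<inter> space M |A. A \<in> sets borel} \<subseteq> motion_events M W m j"
      unfolding sN sp .
  qed
qed

lemma noise_normal:
  assumes "j < 2 ^ m" "\<xi> \<noteq> 0" "k > 0"
  shows "distributed M lborel (noise c m \<xi> k j) (normal_density 0 (norm \<xi> * sqrt (stieltjes_variance c k)))"
proof -
  have "standard_brownian_motion_on M (real m) (real m + 1) (W m j)"
    using brownian[OF assms(1)] by (simp add: add.commute)
  from brownian_stieltjes_sum_normal[OF this assms(2,3)] show ?thesis
    unfolding noise_def[abs_def] .
qed

lemma position_measurable: "j < 2 ^ m \<Longrightarrow> Z (real m) j \<in> borel_measurable M"
  using measurable_from_subalg[OF subalgebra_past position_measurable_past] .

lemma barycentre_measurable_past: "barycentre m \<xi> \<in> borel_measurable (past m)"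
  unfolding barycentre_def[abs_def]
  by (intro borel_measurable_label_mean borel_measurable_inner borel_measurable_const position_measurable_past)

lemma barycentre_measurable: "barycentre m \<xi> \<in> borel_measurable M"
  using measurable_from_subalg[OF subalgebra_past barycentre_measurable_past] .

lemma centred_cosine_measurable: "centred_cosine \<theta> m \<xi> \<in> borel_measurable M"
  unfolding centred_cosine_def[abs_def]
proof (rule borel_measurable_label_mean)
  fix j :: nat assume "j < 2 ^ m"
  note [measurable] = barycentre_measurable[of m \<xi>] position_measurable[OF this]
  show "(\<lambda>\<omega>. cos (\<xi> \<bullet> Z (real m) j \<omega> - barycentre m \<xi> \<omega> + \<theta>)) \<in> borel_measurable M" by measurable
qed

lemma barycentre_scale: "barycentre m (a *\<^sub>R \<xi>) \<omega> = a * barycentre m \<xi> \<omega>"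
  by (simp add: barycentre_def label_mean_mult)

lemma mean_noise_second_moment:
  assumes c: "c > 0" and \<xi>: "\<xi> \<noteq> 0"
  shows "second_moment_le (\<lambda>\<omega>. label_mean m (\<lambda>j. noise c m \<xi> (Suc k) j \<omega>)) ((norm \<xi>)\<^sup>2 / 2 ^ m)"
proof (rule second_moment_leI)
  let ?\<sigma> = "norm \<xi> * sqrt (stieltjes_variance c (Suc k))"
  have pos: "stieltjes_variance c (Suc k) > 0" by (rule stieltjes_variance_pos) simp
  have \<sigma>: "?\<sigma> > 0" using \<xi> pos by simp
  note n = normal_average_second_moment[OF _ indep_vars_noise noise_normal[OF _ \<xi>] \<sigma>]
  show "integrable M (\<lambda>\<omega>. (label_mean m (\<lambda>j. noise c m \<xi> (Suc k) j \<omega>))\<^sup>2)"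
    unfolding label_mean_def by (rule n(2)) auto
  have "expectation (\<lambda>\<omega>. (label_mean m (\<lambda>j. noise c m \<xi> (Suc k) j \<omega>))\<^sup>2) \<le> ?\<sigma>\<^sup>2 / real (2 ^ m)"
    unfolding label_mean_def by (rule n(1)) auto
  also have "?\<sigma>\<^sup>2 \<le> (norm \<xi>)\<^sup>2 * 1"
    unfolding power_mult_distrib using stieltjes_variance_le_1[OF c, of "Suc k"] pos
    by (intro mult_left_mono) auto
  finally show "expectation (\<lambda>\<omega>. (label_mean m (\<lambda>j. noise c m \<xi> (Suc k) j \<omega>))\<^sup>2) \<le> (norm \<xi>)\<^sup>2 / 2 ^ m"
    by (simp add: divide_right_mono)
qed

text \<open>
  The noise of the barycentre is a mean of \<open>2 ^ m\<close> independent Gaussian variables.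
\<close>

lemma barycentre_step:
  assumes b: "b > 0"
  shows "second_moment_le (\<lambda>\<omega>. barycentre (Suc m) \<xi> \<omega> - exp (- b) * barycentre m \<xi> \<omega>) ((norm \<xi>)\<^sup>2 / 2 ^ m)"
proof (cases "\<xi> = 0")
  case True
  then show ?thesis by (intro second_moment_le_const) (simp add: barycentre_def label_mean_const)
next
  case False
  show ?thesis
  proof (rule second_moment_le_limit)
    show "AE \<omega> in M. (\<lambda>k. label_mean m (\<lambda>j. noise b m \<xi> (Suc k) j \<omega>)) \<longlonglongrightarrow>
       barycentre (Suc m) \<xi> \<omega> - exp (- b) * barycentre m \<xi> \<omega>"
      using generation_step
    proof eventually_elim
      case (elim \<omega>)
      then obtain L where F: "\<And>F :: real ^ 'd \<Rightarrow> real. label_mean (Suc m) (\<lambda>i. F (Z (real (Suc m)) i \<omega>)) = label_mean m (\<lambda>j. F (L j))"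
        and l: "(\<lambda>k. label_mean m (\<lambda>j. noise b m \<xi> k j \<omega>)) \<longlonglongrightarrow> label_mean m (\<lambda>j. \<xi> \<bullet> L j) - exp (- b) * barycentre m \<xi> \<omega>"
        by blast
      have "label_mean m (\<lambda>j. \<xi> \<bullet> L j) = barycentre (Suc m) \<xi> \<omega>"
        unfolding barycentre_def F ..
      then show ?case using LIMSEQ_Suc[OF l] by simp
    qed
    show "(\<lambda>\<omega>. label_mean m (\<lambda>j. noise b m \<xi> (Suc k) j \<omega>)) \<in> borel_measurable M" for k
      by (intro borel_measurable_label_mean noise_measurable_M)
  qed (rule mean_noise_second_moment[OF b False])
qed

text \<open>
  In one generation every deviation shrinks by \<open>exp (- (b + \<gamma>))\<close> and receives fresh Gaussian
  noise.  On characteristic functions this means a change of the frequency and multiplication by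
  the Gaussian factor \<open>q\<close>, up to a fluctuation over \<open>2 ^ m\<close> conditionally independent particles.
  The deviations are driven by the noise minus its mean, and the mean contributes an error of the
  same order.
\<close>

lemma centred_cosine_step:
  assumes c: "b + \<gamma> > 0"
  defines "q \<equiv> \<lambda>\<xi> :: real ^ 'd. exp (- ((norm \<xi>)\<^sup>2 * ((1 - exp (- 2 * (b + \<gamma>))) / (2 * (b + \<gamma>)))) / 2)"
  shows "second_moment_le (\<lambda>\<omega>. centred_cosine \<theta> (Suc m) \<xi> \<omega> - q \<xi> * centred_cosine \<theta> m (exp (- (b + \<gamma>)) *\<^sub>R \<xi>) \<omega>)
           (8 * (norm \<xi>)\<^sup>2 / 2 ^ m)"
proof (cases "\<xi> = 0")
  case True
  then show ?thesis
    by (intro second_moment_le_const) (simp add: centred_cosine_def barycentre_def label_mean_const q_def)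
next
  case False
  define c where "c = b + \<gamma>"
  have c0: "c > 0" using c by (simp add: c_def)
  define a where "a j \<omega> = exp (- c) * (\<xi> \<bullet> Z (real m) j \<omega> - barycentre m \<xi> \<omega>) + \<theta>" for j \<omega>
  define v where "v k j \<omega> = noise c m \<xi> (Suc k) j \<omega>" for k j \<omega>
  define q' where "q' k = exp (- (norm \<xi> * sqrt (stieltjes_variance c (Suc k)))\<^sup>2 / 2)" for k
  define X where "X k \<omega> = label_mean m (\<lambda>j. cos (a j \<omega> + (v k j \<omega> - label_mean m (\<lambda>i. v k i \<omega>))))
      - q' k * label_mean m (\<lambda>j. cos (a j \<omega>))" for k \<omega>
  \<comment> \<open>\<open>X\<close> is driven by the centred noise; in \<open>D\<close> the noises are independent.\<close>
  define D where "D k \<omega> = (\<Sum>j<2 ^ m. cos (a j \<omega> + v k j \<omega>) - q' k * cos (a j \<omega>)) / real (2 ^ m)" for k \<omega>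
  have a_past: "a j \<in> borel_measurable (past m)" if "j < 2 ^ m" for j
    unfolding a_def[abs_def]
    by (intro borel_measurable_add borel_measurable_times borel_measurable_diff borel_measurable_inner
        borel_measurable_const position_measurable_past[OF that] barycentre_measurable_past)
  have v_field: "v k j \<in> borel_measurable (noise_field m)" if "j < 2 ^ m" for k j
    unfolding v_def[abs_def] by (rule noise_measurable_field[OF that])
  have a_M: "a j \<in> borel_measurable M" if "j < 2 ^ m" for j
    using measurable_from_subalg[OF subalgebra_past a_past[OF that]] .
  have v_M: "v k j \<in> borel_measurable M" if "j < 2 ^ m" for k j
    using measurable_from_subalg[OF subalgebra_noise_field v_field[OF that]] .
  have vm_M: "(\<lambda>\<omega>. label_mean m (\<lambda>i. v k i \<omega>)) \<in> borel_measurable M" for k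
    by (intro borel_measurable_label_mean v_M)
  have X_M: "X k \<in> borel_measurable M" for k
    unfolding X_def[abs_def]
    by (intro borel_measurable_diff borel_measurable_times borel_measurable_const borel_measurable_label_mean
        measurable_compose[OF _ borel_measurable_cos] borel_measurable_add a_M v_M vm_M)
  have D_M: "D k \<in> borel_measurable M" for k
    unfolding D_def[abs_def]
    by (intro borel_measurable_divide borel_measurable_sum borel_measurable_diff borel_measurable_times borel_measurable_const
        measurable_compose[OF _ borel_measurable_cos] borel_measurable_add a_M v_M) auto
  have D2: "second_moment_le (D k) (3 * (norm \<xi>)\<^sup>2 / 2 ^ m)" for k
  proof (rule second_moment_leI)
    let ?\<sigma> = "norm \<xi> * sqrt (stieltjes_variance c (Suc k))"
    have pos: "stieltjes_variance c (Suc k) > 0" by (rule stieltjes_variance_pos) simp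
    have \<sigma>: "?\<sigma> > 0" using False pos by simp
    have nv: "distributed M lborel (v k j) (normal_density 0 ?\<sigma>)" if "j < 2 ^ m" for j
      unfolding v_def[abs_def] by (rule noise_normal[OF that False]) simp
    have iv: "indep_vars (\<lambda>_. borel) (v k) {..<2 ^ m}"
      unfolding v_def[abs_def] by (rule indep_vars_noise)
    note n = cosine_average_second_moment[OF _ iv nv \<sigma> indep_past_noise_field subalgebra_past subalgebra_noise_field a_past v_field]
    show "integrable M (\<lambda>\<omega>. (D k \<omega>)\<^sup>2)" unfolding D_def q'_def by (rule n(2)) auto
    have "expectation (\<lambda>\<omega>. (D k \<omega>)\<^sup>2) \<le> 3 * ?\<sigma>\<^sup>2 / real (2 ^ m)"
      unfolding D_def q'_def by (rule n(1)) auto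
    also have "?\<sigma>\<^sup>2 \<le> (norm \<xi>)\<^sup>2 * 1"
      unfolding power_mult_distrib using stieltjes_variance_le_1[OF c0, of "Suc k"] pos
      by (intro mult_left_mono) auto
    finally show "expectation (\<lambda>\<omega>. (D k \<omega>)\<^sup>2) \<le> 3 * (norm \<xi>)\<^sup>2 / 2 ^ m"
      by (simp add: divide_right_mono)
  qed
  have vm2: "second_moment_le (\<lambda>\<omega>. label_mean m (\<lambda>i. v k i \<omega>)) ((norm \<xi>)\<^sup>2 / 2 ^ m)" for k
    unfolding v_def by (rule mean_noise_second_moment[OF c0 False])
  have XD: "\<bar>X k \<omega>\<bar> \<le> \<bar>D k \<omega>\<bar> + \<bar>label_mean m (\<lambda>i. v k i \<omega>)\<bar>" for k \<omega>
  proof -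
    have "D k \<omega> = label_mean m (\<lambda>j. cos (a j \<omega> + v k j \<omega>)) - q' k * label_mean m (\<lambda>j. cos (a j \<omega>))"
      unfolding D_def label_mean_mult label_mean_diff by (simp add: label_mean_def)
    then have "X k \<omega> - D k \<omega> = label_mean m (\<lambda>j. cos (a j \<omega> + (v k j \<omega> - label_mean m (\<lambda>i. v k i \<omega>))) - cos (a j \<omega> + v k j \<omega>))"
      unfolding X_def label_mean_diff[symmetric] by simp
    also have "\<bar>\<dots>\<bar> \<le> \<bar>label_mean m (\<lambda>i. v k i \<omega>)\<bar>"
      by (rule abs_label_mean_le, rule order_trans[OF abs_cos_diff_le]) simp
    finally show ?thesis by linarith
  qed
  have X2: "second_moment_le (X k) (8 * (norm \<xi>)\<^sup>2 / 2 ^ m)" for k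
    by (rule second_moment_le_mono[OF second_moment_le_triangle[OF D_M vm_M D2 vm2 _ _ _ AE_I2[OF XD], of 1]])
      auto
  have q_lim: "q' \<longlonglongrightarrow> q \<xi>"
  proof -
    have "(\<lambda>k. exp (- ((norm \<xi>)\<^sup>2 * stieltjes_variance c (Suc k)) / 2)) \<longlonglongrightarrow> q \<xi>"
      unfolding q_def c_def[symmetric]
      by (intro tendsto_intros LIMSEQ_Suc[OF stieltjes_variance_limit[OF c0]]) auto
    moreover have "(norm \<xi> * sqrt (stieltjes_variance c (Suc k)))\<^sup>2 = (norm \<xi>)\<^sup>2 * stieltjes_variance c (Suc k)" for k
      using stieltjes_variance_pos[of "Suc k" c] by (simp add: power_mult_distrib)
    ultimately show ?thesis unfolding q'_def by simp
  qed
  have a_mean: "label_mean m (\<lambda>j. cos (a j \<omega>)) = centred_cosine \<theta> m (exp (- c) *\<^sub>R \<xi>) \<omega>" for \<omega>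
    by (simp add: centred_cosine_def a_def barycentre_scale right_diff_distrib)
  show ?thesis
  proof (rule second_moment_le_limit[OF X_M _ X2])
    show "AE \<omega> in M. (\<lambda>k. X k \<omega>) \<longlonglongrightarrow> centred_cosine \<theta> (Suc m) \<xi> \<omega> - q \<xi> * centred_cosine \<theta> m (exp (- (b + \<gamma>)) *\<^sub>R \<xi>) \<omega>"
      using generation_step
    proof eventually_elim
      case (elim \<omega>)
      then obtain L where F: "\<And>F :: real ^ 'd \<Rightarrow> real. label_mean (Suc m) (\<lambda>i. F (Z (real (Suc m)) i \<omega>)) = label_mean m (\<lambda>j. F (L j))"
        and l: "\<And>j. j < 2 ^ m \<Longrightarrow> (\<lambda>k. noise c m \<xi> k j \<omega> - label_mean m (\<lambda>i. noise c m \<xi> k i \<omega>)) \<longlonglongrightarrow>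
          (\<xi> \<bullet> L j - label_mean m (\<lambda>i. \<xi> \<bullet> L i)) - exp (- c) * (\<xi> \<bullet> Z (real m) j \<omega> - barycentre m \<xi> \<omega>)"
        unfolding c_def by blast
      have bar: "label_mean m (\<lambda>j. \<xi> \<bullet> L j) = barycentre (Suc m) \<xi> \<omega>"
        unfolding barycentre_def F ..
      have "(\<lambda>k. label_mean m (\<lambda>j. cos (a j \<omega> + (v k j \<omega> - label_mean m (\<lambda>i. v k i \<omega>))))) \<longlonglongrightarrow>
          label_mean m (\<lambda>j. cos (\<xi> \<bullet> L j - barycentre (Suc m) \<xi> \<omega> + \<theta>))"
      proof (rule label_mean_tendsto)
        fix j :: nat assume "j < 2 ^ m"
        from tendsto_cos[OF tendsto_add[OF tendsto_const[of "a j \<omega>"] LIMSEQ_Suc[OF l[OF this]]]]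
        show "(\<lambda>k. cos (a j \<omega> + (v k j \<omega> - label_mean m (\<lambda>i. v k i \<omega>)))) \<longlonglongrightarrow> cos (\<xi> \<bullet> L j - barycentre (Suc m) \<xi> \<omega> + \<theta>)"
          by (simp add: v_def bar a_def algebra_simps)
      qed
      also have "label_mean m (\<lambda>j. cos (\<xi> \<bullet> L j - barycentre (Suc m) \<xi> \<omega> + \<theta>)) = centred_cosine \<theta> (Suc m) \<xi> \<omega>"
        unfolding centred_cosine_def by (rule F[symmetric])
      finally show ?case
        unfolding X_def a_mean c_def[symmetric] by (intro tendsto_diff tendsto_mult q_lim tendsto_const)
    qed
  qed
qed

end

section \<open>Geometric decay of the errors\<close>

lemma square_of_power: "(a ^ i)\<^sup>2 = (a\<^sup>2) ^ i" for a :: real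
  by (metis mult.commute power_mult)

lemma norm_axis: "norm (axis k a :: real ^ 'd) = \<bar>a\<bar>"
  by (simp add: norm_eq_sqrt_inner inner_axis_axis)

context interacting_branching_diffusion
begin

text \<open>
  The subtracted constant is the same average for the Gaussian limit, see \<open>limit_measure_cos\<close>
  below.
\<close>

definition cosine_error :: "real \<Rightarrow> nat \<Rightarrow> real ^ 'd \<Rightarrow> 'a \<Rightarrow> real" where
  "cosine_error \<theta> m \<xi> \<omega> = label_mean m (\<lambda>j. cos (\<xi> \<bullet> Z (real m) j \<omega> + \<theta>))
     - exp (- (norm \<xi>)\<^sup>2 / (4 * (b + \<gamma>))) * cos \<theta>"

lemma cosine_error_measurable: "cosine_error \<theta> m \<xi> \<in> borel_measurable M"
  unfolding cosine_error_def[abs_def]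
  by (intro borel_measurable_diff borel_measurable_label_mean borel_measurable_const
      measurable_compose[OF _ borel_measurable_cos] borel_measurable_add borel_measurable_inner position_measurable)

lemma barycentre_second_moment:
  assumes b: "b > 0"
  obtains K \<rho> where "K \<ge> 0" "0 < \<rho>" "\<rho> < 1"
    "\<And>m \<xi>. second_moment_le (barycentre m \<xi>) (K * (norm \<xi>)\<^sup>2 * \<rho> ^ m)"
proof (rule contraction_recursion_second_moment[where E = barycentre and c = b and H = 1 and ?K0.0 = 0 and
      S = "\<lambda>m \<xi> \<omega>. barycentre (Suc m) \<xi> \<omega> - exp (- b) * barycentre m \<xi> \<omega>"])
  show "barycentre m \<xi> \<in> borel_measurable M" for m \<xi> by (rule barycentre_measurable)
  show "(\<lambda>\<omega>. barycentre (Suc m) \<xi> \<omega> - exp (- b) * barycentre m \<xi> \<omega>) \<in> borel_measurable M" for m \<xi>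
    by (intro borel_measurable_diff borel_measurable_times borel_measurable_const barycentre_measurable)
  show "second_moment_le (barycentre 0 \<xi>) (0 * (norm \<xi>)\<^sup>2)" for \<xi>
  proof -
    have "(\<integral>\<^sup>+\<omega>. ennreal ((barycentre 0 \<xi> \<omega>)\<^sup>2) \<partial>M) = (\<integral>\<^sup>+\<omega>. 0 \<partial>M)"
      by (rule nn_integral_cong_AE) (use Z_start in eventually_elim, simp add: barycentre_def label_mean_0)
    then show ?thesis by (simp add: second_moment_le_def)
  qed
  show "second_moment_le (\<lambda>\<omega>. barycentre (Suc m) \<xi> \<omega> - exp (- b) * barycentre m \<xi> \<omega>) (1 * (norm \<xi>)\<^sup>2 / 2 ^ m)" for m \<xi>
    using barycentre_step[OF b] by simp
  show "AE \<omega> in M. \<bar>barycentre (Suc m) \<xi> \<omega>\<bar> \<le> \<bar>barycentre m (exp (- b) *\<^sub>R \<xi>) \<omega>\<bar>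
      + \<bar>barycentre (Suc m) \<xi> \<omega> - exp (- b) * barycentre m \<xi> \<omega>\<bar>" for m \<xi>
    unfolding barycentre_scale by (intro AE_I2) linarith
qed (use b in auto)

text \<open>
  The Gaussian characteristic function \<open>g\<close> is a fixed point of the action of one generation,
  \<open>g \<xi> = q \<xi> * g (exp (- c) *\<^sub>R \<xi>)\<close>.  Hence the difference from it obeys the contracting
  recursion, which starts from the bound \<open>1 - g \<xi> \<le> (norm \<xi>)\<^sup>2 / (4 * c)\<close> for a single
  particle at its own barycentre.
\<close>

lemma centred_cosine_second_moment:
  assumes c: "b + \<gamma> > 0"
  obtains K \<rho> where "K \<ge> 0" "0 < \<rho>" "\<rho> < 1"
    "\<And>m \<xi>. second_moment_le (\<lambda>\<omega>. centred_cosine \<theta> m \<xi> \<omega> - exp (- (norm \<xi>)\<^sup>2 / (4 * (b + \<gamma>))) * cos \<theta>)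
       (K * (norm \<xi>)\<^sup>2 * \<rho> ^ m)"
proof -
  define c where "c = b + \<gamma>"
  have c0: "c > 0" using assms by (simp add: c_def)
  define g where "g \<xi> = exp (- (norm \<xi>)\<^sup>2 / (4 * c))" for \<xi> :: "real ^ 'd"
  define q where "q \<xi> = exp (- ((norm \<xi>)\<^sup>2 * ((1 - exp (- 2 * c)) / (2 * c))) / 2)" for \<xi> :: "real ^ 'd"
  have q01: "0 \<le> q \<xi>" "q \<xi> \<le> 1" for \<xi> using c0 by (auto simp: q_def)
  have qg: "q \<xi> * g (exp (- c) *\<^sub>R \<xi>) = g \<xi>" for \<xi>
  proof -
    have "exp (- c) * exp (- c) = exp (- 2 * c)" by (simp add: exp_add[symmetric])
    then have e: "(norm (exp (- c) *\<^sub>R \<xi>))\<^sup>2 = exp (- 2 * c) * (norm \<xi>)\<^sup>2"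
      by (simp add: power_mult_distrib power2_eq_square)
    have "- ((norm \<xi>)\<^sup>2 * ((1 - x) / (2 * c))) / 2 + - (x * (norm \<xi>)\<^sup>2) / (4 * c) = - (norm \<xi>)\<^sup>2 / (4 * c)" for x
      using c0 by (simp add: field_simps)
    then show ?thesis unfolding q_def g_def e exp_add[symmetric] by simp
  qed
  obtain K \<rho> where "K \<ge> 0" "0 < \<rho>" "\<rho> < 1"
    "\<And>m \<xi>. second_moment_le (\<lambda>\<omega>. centred_cosine \<theta> m \<xi> \<omega> - g \<xi> * cos \<theta>) (K * (norm \<xi>)\<^sup>2 * \<rho> ^ m)"
  proof (rule contraction_recursion_second_moment[where c = c and H = 8 and ?K0.0 = "1 / (4 * c)" and
      E = "\<lambda>m \<xi> \<omega>. centred_cosine \<theta> m \<xi> \<omega> - g \<xi> * cos \<theta>" and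
      S = "\<lambda>m \<xi> \<omega>. centred_cosine \<theta> (Suc m) \<xi> \<omega> - q \<xi> * centred_cosine \<theta> m (exp (- c) *\<^sub>R \<xi>) \<omega>"])
    show "(\<lambda>\<omega>. centred_cosine \<theta> m \<xi> \<omega> - g \<xi> * cos \<theta>) \<in> borel_measurable M" for m \<xi>
      by (intro borel_measurable_diff borel_measurable_const centred_cosine_measurable)
    show "(\<lambda>\<omega>. centred_cosine \<theta> (Suc m) \<xi> \<omega> - q \<xi> * centred_cosine \<theta> m (exp (- c) *\<^sub>R \<xi>) \<omega>) \<in> borel_measurable M" for m \<xi>
      by (intro borel_measurable_diff borel_measurable_times borel_measurable_const centred_cosine_measurable)
    show "second_moment_le (\<lambda>\<omega>. centred_cosine \<theta> 0 \<xi> \<omega> - g \<xi> * cos \<theta>) (1 / (4 * c) * (norm \<xi>)\<^sup>2)" for \<xi>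
    proof (rule second_moment_le_const)
      fix \<omega>
      have g: "0 \<le> g \<xi>" "g \<xi> \<le> 1" "1 - g \<xi> \<le> (norm \<xi>)\<^sup>2 / (4 * c)"
        using exp_ge_add_one_self[of "- (norm \<xi>)\<^sup>2 / (4 * c)"] c0 by (auto simp: g_def)
      have "centred_cosine \<theta> 0 \<xi> \<omega> - g \<xi> * cos \<theta> = (1 - g \<xi>) * cos \<theta>"
        by (simp add: centred_cosine_def barycentre_def label_mean_0 algebra_simps)
      then have "(centred_cosine \<theta> 0 \<xi> \<omega> - g \<xi> * cos \<theta>)\<^sup>2 = (1 - g \<xi>) * ((1 - g \<xi>) * (cos \<theta>)\<^sup>2)"
        by (simp add: power2_eq_square)
      also have "\<dots> \<le> (1 - g \<xi>) * (1 * 1)"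
        using g by (intro mult_left_mono mult_mono) (auto simp: abs_square_le_1)
      finally show "(centred_cosine \<theta> 0 \<xi> \<omega> - g \<xi> * cos \<theta>)\<^sup>2 \<le> 1 / (4 * c) * (norm \<xi>)\<^sup>2"
        using g by simp
    qed
    show "second_moment_le (\<lambda>\<omega>. centred_cosine \<theta> (Suc m) \<xi> \<omega> - q \<xi> * centred_cosine \<theta> m (exp (- c) *\<^sub>R \<xi>) \<omega>)
        (8 * (norm \<xi>)\<^sup>2 / 2 ^ m)" for m \<xi>
      unfolding q_def c_def by (rule centred_cosine_step[OF assms])
    show "AE \<omega> in M. \<bar>centred_cosine \<theta> (Suc m) \<xi> \<omega> - g \<xi> * cos \<theta>\<bar>
        \<le> \<bar>centred_cosine \<theta> m (exp (- c) *\<^sub>R \<xi>) \<omega> - g (exp (- c) *\<^sub>R \<xi>) * cos \<theta>\<bar>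
          + \<bar>centred_cosine \<theta> (Suc m) \<xi> \<omega> - q \<xi> * centred_cosine \<theta> m (exp (- c) *\<^sub>R \<xi>) \<omega>\<bar>" for m \<xi>
    proof (rule AE_I2)
      fix \<omega>
      have tri: "\<bar>x\<bar> \<le> \<bar>z\<bar> + \<bar>s\<bar>" if "x = y + s" "\<bar>y\<bar> \<le> 1 * \<bar>z\<bar>" for x y z s :: real
        using that by linarith
      let ?e = "centred_cosine \<theta> m (exp (- c) *\<^sub>R \<xi>) \<omega> - g (exp (- c) *\<^sub>R \<xi>) * cos \<theta>"
      have "centred_cosine \<theta> (Suc m) \<xi> \<omega> - g \<xi> * cos \<theta>
         = q \<xi> * ?e + (centred_cosine \<theta> (Suc m) \<xi> \<omega> - q \<xi> * centred_cosine \<theta> m (exp (- c) *\<^sub>R \<xi>) \<omega>)"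
        unfolding qg[of \<xi>, symmetric] by (simp add: algebra_simps)
      moreover have "\<bar>q \<xi> * ?e\<bar> \<le> 1 * \<bar>?e\<bar>"
        unfolding abs_mult using q01 by (intro mult_right_mono) auto
      ultimately show "\<bar>centred_cosine \<theta> (Suc m) \<xi> \<omega> - g \<xi> * cos \<theta>\<bar>
        \<le> \<bar>?e\<bar> + \<bar>centred_cosine \<theta> (Suc m) \<xi> \<omega> - q \<xi> * centred_cosine \<theta> m (exp (- c) *\<^sub>R \<xi>) \<omega>\<bar>"
        by (rule tri)
    qed
  qed (use c0 in auto)
  then show ?thesis using that unfolding g_def c_def by blast
qed

text \<open>
  Since the cosine is Lipschitz, returning from deviations to positions costs at most the modulus
  of the barycentre.
\<close>

lemma cosine_error_second_moment:
  assumes b: "b > 0" and c: "b + \<gamma> > 0"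
  obtains K \<rho> where "K \<ge> 0" "0 < \<rho>" "\<rho> < 1"
    "\<And>m \<xi>. second_moment_le (cosine_error \<theta> m \<xi>) (K * (norm \<xi>)\<^sup>2 * \<rho> ^ m)"
proof -
  define e where "e m \<xi> \<omega> = centred_cosine \<theta> m \<xi> \<omega> - exp (- (norm \<xi>)\<^sup>2 / (4 * (b + \<gamma>))) * cos \<theta>" for m \<xi> \<omega>
  obtain K \<rho> where K: "K \<ge> 0" "0 < \<rho>" "\<rho> < 1"
    "\<And>m \<xi>. second_moment_le (barycentre m \<xi>) (K * (norm \<xi>)\<^sup>2 * \<rho> ^ m)"
    using barycentre_second_moment[OF b] by blast
  obtain K' \<rho>' where K': "K' \<ge> 0" "0 < \<rho>'" "\<rho>' < 1"
    "\<And>m \<xi>. second_moment_le (e m \<xi>) (K' * (norm \<xi>)\<^sup>2 * \<rho>' ^ m)"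
    using centred_cosine_second_moment[OF c, of \<theta>] unfolding e_def by blast
  have em: "e m \<xi> \<in> borel_measurable M" for m \<xi>
    unfolding e_def[abs_def] by (intro borel_measurable_diff borel_measurable_const centred_cosine_measurable)
  have "second_moment_le (cosine_error \<theta> m \<xi>) (2 * (K + K') * (norm \<xi>)\<^sup>2 * max \<rho> \<rho>' ^ m)" for m \<xi>
  proof (rule second_moment_le_mono)
    have "\<bar>cosine_error \<theta> m \<xi> \<omega>\<bar> \<le> \<bar>e m \<xi> \<omega>\<bar> + \<bar>barycentre m \<xi> \<omega>\<bar>" for \<omega>
    proof -
      have "cosine_error \<theta> m \<xi> \<omega> - e m \<xi> \<omega> = label_mean m (\<lambda>j. cos (\<xi> \<bullet> Z (real m) j \<omega> + \<theta>)
          - cos (\<xi> \<bullet> Z (real m) j \<omega> - barycentre m \<xi> \<omega> + \<theta>))"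
        unfolding label_mean_diff[symmetric] by (simp add: cosine_error_def e_def centred_cosine_def)
      also have "\<bar>\<dots>\<bar> \<le> \<bar>barycentre m \<xi> \<omega>\<bar>"
        by (rule abs_label_mean_le, rule order_trans[OF abs_cos_diff_le]) simp
      finally show ?thesis by linarith
    qed
    then show "second_moment_le (cosine_error \<theta> m \<xi>) ((1 + 1) * (K' * (norm \<xi>)\<^sup>2 * \<rho>' ^ m) + (1 + 1 / 1) * (K * (norm \<xi>)\<^sup>2 * \<rho> ^ m))"
      by (intro second_moment_le_triangle[OF em barycentre_measurable K'(4) K(4)] AE_I2) (use K K' in auto)
    have "K' * (norm \<xi>)\<^sup>2 * \<rho>' ^ m \<le> K' * (norm \<xi>)\<^sup>2 * max \<rho> \<rho>' ^ m"
      using K K' by (intro mult_left_mono power_mono) auto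
    moreover have "K * (norm \<xi>)\<^sup>2 * \<rho> ^ m \<le> K * (norm \<xi>)\<^sup>2 * max \<rho> \<rho>' ^ m"
      using K K' by (intro mult_left_mono power_mono) auto
    ultimately show "(1 + 1) * (K' * (norm \<xi>)\<^sup>2 * \<rho>' ^ m) + (1 + 1 / 1) * (K * (norm \<xi>)\<^sup>2 * \<rho> ^ m)
        \<le> 2 * (K + K') * (norm \<xi>)\<^sup>2 * max \<rho> \<rho>' ^ m"
      by (simp add: algebra_simps)
  qed
  then show ?thesis using that[of "2 * (K + K')" "max \<rho> \<rho>'"] K(1-3) K'(1-3) by (simp add: less_max_iff_disj)
qed

lemma cosine_error_tendsto_zero:
  assumes "b > 0" "b + \<gamma> > 0"
  shows "AE \<omega> in M. (\<lambda>m. cosine_error \<theta> m \<xi> \<omega>) \<longlonglongrightarrow> 0"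
proof -
  obtain K \<rho> where K: "K \<ge> 0" "0 < \<rho>" "\<rho> < 1"
    "\<And>m \<xi>. second_moment_le (cosine_error \<theta> m \<xi>) (K * (norm \<xi>)\<^sup>2 * \<rho> ^ m)"
    using cosine_error_second_moment[OF assms] by blast
  show ?thesis
    by (rule AE_tendsto_zero_of_second_moments[OF cosine_error_measurable _ _ _ K(4)]) (use K in auto)
qed

text \<open>
  At the frequency \<open>2 ^ (- i)\<close> the second moment carries a factor \<open>4 ^ (- i)\<close>.  The weight
  \<open>(16 / 9) ^ i\<close> is still summable against it, and forces the errors to decay like \<open>(3 / 4) ^ i\<close>,
  uniformly in the generation.  This is the source of tightness.
\<close>

lemma dyadic_cosine_error_bounded:
  assumes "b > 0" "b + \<gamma> > 0"
  shows "AE \<omega> in M. \<exists>B. \<forall>m i. (cosine_error 0 m (axis k (1 / 2 ^ i)) \<omega>)\<^sup>2 * (16 / 9) ^ i \<le> B"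
proof -
  obtain K \<rho> where K: "K \<ge> 0" "0 < \<rho>" "\<rho> < 1"
    "\<And>m \<xi>. second_moment_le (cosine_error 0 m \<xi>) (K * (norm \<xi>)\<^sup>2 * \<rho> ^ m)"
    using cosine_error_second_moment[OF assms] by blast
  show ?thesis
  proof (rule AE_bounded_double_series[where K = K and r = \<rho> and a = "4 / 9"])
    note [measurable] = cosine_error_measurable
    show "(\<lambda>\<omega>. (cosine_error 0 m (axis k (1 / 2 ^ i)) \<omega>)\<^sup>2 * (16 / 9) ^ i) \<in> borel_measurable M" for m i
      by measurable
    fix m i
    have "(\<integral>\<^sup>+\<omega>. ennreal ((cosine_error 0 m (axis k (1 / 2 ^ i)) \<omega>)\<^sup>2 * (16 / 9) ^ i) \<partial>M)
        = (\<integral>\<^sup>+\<omega>. ennreal ((cosine_error 0 m (axis k (1 / 2 ^ i)) \<omega>)\<^sup>2) \<partial>M) * ennreal ((16 / 9) ^ i)"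
      by (simp add: ennreal_mult nn_integral_multc)
    also have "\<dots> \<le> ennreal (K * (norm (axis k (1 / 2 ^ i :: real) :: real ^ 'd))\<^sup>2 * \<rho> ^ m) * ennreal ((16 / 9) ^ i)"
      using K(4)[of m "axis k (1 / 2 ^ i)"] unfolding second_moment_le_def by (intro mult_right_mono) auto
    also have "\<dots> = ennreal (K * \<rho> ^ m * (4 / 9) ^ i)"
    proof -
      have "((1 / 2 ^ i)\<^sup>2 :: real) = (1 / 4) ^ i"
        by (simp only: power_one_over[symmetric] square_of_power) (simp add: power2_eq_square)
      then have "((1 / 2 ^ i)\<^sup>2 :: real) * (16 / 9) ^ i = (1 / 4 * (16 / 9)) ^ i"
        by (simp only: power_mult_distrib)
      then have "K * (norm (axis k (1 / 2 ^ i :: real) :: real ^ 'd))\<^sup>2 * \<rho> ^ m * (16 / 9) ^ i = K * \<rho> ^ m * (4 / 9) ^ i"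
        by (simp add: norm_axis)
      then show ?thesis using K by (simp add: ennreal_mult[symmetric])
    qed
    finally show "(\<integral>\<^sup>+\<omega>. ennreal ((cosine_error 0 m (axis k (1 / 2 ^ i)) \<omega>)\<^sup>2 * (16 / 9) ^ i) \<partial>M)
        \<le> ennreal (K * \<rho> ^ m * (4 / 9) ^ i)" .
  qed (use K in auto)
qed

end

section \<open>Convergence to the Gaussian measure\<close>

lemma limit_measure_eq_product:
  assumes c: "b + \<gamma> > 0"
  shows "(limit_measure b \<gamma> :: (real ^ 'd) measure)
    = density lborel (\<lambda>x. ennreal (\<Prod>k\<in>UNIV. normal_density 0 (1 / sqrt (2 * (b + \<gamma>))) (x $ k)))"
proof -
  define c where "c = b + \<gamma>"
  have c0: "c > 0" using assms by (simp add: c_def)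
  have nd: "normal_density 0 (1 / sqrt (2 * c)) t = sqrt (c / pi) * exp (- c * t\<^sup>2)" for t
    using c0 by (simp add: normal_density_def power_divide real_sqrt_divide)
  have "(c / pi) powr (real CARD('d) / 2) = ((c / pi) powr (1 / 2)) powr real CARD('d)"
    by (simp add: powr_powr)
  also have "\<dots> = sqrt (c / pi) ^ CARD('d)"
    using c0 by (simp add: powr_half_sqrt powr_realpow)
  finally have "(c / pi) powr (real CARD('d) / 2) * exp (- c * (norm x)\<^sup>2)
     = (\<Prod>k\<in>UNIV. normal_density 0 (1 / sqrt (2 * c)) (x $ k))" for x :: "real ^ 'd"
    unfolding nd prod.distrib
    by (simp add: exp_sum[symmetric] norm_vec_def L2_set_def sum_nonneg sum_distrib_left sum_negf)
  then show ?thesis unfolding limit_measure_def c_def by (simp add: add.commute)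
qed

lemma prob_space_limit_measure:
  assumes c: "b + \<gamma> > 0"
  shows "prob_space (limit_measure b \<gamma> :: (real ^ 'd) measure)"
proof
  have s: "1 / sqrt (2 * (b + \<gamma>)) > 0" using c by simp
  have "emeasure (limit_measure b \<gamma>) (space (limit_measure b \<gamma> :: (real ^ 'd) measure))
     = (\<integral>\<^sup>+x. (\<Prod>k\<in>UNIV. ennreal (normal_density 0 (1 / sqrt (2 * (b + \<gamma>))) (x $ k))) \<partial>(lborel :: (real ^ 'd) measure))"
    unfolding limit_measure_eq_product[OF c]
    by (subst emeasure_density) (auto simp: prod_ennreal intro!: borel_measurable_continuous_onI continuous_intros)
  also have "\<dots> = 1"
    by (subst nn_integral_lborel_vec_prod) (use nn_integral_normal_density[OF s] in auto)
  finally show "emeasure (limit_measure b \<gamma>) (space (limit_measure b \<gamma> :: (real ^ 'd) measure)) = 1" .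
qed

lemma sets_limit_measure: "sets (limit_measure b \<gamma> :: (real ^ 'd) measure) = sets borel"
  by (simp add: limit_measure_def)

lemma limit_measure_cos:
  fixes \<xi> :: "real ^ 'd"
  assumes c: "b + \<gamma> > 0"
  shows "(\<integral>x. cos (\<xi> \<bullet> x + \<theta>) \<partial>limit_measure b \<gamma>) = exp (- (norm \<xi>)\<^sup>2 / (4 * (b + \<gamma>))) * cos \<theta>"
proof -
  interpret L: prob_space "limit_measure b \<gamma> :: (real ^ 'd) measure" by (rule prob_space_limit_measure[OF c])
  show ?thesis
  proof (cases "\<xi> = 0")
    case True then show ?thesis by (simp add: L.prob_space)
  next
    case False
    let ?s = "1 / sqrt (2 * (b + \<gamma>))"
    have s: "?s > 0" using c by simp
    have "distributed (limit_measure b \<gamma>) lborel (\<lambda>x. x) (\<lambda>x :: real ^ 'd. ennreal (\<Prod>k\<in>UNIV. normal_density 0 ?s (x $ k)))"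
      unfolding distributed_def
      by (auto simp: limit_measure_eq_product[OF c] distr_id2 intro!: borel_measurable_continuous_onI continuous_intros)
    from L.isotropic_normal_projection[OF this s False]
    have P: "distributed (limit_measure b \<gamma>) lborel (\<lambda>x. \<xi> \<bullet> x) (normal_density 0 (?s * norm \<xi>))" .
    have sn: "?s * norm \<xi> > 0" using s False by simp
    note mom = L.normal_trig_moments[OF P sn]
    have int: "integrable (limit_measure b \<gamma>) (\<lambda>x. cos (\<xi> \<bullet> x))" "integrable (limit_measure b \<gamma>) (\<lambda>x. sin (\<xi> \<bullet> x))"
      by (rule integrable_bounded_continuous[OF L.prob_space_axioms sets_limit_measure, where C = 1]; auto intro!: continuous_intros)+
    have "(\<integral>x. cos (\<xi> \<bullet> x + \<theta>) \<partial>limit_measure b \<gamma>)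
        = (\<integral>x. cos (\<xi> \<bullet> x) \<partial>limit_measure b \<gamma>) * cos \<theta> - (\<integral>x. sin (\<xi> \<bullet> x) \<partial>limit_measure b \<gamma>) * sin \<theta>"
      unfolding cos_add using int by simp
    also have "\<dots> = exp (- (?s * norm \<xi>)\<^sup>2 / 2) * cos \<theta>"
      using mom(1,2) by simp
    also have "- (?s * norm \<xi>)\<^sup>2 / 2 = - (norm \<xi>)\<^sup>2 / (4 * (b + \<gamma>))"
      using c by (simp add: power_mult_distrib power_divide)
    finally show ?thesis .
  qed
qed

text \<open>
  The law of the position of a uniformly chosen particle.
\<close>

lemma scaled_particle_measure_eq:
  "scale_measure (1 / 2 ^ n) (particle_measure Z (real n) \<omega>)
     = distr (measure_pmf (pmf_of_set {..<2 ^ n})) borel (\<lambda>i. Z (real n) i \<omega>)"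
proof (rule measure_eqI)
  fix A assume "A \<in> sets (scale_measure (1 / 2 ^ n) (particle_measure Z (real n) \<omega>))"
  then have A: "A \<in> sets borel" by (simp add: particle_measure_def)
  let ?I = "{..<2 ^ n} :: nat set"
  let ?P = "(\<lambda>i. Z (real n) i \<omega>) -` A"
  have I: "?I \<noteq> {}" "finite ?I" by (auto simp: lessThan_empty_iff)
  have "emeasure (particle_measure Z (real n) \<omega>) A = emeasure (count_space ?I) (?P \<inter> ?I)"
    unfolding particle_measure_def using A by (subst emeasure_distr) auto
  also have "\<dots> = of_nat (card (?I \<inter> ?P))"
    by (subst emeasure_count_space_finite) (auto simp: Int_commute)
  finally have 1: "emeasure (scale_measure (1 / 2 ^ n) (particle_measure Z (real n) \<omega>)) A
      = 1 / 2 ^ n * of_nat (card (?I \<inter> ?P))" by simp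
  have "emeasure (distr (measure_pmf (pmf_of_set ?I)) borel (\<lambda>i. Z (real n) i \<omega>)) A
      = emeasure (measure_pmf (pmf_of_set ?I)) ?P"
    using A by (subst emeasure_distr) auto
  also have "\<dots> = ennreal (real (card (?I \<inter> ?P)) / real (2 ^ n))"
    by (subst emeasure_pmf_of_set[OF I]) simp
  also have "\<dots> = 1 / 2 ^ n * of_nat (card (?I \<inter> ?P))"
    by (simp add: divide_ennreal[symmetric] ennreal_of_nat_eq_real_of_nat[symmetric] ennreal_power[symmetric]
        divide_ennreal_def mult.commute)
  finally show "emeasure (scale_measure (1 / 2 ^ n) (particle_measure Z (real n) \<omega>)) A
     = emeasure (distr (measure_pmf (pmf_of_set ?I)) borel (\<lambda>i. Z (real n) i \<omega>)) A"
    using 1 by simp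
qed (simp add: particle_measure_def)

lemma integral_scaled_particle_measure:
  assumes "f \<in> borel_measurable borel"
  shows "(\<integral>x. f x \<partial>scale_measure (1 / 2 ^ n) (particle_measure Z (real n) \<omega>)) = label_mean n (\<lambda>i. f (Z (real n) i \<omega>))"
proof -
  have "({..<2 ^ n} :: nat set) \<noteq> {}" by (auto simp: lessThan_empty_iff)
  then show ?thesis
    unfolding scaled_particle_measure_eq using assms
    by (subst integral_distr) (auto simp: integral_pmf_of_set label_mean_def)
qed

lemma countable_rational_vectors: "countable {\<xi> :: real ^ 'd. \<forall>k. \<xi> $ k \<in> \<rat>}"
proof -
  have "countable (vec_lambda ` (PiE UNIV (\<lambda>_ :: 'd. \<rat> :: real set)))"
    by (intro countable_image countable_PiE countable_rat) auto
  moreover have "{\<xi> :: real ^ 'd. \<forall>k. \<xi> $ k \<in> \<rat>} \<subseteq> vec_lambda ` (PiE UNIV (\<lambda>_ :: 'd. \<rat>))"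
  proof
    fix \<xi> :: "real ^ 'd" assume "\<xi> \<in> {\<xi>. \<forall>k. \<xi> $ k \<in> \<rat>}"
    then have "vec_nth \<xi> \<in> PiE UNIV (\<lambda>_. \<rat>)" by auto
    then show "\<xi> \<in> vec_lambda ` (PiE UNIV (\<lambda>_. \<rat>))" by (metis image_eqI vec_nth_inverse)
  qed
  ultimately show ?thesis by (rule countable_subset[rotated])
qed

text \<open>
  Almost surely, the errors vanish at all rational frequencies for the phases \<open>0\<close> and \<open>pi / 2\<close>,
  which determine the other phases by the addition formula, and the dyadic bounds give tightness.
\<close>

lemma (in interacting_branching_diffusion) empirical_measures_converge:
  assumes b: "b > 0" and c: "b + \<gamma> > 0"
  shows "AE \<omega> in M. weakly_converges
       (\<lambda>n. scale_measure (1 / 2 ^ n) (particle_measure Z (real n) \<omega>)) (limit_measure b \<gamma>)"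
proof -
  have "AE \<omega> in M. \<forall>\<xi>\<in>{\<xi>. \<forall>k. \<xi> $ k \<in> \<rat>}. (\<lambda>m. cosine_error 0 m \<xi> \<omega>) \<longlonglongrightarrow> 0 \<and> (\<lambda>m. cosine_error (pi / 2) m \<xi> \<omega>) \<longlonglongrightarrow> 0"
    by (rule AE_ball_countable'[OF _ countable_rational_vectors])
       (intro AE_conjI cosine_error_tendsto_zero[OF b c])
  moreover have "AE \<omega> in M. \<forall>k\<in>UNIV. \<exists>B. \<forall>m i. (cosine_error 0 m (axis k (1 / 2 ^ i)) \<omega>)\<^sup>2 * (16 / 9) ^ i \<le> B"
    by (rule AE_ball_countable'[OF dyadic_cosine_error_bounded[OF b c]]) (simp add: countable_finite)
  ultimately show ?thesis
  proof eventually_elim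
    case (elim \<omega>)
    define \<mu> where "\<mu> n = scale_measure (1 / 2 ^ n) (particle_measure Z (real n) \<omega>)" for n
    define g where "g \<xi> = exp (- (norm \<xi>)\<^sup>2 / (4 * (b + \<gamma>)))" for \<xi> :: "real ^ 'd"
    have p\<mu>: "prob_space (\<mu> n)" for n
      unfolding \<mu>_def scaled_particle_measure_eq by (rule measure_pmf.prob_space_distr) simp
    have s\<mu>: "sets (\<mu> n) = sets borel" for n by (simp add: \<mu>_def particle_measure_def)
    have int\<mu>: "(\<integral>x. cos (\<xi> \<bullet> x + \<theta>) \<partial>\<mu> n) = label_mean n (\<lambda>i. cos (\<xi> \<bullet> Z (real n) i \<omega> + \<theta>))" for \<xi> \<theta> n
      unfolding \<mu>_def by (rule integral_scaled_particle_measure) measurable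
    have err: "(\<integral>x. cos (\<xi> \<bullet> x + \<theta>) \<partial>\<mu> n) = g \<xi> * cos \<theta> + cosine_error \<theta> n \<xi> \<omega>" for \<xi> \<theta> n
      unfolding int\<mu> cosine_error_def g_def by simp
    have "weakly_converges \<mu> (limit_measure b \<gamma>)"
    proof (rule weakly_converges_of_trig_averages[OF p\<mu> s\<mu> prob_space_limit_measure[OF c] sets_limit_measure])
      fix \<xi> :: "real ^ 'd" and \<theta> assume "\<And>k. \<xi> $ k \<in> \<rat>"
      then have "(\<lambda>m. cosine_error 0 m \<xi> \<omega>) \<longlonglongrightarrow> 0" "(\<lambda>m. cosine_error (pi / 2) m \<xi> \<omega>) \<longlonglongrightarrow> 0"
        using elim(1) by auto
      then have "(\<lambda>n. cos \<theta> * (g \<xi> * cos 0 + cosine_error 0 n \<xi> \<omega>) + sin \<theta> * (g \<xi> * cos (pi / 2) + cosine_error (pi / 2) n \<xi> \<omega>))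
          \<longlonglongrightarrow> cos \<theta> * (g \<xi> * cos 0 + 0) + sin \<theta> * (g \<xi> * cos (pi / 2) + 0)"
        by (intro tendsto_intros)
      moreover have "(\<integral>x. cos (\<xi> \<bullet> x + \<theta>) \<partial>\<mu> n)
          = cos \<theta> * (g \<xi> * cos 0 + cosine_error 0 n \<xi> \<omega>) + sin \<theta> * (g \<xi> * cos (pi / 2) + cosine_error (pi / 2) n \<xi> \<omega>)" for n
        unfolding err[symmetric] int\<mu> label_mean_mult label_mean_add
        by (rule label_mean_cong) (simp add: cos_add)
      ultimately show "(\<lambda>n. \<integral>x. cos (\<xi> \<bullet> x + \<theta>) \<partial>\<mu> n) \<longlonglongrightarrow> (\<integral>x. cos (\<xi> \<bullet> x + \<theta>) \<partial>limit_measure b \<gamma>)"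
        unfolding limit_measure_cos[OF c] g_def by (simp add: mult.commute)
    next
      fix e :: real assume e: "e > 0"
      have "\<exists>B. \<forall>n J. measure (\<mu> n) {x. 2 ^ J \<le> \<bar>x $ k\<bar>} \<le> B * (3 / 4) ^ J" for k
      proof -
        obtain B0 where B0: "\<And>m i. (cosine_error 0 m (axis k (1 / 2 ^ i)) \<omega>)\<^sup>2 * (16 / 9) ^ i \<le> B0"
          using elim(2) by blast
        have B00: "B0 \<ge> 0" using B0[of 0 0] by (auto intro: order_trans[rotated])
        \<comment> \<open>The empirical average differs from 1 by its error and by the defect \<open>1 - g\<close> of the limit.\<close>
        define B where "B = sqrt B0 + 1 / (4 * (b + \<gamma>))"
        have B: "B \<ge> 0" using B00 c by (simp add: B_def)
        have small: "1 - (\<integral>x. cos (x $ k / 2 ^ i) \<partial>\<mu> n) \<le> B * (3 / 4) ^ i" for i n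
        proof -
          let ?\<xi> = "axis k (1 / 2 ^ i) :: real ^ 'd"
          have "?\<xi> \<bullet> x + 0 = x $ k / 2 ^ i" for x :: "real ^ 'd"
            by (simp add: inner_axis' )
          then have "(\<integral>x. cos (x $ k / 2 ^ i) \<partial>\<mu> n) = g ?\<xi> * cos 0 + cosine_error 0 n ?\<xi> \<omega>"
            using err[of n ?\<xi> 0] by simp
          moreover have "\<bar>cosine_error 0 n ?\<xi> \<omega>\<bar> \<le> sqrt B0 * (3 / 4) ^ i"
          proof -
            have "(cosine_error 0 n ?\<xi> \<omega> * (4 / 3) ^ i)\<^sup>2 \<le> B0"
              using B0[of n i] unfolding power_mult_distrib square_of_power[of "4 / 3" i]
              by (simp add: power2_eq_square)
            then have "\<bar>cosine_error 0 n ?\<xi> \<omega> * (4 / 3) ^ i\<bar> \<le> sqrt B0" using real_sqrt_le_mono by fastforce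
            then have "\<bar>cosine_error 0 n ?\<xi> \<omega>\<bar> * (4 / 3) ^ i * (3 / 4) ^ i \<le> sqrt B0 * (3 / 4) ^ i"
              by (intro mult_right_mono) (auto simp: abs_mult)
            then show ?thesis by (simp add: mult.assoc power_mult_distrib[symmetric])
          qed
          moreover have "1 - g ?\<xi> \<le> 1 / (4 * (b + \<gamma>)) * (3 / 4) ^ i"
          proof -
            have "1 - g ?\<xi> \<le> (norm ?\<xi>)\<^sup>2 / (4 * (b + \<gamma>))"
              using exp_ge_add_one_self[of "- (norm ?\<xi>)\<^sup>2 / (4 * (b + \<gamma>))"] by (simp add: g_def)
            also have "norm ?\<xi> = (1 / 2) ^ i" by (simp add: norm_axis power_one_over)
            also have "((1 / 2) ^ i)\<^sup>2 = (1 / 4 :: real) ^ i"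
              unfolding square_of_power by (simp add: power2_eq_square)
            also have "(1 / 4 :: real) ^ i \<le> (3 / 4) ^ i" by (intro power_mono) auto
            finally show ?thesis using c by (simp add: divide_right_mono)
          qed
          ultimately show ?thesis unfolding B_def distrib_right by simp
        qed
        have "measure (\<mu> n) {x. 2 ^ J \<le> \<bar>x $ k\<bar>} \<le> B * (3 / 4) ^ J / ((1 - cos 1) * (1 - 3 / 4))" for n J
          by (rule dyadic_tail_bound[OF p\<mu> s\<mu> B _ _ small]) auto
        then show ?thesis by (intro exI[of _ "B / ((1 - cos 1) * (1 - 3 / 4))"]) (simp add: mult_ac)
      qed
      then obtain B where B: "\<And>k n J. measure (\<mu> n) {x. 2 ^ J \<le> \<bar>x $ k\<bar>} \<le> B k * (3 / 4) ^ J" by metis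
      have "(\<lambda>J. \<Sum>k\<in>UNIV. B k * (3 / 4) ^ J) \<longlonglongrightarrow> (\<Sum>k\<in>(UNIV :: 'd set). B k * 0)"
        by (intro tendsto_intros LIMSEQ_power_zero) auto
      then have "eventually (\<lambda>J. (\<Sum>k\<in>UNIV. B k * (3 / 4) ^ J) < e) sequentially"
        using e by (intro order_tendstoD(2)[of _ 0]) auto
      then obtain J where J: "(\<Sum>k\<in>UNIV. B k * (3 / 4) ^ J) < e"
        using eventually_happens'[OF sequentially_bot] by blast
      have "measure (\<mu> n) {x. \<exists>k. 2 ^ J \<le> \<bar>x $ k\<bar>} \<le> e" for n
      proof -
        interpret P: prob_space "\<mu> n" by (rule p\<mu>)
        have ev: "{x :: real ^ 'd. 2 ^ J \<le> \<bar>x $ k\<bar>} \<in> sets (\<mu> n)" for k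
          unfolding s\<mu> by measurable
        have "{x :: real ^ 'd. \<exists>k. 2 ^ J \<le> \<bar>x $ k\<bar>} = (\<Union>k\<in>UNIV. {x. 2 ^ J \<le> \<bar>x $ k\<bar>})" by auto
        also have "measure (\<mu> n) \<dots> \<le> (\<Sum>k\<in>UNIV. measure (\<mu> n) {x. 2 ^ J \<le> \<bar>x $ k\<bar>})"
          by (rule P.finite_measure_subadditive_finite) (use ev in auto)
        also have "\<dots> \<le> (\<Sum>k\<in>UNIV. B k * (3 / 4) ^ J)" by (intro sum_mono B)
        finally show ?thesis using J by simp
      qed
      then show "\<exists>R. \<forall>n. measure (\<mu> n) {x. \<exists>k. R \<le> \<bar>x $ k\<bar>} \<le> e" by blast
    qed
    then show ?case unfolding \<mu>_def .
  qed
qed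

theorem theorem7p1:
  fixes M :: "'a measure"
    and b \<gamma> :: real
    and W :: "nat \<Rightarrow> nat \<Rightarrow> real \<Rightarrow> 'a \<Rightarrow> real ^ 'd"
    and parent :: "nat \<Rightarrow> nat \<Rightarrow> 'a \<Rightarrow> nat"
    and Z :: "real \<Rightarrow> nat \<Rightarrow> 'a \<Rightarrow> real ^ 'd"
  assumes "interacting_branching_diffusion M b \<gamma> W parent Z"
    and "\<gamma> \<noteq> 0"
    and "b > 0"
    and "b + \<gamma> > 0"
  shows "prob_space (limit_measure b \<gamma> :: (real ^ 'd) measure) \<and>
    (AE \<omega> in M. weakly_converges
       (\<lambda>n. scale_measure (1 / 2 ^ n) (particle_measure Z (real n) \<omega>))
       (limit_measure b \<gamma>))"
  using prob_space_limit_measure[OF assms(4)]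
    interacting_branching_diffusion.empirical_measures_converge[OF assms(1,3,4)] by blast

end
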